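(* Let $\varepsilon,\delta,\beta_0\in\mathbb N^{-1}$, $\gamma=\min\{\beta_0/(2n),\delta/4\}$, $\mathcal M={\tt FastSample}_{n,\varepsilon,\gamma}$ and $b=1+\lceil\frac{9}{2\varepsilon}\ln\frac4\delta\rceil$. Then: (i) ${\tt StabilityHistogram}_{\mathcal M,b}$ is $(\varepsilon,\delta)$-differentially private; (ii) for every $\beta\ge2\gamma$, ${\tt StabilityHistogram}_{\mathcal M,b}$ has $(a,\beta)$-per-query accuracy on counts larger than $t$, where $a=\lceil\frac{9}{2\varepsilon}\ln\frac2\beta\rceil$ and $t=2+\lceil\frac{9}{2\varepsilon}\ln\frac{8}{\beta\delta}\rceil$; (iii) for every $\beta\ge\beta_0$, ${\tt StabilityHistogram}_{\mathcal M,b}$ has $(a,\beta)$-simultaneous accuracy with $a=2+\lceil\frac{9}{2\varepsilon}\ln\frac{8n}{\beta\delta}\rceil$; (iv) if $b\in[n]$, ${\tt StabilityHistogram}_{\mathcal M,b}$ has running time $\tilde O\bigl(\frac n\varepsilon\log\frac{1}{\beta_0\delta}\bigr)+O(n\log n\cdot\log|\mathcal X|)$.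
   Context: Notation: $\mathbb N_+=\{1,2,\dots\}$, $\mathbb N^{-1}=\{1/k:k\in\mathbb N_+\}$, $[n]=\{0,\dots,n\}$, $[n]_+=\{1,\dots,n\}$, $\log$ base 2. A dataset is $D\in\mathcal X^n$ over a finite universe $\mathcal X=\{1,\dots,m\}$; neighbors differ in exactly one row; $c_x(D)=|\{i:D_i=x\}|$. $(\varepsilon,\delta)$-differential privacy: for all neighbors $D,D'$ and output sets $S$, $\Pr[\mathcal M(D)\in S]\le e^\varepsilon\Pr[\mathcal M(D')\in S]+\delta$. ${\tt FastSample}_{n,\varepsilon,\gamma}:[n]\times[d]_+\to[n]$ is the deterministic algorithm: let $k=\lceil\log(2/\varepsilon)\rceil$, $t_0=\lceil\frac{9}{2\varepsilon}\lceil\log\frac{8(n+1)(1-\gamma)}{\varepsilon\gamma}\rceil\rceil-1$, $d'=(2^{k+1}+1)(2^k+1)^{t_0}$, $d=(n+1)d'/\gamma$. Given $c\in[n]$, for integers $z$ let $F'(z)=0$ if $z<\max\{0,c-t_0\}$; $F'(z)=2^{k(c-z)}(2^k+1)^{t_0+1-(c-z)}-2^{k(t_0+1)}$ if $\max\{0,c-t_0\}\le z<c$; $F'(z)=d'-2^{k(z-c+1)}(2^k+1)^{t_0-(z-c)}+2^{k(t_0+1)}$ if $c\le z<\min\{c+t_0,n\}$; $F'(z)=d'$ if $z\ge\min\{c+t_0,n\}$; $F(z)=(z+1)d'+(1/\gamma-1)(n+1)F'(z)$. On input $(c,u)$ it outputs the smallest $z\in[n]$ with $F(z)\ge u$, by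 binary search. ${\tt StabilityHistogram}_{\mathcal M,b}(D)$: let $A=\{x:c_x(D)>0\}$; for each $x\in A$ independently sample $u_x\sim\mathrm{Unif}([d]_+)$ and set $\tilde c_x=\mathcal M(c_x(D),u_x)$; release $\{(x,\tilde c_x):x\in A,\tilde c_x>b\}$, identified with the histogram equal to $\tilde c_x$ on released $x$ and $0$ elsewhere. A histogram algorithm $\mathcal H$ has $(a,\beta)$-per-query accuracy on counts larger than $t$ if $\Pr[|\mathcal H(D)_x-c_x(D)|\le a]\ge1-\beta$ for all $D$ and all $x$ with $c_x(D)>t$, and $(a,\beta)$-simultaneous accuracy if $\Pr[\forall x:|\mathcal H(D)_x-c_x(D)|\le a]\ge1-\beta$ for all $D$. Running times are in the $w$-bit word RAM model with $w=O(\log n+\log\log|\mathcal X|)$, unit-cost oracle returning a uniform element of $[d]_+$, multiplication of $x$-bit integers in $\tilde O(x)$, partial histograms stored in balanced search trees.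
   Formalization: In (iv) the factor log(1/(β0δ)) is read as max{1, log(1/(β0δ))}; this differs only for β0 = δ = 1, where the literal bound is 0 when |X| = 1 and hence false. *)

theory Defs
  imports
    "HOL-Probability.Probability"
    "HOL-Library.Tree"
    "HOL-Library.Log_Nat"
    "HOL-Library.Landau_Symbols"
begin

section \<open>Datasets, privacy and accuracy\<close>

definition unit_fractions :: "real set" where
  "unit_fractions = {1 / real k | k. k > (0::nat)}"

text \<open>The universe is \<open>{1..m}\<close>; a dataset is the list of its \<open>n\<close> rows.\<close>

definition datasets :: "nat \<Rightarrow> nat \<Rightarrow> nat list set" where
  "datasets n m = {D. length D = n \<and> set D \<subseteq> {1..m}}"

definition neighbors :: "nat list \<Rightarrow> nat list \<Rightarrow> bool" where
  "neighbors D D' \<longleftrightarrow> length D = length D' \<and> card {i. i < length D \<and> D ! i \<noteq> D' ! i} = 1"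

definition row_count :: "nat list \<Rightarrow> nat \<Rightarrow> nat" where
  "row_count D x = card {i. i < length D \<and> D ! i = x}"

definition differentially_private ::
    "nat \<Rightarrow> nat \<Rightarrow> real \<Rightarrow> real \<Rightarrow> (nat list \<Rightarrow> 'o pmf) \<Rightarrow> bool" where
  "differentially_private n m \<epsilon> \<delta> M \<longleftrightarrow>
     (\<forall>D\<in>datasets n m. \<forall>D'\<in>datasets n m. neighbors D D' \<longrightarrow>
       (\<forall>S. measure_pmf.prob (M D) S \<le> exp \<epsilon> * measure_pmf.prob (M D') S + \<delta>))"

text \<open>A released set of pairs \<open>(x, v)\<close> (one per released \<open>x\<close>) is a partial map; it is read as
  the histogram that is \<open>0\<close> off its domain.\<close>

type_synonym partial_histogram = "nat \<rightharpoonup> nat"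

definition hist_value :: "partial_histogram \<Rightarrow> nat \<Rightarrow> nat" where
  "hist_value h x = (case h x of None \<Rightarrow> 0 | Some v \<Rightarrow> v)"

definition per_query_accuracy ::
    "nat \<Rightarrow> nat \<Rightarrow> int \<Rightarrow> real \<Rightarrow> int \<Rightarrow> (nat list \<Rightarrow> partial_histogram pmf) \<Rightarrow> bool" where
  "per_query_accuracy n m a \<beta> t H \<longleftrightarrow>
     (\<forall>D\<in>datasets n m. \<forall>x\<in>{1..m}. int (row_count D x) > t \<longrightarrow>
       measure_pmf.prob (H D) {h. \<bar>int (hist_value h x) - int (row_count D x)\<bar> \<le> a} \<ge> 1 - \<beta>)"

definition simultaneous_accuracy ::
    "nat \<Rightarrow> nat \<Rightarrow> int \<Rightarrow> real \<Rightarrow> (nat list \<Rightarrow> partial_histogram pmf) \<Rightarrow> bool" where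
  "simultaneous_accuracy n m a \<beta> H \<longleftrightarrow>
     (\<forall>D\<in>datasets n m.
       measure_pmf.prob (H D)
         {h. \<forall>x\<in>{1..m}. \<bar>int (hist_value h x) - int (row_count D x)\<bar> \<le> a} \<ge> 1 - \<beta>)"

section \<open>FastSample and StabilityHistogram\<close>

definition fs_k :: "real \<Rightarrow> nat" where
  "fs_k \<epsilon> = nat \<lceil>log 2 (2 / \<epsilon>)\<rceil>"

definition fs_t0 :: "nat \<Rightarrow> real \<Rightarrow> real \<Rightarrow> nat" where
  "fs_t0 n \<epsilon> \<gamma> =
     nat (\<lceil>9 / (2 * \<epsilon>) * real_of_int \<lceil>log 2 (8 * (real n + 1) * (1 - \<gamma>) / (\<epsilon> * \<gamma>))\<rceil>\<rceil> - 1)"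

definition fs_d' :: "nat \<Rightarrow> real \<Rightarrow> real \<Rightarrow> nat" where
  "fs_d' n \<epsilon> \<gamma> = (2 ^ (fs_k \<epsilon> + 1) + 1) * (2 ^ fs_k \<epsilon> + 1) ^ fs_t0 n \<epsilon> \<gamma>"

text \<open>\<open>(n + 1) d' / \<gamma>\<close>, which is an integer when \<open>1 / \<gamma>\<close> is.\<close>

definition fs_d :: "nat \<Rightarrow> real \<Rightarrow> real \<Rightarrow> nat" where
  "fs_d n \<epsilon> \<gamma> = nat \<lfloor>(real n + 1) * real (fs_d' n \<epsilon> \<gamma>) / \<gamma>\<rfloor>"

text \<open>In each branch the exponents passed to \<^const>\<open>nat\<close> are nonnegative.\<close>

definition fs_F' :: "nat \<Rightarrow> real \<Rightarrow> real \<Rightarrow> nat \<Rightarrow> int \<Rightarrow> int" where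
  "fs_F' n \<epsilon> \<gamma> c z =
    (let k = fs_k \<epsilon>; t0 = fs_t0 n \<epsilon> \<gamma>; d' = int (fs_d' n \<epsilon> \<gamma>) in
     if z < max 0 (int c - int t0) then 0
     else if z < int c then
       2 ^ (k * nat (int c - z)) * (2 ^ k + 1) ^ nat (int t0 + 1 - (int c - z)) - 2 ^ (k * (t0 + 1))
     else if z < min (int c + int t0) (int n) then
       d' - 2 ^ (k * nat (z - int c + 1)) * (2 ^ k + 1) ^ nat (int t0 - (z - int c))
          + 2 ^ (k * (t0 + 1))
     else d')"

definition fs_F :: "nat \<Rightarrow> real \<Rightarrow> real \<Rightarrow> nat \<Rightarrow> int \<Rightarrow> real" where
  "fs_F n \<epsilon> \<gamma> c z =
     (real_of_int z + 1) * real (fs_d' n \<epsilon> \<gamma>)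
     + (1 / \<gamma> - 1) * (real n + 1) * real_of_int (fs_F' n \<epsilon> \<gamma> c z)"

definition fast_sample :: "nat \<Rightarrow> real \<Rightarrow> real \<Rightarrow> nat \<Rightarrow> nat \<Rightarrow> nat" where
  "fast_sample n \<epsilon> \<gamma> c u = (LEAST z. z \<le> n \<and> fs_F n \<epsilon> \<gamma> c (int z) \<ge> real u)"

definition stability_histogram ::
    "(nat \<Rightarrow> nat \<Rightarrow> nat) \<Rightarrow> nat \<Rightarrow> nat \<Rightarrow> nat list \<Rightarrow> partial_histogram pmf" where
  "stability_histogram M d b D =
    (let A = {x. row_count D x > 0} in
     map_pmf
       (\<lambda>u x. if x \<in> A \<and> M (row_count D x) (u x) > b then Some (M (row_count D x) (u x)) else None)
       (Pi_pmf A 0 (\<lambda>_. pmf_of_set {1..d})))"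

section \<open>Balanced search trees\<close>

text \<open>Dictionaries are AVL trees whose nodes hold a key, a value and the height of the subtree.\<close>

type_synonym dict = "((nat \<times> nat) \<times> nat) tree"

fun ht :: "dict \<Rightarrow> nat" where
  "ht Leaf = 0"
| "ht (Node l (_, h) r) = h"

definition mk_node :: "dict \<Rightarrow> nat \<times> nat \<Rightarrow> dict \<Rightarrow> dict" where
  "mk_node l p r = Node l (p, 1 + max (ht l) (ht r)) r"

fun rotate_right :: "dict \<Rightarrow> nat \<times> nat \<Rightarrow> dict \<Rightarrow> dict" where
  "rotate_right (Node ll (q, _) lr) p r = mk_node ll q (mk_node lr p r)"
| "rotate_right Leaf p r = mk_node Leaf p r"

fun rotate_left :: "dict \<Rightarrow> nat \<times> nat \<Rightarrow> dict \<Rightarrow> dict" where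
  "rotate_left l p (Node rl (q, _) rr) = mk_node (mk_node l p rl) q rr"
| "rotate_left l p Leaf = mk_node l p Leaf"

fun lean_left :: "dict \<Rightarrow> dict" where
  "lean_left (Node l (p, h) r) = (if ht l < ht r then rotate_left l p r else Node l (p, h) r)"
| "lean_left Leaf = Leaf"

fun lean_right :: "dict \<Rightarrow> dict" where
  "lean_right (Node l (p, h) r) = (if ht r < ht l then rotate_right l p r else Node l (p, h) r)"
| "lean_right Leaf = Leaf"

definition rebalance :: "dict \<Rightarrow> nat \<times> nat \<Rightarrow> dict \<Rightarrow> dict" where
  "rebalance l p r =
    (if ht l > ht r + 1 then rotate_right (lean_left l) p r
     else if ht r > ht l + 1 then rotate_left l p (lean_right r)
     else mk_node l p r)"

definition dict_map :: "dict \<Rightarrow> partial_histogram" where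
  "dict_map t = map_of (map fst (inorder t))"

fun avl :: "dict \<Rightarrow> bool" where
  "avl Leaf \<longleftrightarrow> True"
| "avl (Node l (p, h) r) \<longleftrightarrow>
     avl l \<and> avl r \<and> h = 1 + max (ht l) (ht r) \<and> ht l \<le> ht r + 1 \<and> ht r \<le> ht l + 1"

definition avl_search_tree :: "dict \<Rightarrow> bool" where
  "avl_search_tree t \<longleftrightarrow> avl t \<and> sorted_wrt (<) (map (fst \<circ> fst) (inorder t))"

section \<open>Cost model\<close>

text \<open>
  The running time of StabilityHistogram is that of an implementation in a monad of randomized
  computations that carry the number of steps made on a \<open>w\<close>-bit word RAM.  The implementation uses
  only the operations charged for below, monadic sequencing, conditionals on computed booleans,
  tuples of references, recursion on trees, and the two loop combinators.  Integers are arrays of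
  \<open>w\<close>-bit words; the cost of an operation is, up to a constant factor, the number of words it
  touches, except that a multiplication of \<open>x\<close>-bit integers costs \<open>mul_time x\<close>, an arbitrary function here.
\<close>

datatype 'a run = Run (outcomes: "('a \<times> nat) pmf")

definition charge :: "nat \<Rightarrow> 'a \<Rightarrow> 'a run" where
  "charge s x = Run (return_pmf (x, s))"

definition ret :: "'a \<Rightarrow> 'a run" where
  "ret x = charge 0 x"

definition bind_run :: "'a run \<Rightarrow> ('a \<Rightarrow> 'b run) \<Rightarrow> 'b run" where
  "bind_run p f =
     Run (bind_pmf (outcomes p) (\<lambda>(x, s). map_pmf (\<lambda>(y, s'). (y, s + s')) (outcomes (f x))))"

adhoc_overloading Monad_Syntax.bind \<rightleftharpoons> bind_run

primrec loop :: "nat \<Rightarrow> ('s \<Rightarrow> 's run) \<Rightarrow> 's \<Rightarrow> 's run" where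
  "loop 0 f s = charge 1 s"
| "loop (Suc i) f s = do { s' \<leftarrow> charge 1 s; s'' \<leftarrow> f s'; loop i f s'' }"

primrec for_each :: "'a list \<Rightarrow> ('a \<Rightarrow> 's \<Rightarrow> 's run) \<Rightarrow> 's \<Rightarrow> 's run" where
  "for_each [] f s = charge 1 s"
| "for_each (x # xs) f s = do { s' \<leftarrow> charge 1 s; s'' \<leftarrow> f x s'; for_each xs f s'' }"

text \<open>The oracle takes one step, however long \<open>d\<close> is.\<close>

definition rand_oracle :: "nat \<Rightarrow> nat run" where
  "rand_oracle d = Run (map_pmf (\<lambda>u. (u, 1)) (pmf_of_set {1..d}))"

context
  fixes w :: nat and mul_time :: "nat \<Rightarrow> nat"
begin

text \<open>\<open>floorlog 2 x\<close> is the number of bits of \<open>x\<close>.\<close>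

definition word_count :: "nat \<Rightarrow> nat" where
  "word_count x = max 1 ((floorlog 2 x + w - 1) div w)"

definition op_add :: "nat \<Rightarrow> nat \<Rightarrow> nat run" where
  "op_add x y = charge (word_count x + word_count y) (x + y)"

definition op_sub :: "nat \<Rightarrow> nat \<Rightarrow> nat run" where
  "op_sub x y = charge (word_count x + word_count y) (x - y)"

definition op_less :: "nat \<Rightarrow> nat \<Rightarrow> bool run" where
  "op_less x y = charge (word_count x + word_count y) (x < y)"

definition op_half :: "nat \<Rightarrow> nat run" where
  "op_half x = charge (word_count x) (x div 2)"

definition op_odd :: "nat \<Rightarrow> bool run" where
  "op_odd x = charge 1 (odd x)"

definition op_shift :: "nat \<Rightarrow> nat \<Rightarrow> nat run" where
  "op_shift x i = charge (word_count i + word_count (x * 2 ^ i)) (x * 2 ^ i)"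

definition op_mult :: "nat \<Rightarrow> nat \<Rightarrow> nat run" where
  "op_mult x y = charge (mul_time (max (floorlog 2 x) (floorlog 2 y))) (x * y)"

text \<open>The leading word is scanned bit by bit.\<close>

definition op_bits :: "nat \<Rightarrow> nat run" where
  "op_bits x = charge (word_count x + w) (floorlog 2 x)"

text \<open>\<open>f\<close> computes the new value of \<open>x\<close> from the old one, if any.  Restoring the balance at a node on the search
  path takes a constant number of word operations, charged as one step.\<close>

fun dict_update :: "nat \<Rightarrow> (nat option \<Rightarrow> nat run) \<Rightarrow> dict \<Rightarrow> dict run" where
  "dict_update x f Leaf = do {
     v \<leftarrow> f None;
     charge (1 + word_count x) (mk_node Leaf (x, v) Leaf) }"
| "dict_update x f (Node l ((y, v), h) r) = do {
     b1 \<leftarrow> op_less x y;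
     if b1 then do { l' \<leftarrow> dict_update x f l; charge 1 (rebalance l' (y, v) r) }
     else do {
       b2 \<leftarrow> op_less y x;
       if b2 then do { r' \<leftarrow> dict_update x f r; charge 1 (rebalance l (y, v) r') }
       else do { v' \<leftarrow> f (Some v); charge 1 (Node l ((y, v'), h) r) } } }"

definition dict_insert :: "nat \<Rightarrow> nat \<Rightarrow> dict \<Rightarrow> dict run" where
  "dict_insert x v = dict_update x (\<lambda>_. charge (word_count v) v)"

definition dict_increment :: "nat \<Rightarrow> dict \<Rightarrow> dict run" where
  "dict_increment x = dict_update x (\<lambda>c. case c of None \<Rightarrow> ret 1 | Some c' \<Rightarrow> op_add c' 1)"

text \<open>An inorder traversal passes each edge, leaves included, twice.\<close>

definition dict_entries :: "dict \<Rightarrow> (nat \<times> nat) list run" where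
  "dict_entries t = charge (1 + 4 * size t) (map fst (inorder t))"

section \<open>Implementation of StabilityHistogram\<close>

text \<open>\<open>\<lceil>log 2 x\<rceil>\<close> for \<open>x \<ge> 1\<close>.\<close>

definition ceil_log2_run :: "nat \<Rightarrow> nat run" where
  "ceil_log2_run x = do { y \<leftarrow> op_sub x 1; op_bits y }"

text \<open>Repeated squaring.\<close>

definition pow_run :: "nat \<Rightarrow> nat \<Rightarrow> nat run" where
  "pow_run x e = do {
     l \<leftarrow> op_bits e;
     (acc, _, _) \<leftarrow> loop l
       (\<lambda>(acc, y, i). do {
          o1 \<leftarrow> op_odd i;
          acc' \<leftarrow> (if o1 then op_mult acc y else ret acc);
          y' \<leftarrow> op_mult y y;
          i' \<leftarrow> op_half i;
          ret (acc', y', i') })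
       (1, x, e);
     ret acc }"

text \<open>
  The numbers \<open>k\<close>, \<open>t\<^sub>0\<close>, \<open>q = 2^k + 1\<close>, \<open>p = 2^(k (t\<^sub>0 + 1))\<close>, \<open>d'\<close>, \<open>d\<close>.  The rationals
  \<open>\<epsilon> = 1 / E\<close> and \<open>\<gamma> = 1 / G\<close> are given by \<open>E\<close> and \<open>G\<close>.  The ceilings are exact:
  \<open>(1 - \<gamma>) / (\<epsilon> \<gamma>) = E (G - 1)\<close> and \<open>\<lceil>9 / (2 \<epsilon>) * l\<rceil> = (9 E l + 1) div 2\<close>.
\<close>

definition fs_setup_run :: "nat \<Rightarrow> nat \<Rightarrow> nat \<Rightarrow> (nat \<times> nat \<times> nat \<times> nat \<times> nat \<times> nat) run" where
  "fs_setup_run n E G = do {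
     e2 \<leftarrow> op_shift E 1;
     k \<leftarrow> ceil_log2_run e2;
     n1 \<leftarrow> op_add n 1;
     g1 \<leftarrow> op_sub G 1;
     x1 \<leftarrow> op_mult n1 E;
     x2 \<leftarrow> op_mult x1 g1;
     x3 \<leftarrow> op_shift x2 3;
     l \<leftarrow> ceil_log2_run x3;
     y1 \<leftarrow> op_mult 9 E;
     y2 \<leftarrow> op_mult y1 l;
     y3 \<leftarrow> op_add y2 1;
     y4 \<leftarrow> op_half y3;
     t0 \<leftarrow> op_sub y4 1;
     q1 \<leftarrow> op_shift 1 k;
     q \<leftarrow> op_add q1 1;
     r1 \<leftarrow> op_shift q1 1;
     r \<leftarrow> op_add r1 1;
     qt \<leftarrow> pow_run q t0;
     d' \<leftarrow> op_mult r qt;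
     t1 \<leftarrow> op_add t0 1;
     kt \<leftarrow> op_mult k t1;
     p \<leftarrow> op_shift 1 kt;
     d1 \<leftarrow> op_mult n1 d';
     d \<leftarrow> op_mult d1 G;
     ret (k, t0, q, p, d', d) }"

text \<open>The natural-number subtractions below never truncate.\<close>

definition fs_F'_run ::
    "nat \<Rightarrow> nat \<times> nat \<times> nat \<times> nat \<times> nat \<times> nat \<Rightarrow> nat \<Rightarrow> nat \<Rightarrow> nat run" where
  "fs_F'_run n = (\<lambda>(k, t0, q, p, d', d) c z. do {
     zt \<leftarrow> op_add z t0;
     b1 \<leftarrow> op_less zt c;
     if b1 then ret 0 else do {
     b2 \<leftarrow> op_less z c;
     if b2 then do {
       i \<leftarrow> op_sub c z;
       ki \<leftarrow> op_mult k i;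
       t1 \<leftarrow> op_add t0 1;
       e \<leftarrow> op_sub t1 i;
       qe \<leftarrow> pow_run q e;
       v \<leftarrow> op_shift qe ki;
       op_sub v p }
     else do {
     ct \<leftarrow> op_add c t0;
     b3 \<leftarrow> op_less z ct;
     b4 \<leftarrow> op_less z n;
     if b3 \<and> b4 then do {
       i \<leftarrow> op_sub z c;
       i1 \<leftarrow> op_add i 1;
       ki \<leftarrow> op_mult k i1;
       e \<leftarrow> op_sub t0 i;
       qe \<leftarrow> pow_run q e;
       v \<leftarrow> op_shift qe ki;
       dp \<leftarrow> op_add d' p;
       op_sub dp v }
     else ret d' } } })"

definition fs_F_run ::
    "nat \<Rightarrow> nat \<Rightarrow> nat \<times> nat \<times> nat \<times> nat \<times> nat \<times> nat \<Rightarrow> nat \<Rightarrow> nat \<Rightarrow> nat run" where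
  "fs_F_run n G = (\<lambda>(k, t0, q, p, d', d) c z. do {
     f \<leftarrow> fs_F'_run n (k, t0, q, p, d', d) c z;
     z1 \<leftarrow> op_add z 1;
     zd \<leftarrow> op_mult z1 d';
     g1 \<leftarrow> op_sub G 1;
     n1 \<leftarrow> op_add n 1;
     gn \<leftarrow> op_mult g1 n1;
     gf \<leftarrow> op_mult gn f;
     op_add zd gf })"

text \<open>Binary search on \<open>[lo, hi]\<close>, an interval containing the answer, for as many rounds as \<open>n\<close>
  has bits.\<close>

definition fast_sample_run ::
    "nat \<Rightarrow> nat \<Rightarrow> nat \<times> nat \<times> nat \<times> nat \<times> nat \<times> nat \<Rightarrow> nat \<Rightarrow> nat \<Rightarrow> nat run" where
  "fast_sample_run n G consts c u = do {
     l \<leftarrow> op_bits n;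
     (lo, _) \<leftarrow> loop l
       (\<lambda>(lo, hi). do {
          more \<leftarrow> op_less lo hi;
          if more then do {
            s \<leftarrow> op_add lo hi;
            mid \<leftarrow> op_half s;
            v \<leftarrow> fs_F_run n G consts c mid;
            small \<leftarrow> op_less v u;
            if small then do { lo' \<leftarrow> op_add mid 1; ret (lo', hi) } else ret (lo, mid) }
          else ret (lo, hi) })
       (0, n);
     ret lo }"

definition stability_histogram_run ::
    "nat \<Rightarrow> nat \<Rightarrow> nat \<Rightarrow> nat \<Rightarrow> nat list \<Rightarrow> dict run" where
  "stability_histogram_run n E G b D = do {
     (k, t0, q, p, d', d) \<leftarrow> fs_setup_run n E G;
     counts \<leftarrow> for_each D dict_increment Leaf;
     cs \<leftarrow> dict_entries counts;
     for_each cs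
       (\<lambda>(x, c) rel. do {
          u \<leftarrow> rand_oracle d;
          v \<leftarrow> fast_sample_run n G (k, t0, q, p, d', d) c u;
          keep \<leftarrow> op_less b v;
          if keep then dict_insert x v rel else ret rel })
       Leaf }"

end

section \<open>Asymptotics\<close>

text \<open>Soft-O on the tail of \<open>F\<close>; with \<open>F = principal Q\<close> the bound, and its constants, are uniform
  over all of \<open>Q\<close>.\<close>

definition soft_bigo :: "'a filter \<Rightarrow> ('a \<Rightarrow> real) \<Rightarrow> ('a \<Rightarrow> real) set" where
  "soft_bigo F g = (\<Union>j::nat. O[F](\<lambda>x. g x * log 2 (g x) ^ j))"

text \<open>\<open>w = O(log n + log log m)\<close> with constant \<open>K\<close>, where words are long enough for row indices.
  For \<open>m = 1\<close> the summand \<open>log 2 (log 2 m)\<close> is \<open>0\<close> in HOL.\<close>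

definition word_length_ok :: "real \<Rightarrow> nat \<Rightarrow> nat \<Rightarrow> nat \<Rightarrow> bool" where
  "word_length_ok K n m w \<longleftrightarrow>
     log 2 (real n) + log 2 (log 2 (real m)) \<le> real w \<and>
     real w \<le> K * (log 2 (real n) + log 2 (log 2 (real m)))"

text \<open>The program samples from the given distribution of partial histograms (stored as search
  trees), and makes at most \<open>T\<close> steps, whatever the random choices are.\<close>

definition implements_within ::
    "dict run \<Rightarrow> partial_histogram pmf \<Rightarrow> real \<Rightarrow> bool" where
  "implements_within prog H T \<longleftrightarrow>
     map_pmf (\<lambda>(t, s). dict_map t) (outcomes prog) = H \<and>
     (\<forall>(t, s) \<in> set_pmf (outcomes prog). avl_search_tree t \<and> real s \<le> T)"

end

(*
  FastSample draws from the mixture of the uniform distribution (weight gamma) and of a truncated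
  two-sided geometric distribution with ratio r = 2^k / (2^k + 1), clamped to {0..n}.  Write rho for
  the mass that the truncation cuts off on each side.  Then every point mass of the clamped truncated
  distribution is within 2 rho of the one of the clamped geometric distribution, whose masses change
  by a factor of at most 1/r = 1 + 2^-k <= exp(epsilon / 2) if the center moves by one; t0 is so large
  that the mass gamma / (n + 1) of the uniform part absorbs the error 4 rho.  Since a change of one row
  moves two counts by one, privacy follows by composition; a count that drops from 1 to 0 disappears
  from the output, but was released with probability at most delta / 2 only.  The accuracy bounds are
  tail bounds and a union bound, based on r <= exp(-2 epsilon / 9), which is ln(1 + x) >= 2x / (2 + x)
  at x = epsilon / 4.

  For the running time, every number that the program handles is at most 16 d, so that each
  operation costs at most some U; d has O(L^2 Lambda / epsilon) bits, where Lambda is the maximum of 1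
  and log(1 / (beta0 delta)) and L is the logarithm of n Lambda / epsilon.  The logarithmic search, with
  a power by repeated squaring in each round, adds further powers of L.  What depends on the universe
  are the word length and the key comparisons in the search trees.
*)
theory Submission
  imports Defs
begin

section \<open>Truncated geometric distributions and FastSample\<close>

text \<open>Rounding \<open>log 2 (2 / \<epsilon>)\<close> up pins \<open>2^-k\<close> between
  \<epsilon>/4 and \<epsilon>/2. The upper bound limits the ratio of neighboring masses, the lower
  one makes the tails decay. The constant 9/2 is the worst case \<epsilon> = 1 of the decay rate
  \<open>ln (1 + \<epsilon>/4)\<close> under the rational lower bound; the simpler bound x / (1 + x)
  would give 5. Truncation serves integrality: distances up to n would bring powers of
  \<open>q\<close> up to about n into the denominators, whereas \<open>d'\<close> clears them all
  once distances stop at \<open>t0\<close>. The price is that the truncated distributions of two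
  neighboring counts may have different supports, which rules out a ratio bound between them; hence
  the detour through the untruncated masses and the need for a uniform part that pays for it. On the
  program side everything but the oracle call is deterministic, so that most of the work is done
  with a calculus of exact results and step bounds; probability enters only in the loop that
  releases the values. In the time bound, b \<in> {0..n} forces n \<ge> 8, so that
  \<open>log 2 n\<close> is at least 3 and absorbs additive constants.\<close>

lemma ln_one_plus_ge:
  fixes x :: real
  assumes "0 \<le> x"
  shows "2 * x / (2 + x) \<le> ln (1 + x)"
proof -
  define f where "f = (\<lambda>x::real. ln (1 + x) - 2 * x / (2 + x))"
  have "f 0 \<le> f x"
  proof (rule DERIV_nonneg_imp_nondecreasing[OF assms])
    fix y :: real assume y: "0 \<le> y" "y \<le> x"
    have "(f has_real_derivative (1 / (1 + y) - (2 * (2 + y) - 2 * y) / (2 + y)\<^sup>2)) (at y)"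
      unfolding f_def using y by (auto intro!: derivative_eq_intros simp: power2_eq_square)
    moreover have "1 / (1 + y) - (2 * (2 + y) - 2 * y) / (2 + y)\<^sup>2 = y\<^sup>2 / ((1 + y) * (2 + y)\<^sup>2)"
      using y by (simp add: divide_simps) (simp add: power2_eq_square algebra_simps)
    moreover have "y\<^sup>2 / ((1 + y) * (2 + y)\<^sup>2) \<ge> 0" using y by simp
    ultimately show "\<exists>D. DERIV f y :> D \<and> 0 \<le> D" by metis
  qed
  then show ?thesis by (simp add: f_def)
qed

lemma ceiling_half: "\<lceil>real m / 2\<rceil> = int ((m + 1) div 2)"
  by (rule ceiling_unique) linarith+

lemma ceiling_log2:
  assumes "x \<ge> 1"
  shows "\<lceil>log 2 (real x)\<rceil> = int (ceillog2 x)"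
proof -
  have "0 \<le> log 2 (real x)" using assms by simp
  then have "0 \<le> \<lceil>log 2 (real x)\<rceil>" by linarith
  then show ?thesis using assms by (simp add: ceillog2_def)
qed

section \<open>Integer parameters of the sampler\<close>

locale fast_sample_params =
  fixes n E G :: nat
  assumes n: "1 \<le> n" and E: "1 \<le> E" and G: "4 \<le> G"
begin

definition k :: nat where "k = ceillog2 (2 * E)"
definition lg :: nat where "lg = ceillog2 (8 * (n + 1) * E * (G - 1))"
definition t0 :: nat where "t0 = (9 * E * lg + 1) div 2 - 1"
definition q :: nat where "q = 2 ^ k + 1"
definition d' :: nat where "d' = (2 ^ (k + 1) + 1) * q ^ t0"
definition d :: nat where "d = (n + 1) * d' * G"

abbreviation \<epsilon> :: real where "\<epsilon> \<equiv> 1 / real E"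
abbreviation \<gamma> :: real where "\<gamma> \<equiv> 1 / real G"

lemma k_bounds: "2 * E \<le> 2 ^ k" "2 ^ k < 4 * E"
  using le_two_power_ceillog2[of "2 * E"] two_power_ceillog2_gt[of "2 * E"] E by (auto simp: k_def)

lemma lg_bounds: "8 * (n + 1) * E * (G - 1) \<le> 2 ^ lg" "6 \<le> lg"
proof -
  show *: "8 * (n + 1) * E * (G - 1) \<le> 2 ^ lg"
    unfolding lg_def by (rule le_two_power_ceillog2)
  define X where "X = 8 * (n + 1) * E * (G - 1)"
  \<comment> \<open>The least admissible values give 48 > 32 = \<open>2 ^ 5\<close>. The resulting
    bound 6 lets \<open>(5/4) ^ lg\<close> exceed 2 in \<open>\<rho>_le\<close>.\<close>
  have "8 * (1 + 1) * 1 * (4 - 1) \<le> X"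
    unfolding X_def using n E G by (intro mult_le_mono diff_le_mono) auto
  then have "6 \<le> ceillog2 X" by (subst ceillog2_ge_iff) auto
  then show "6 \<le> lg" unfolding lg_def X_def .
qed

lemma t0_Suc: "t0 + 1 = (9 * E * lg + 1) div 2"
proof -
  have "9 * 1 * 6 \<le> 9 * E * lg" using E lg_bounds(2) by (intro mult_le_mono) auto
  then show ?thesis unfolding t0_def by simp
qed

lemma t0_ge: "9 * real E * real lg / 2 \<le> real (t0 + 1)"
proof -
  have "9 * E * lg \<le> 2 * (t0 + 1)" unfolding t0_Suc by simp
  from of_nat_mono[OF this, where 'a = real] show ?thesis by simp
qed

lemma fs_k_eq: "fs_k \<epsilon> = k"
  using E ceiling_log2[of "2 * E"] by (simp add: fs_k_def k_def)

lemma fs_t0_eq: "fs_t0 n \<epsilon> \<gamma> = t0"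
proof -
  have eq: "8 * (real n + 1) * (1 - \<gamma>) / (\<epsilon> * \<gamma>) = real (8 * (n + 1) * E * (G - 1))"
    using E G by (simp add: field_simps of_nat_diff)
  have "8 * (n + 1) * E * (G - 1) \<ge> 1" using E G by simp
  from ceiling_log2[OF this] have lg: "\<lceil>log 2 (real (8 * (n + 1) * E * (G - 1)))\<rceil> = int lg"
    by (simp add: lg_def)
  have "9 / (2 * \<epsilon>) * real lg = real (9 * E * lg) / 2" using E by simp
  then show ?thesis
    unfolding fs_t0_def eq lg of_int_of_nat_eq t0_def
    by (metis ceiling_half nat_diff_distrib' nat_int nat_one_as_int of_nat_0_le_iff of_nat_1)
qed

lemma fs_d'_eq: "fs_d' n \<epsilon> \<gamma> = d'"
  by (simp add: fs_d'_def d'_def fs_k_eq fs_t0_eq q_def)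

lemma fs_d_eq: "fs_d n \<epsilon> \<gamma> = d"
proof -
  have "(real n + 1) * real (fs_d' n \<epsilon> \<gamma>) / \<gamma> = real d"
    by (simp add: fs_d'_eq d_def del: mult_Suc)
  then show ?thesis by (simp add: fs_d_def)
qed

lemma d'_pos: "d' > 0" and d_pos: "d > 0"
  using G by (auto simp: d'_def q_def d_def)

section \<open>The truncated two-sided geometric distribution\<close>

definition r :: real where "r = 2 ^ k / real q"
text \<open>For Z with masses \<open>(1 - r) / (1 + r) * r ^ |z|\<close> this is the probability of
  Z \<ge> i, and by symmetry that of Z \<le> -i.\<close>

definition geo :: "nat \<Rightarrow> real" where "geo i = r ^ i / (1 + r)"
definition \<rho> :: real where "\<rho> = r ^ (t0 + 1) / (1 + r)"
text \<open>Lowering the tail probabilities on both sides by \<rho> moves the mass beyond distance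
  \<open>t0\<close> to the center.\<close>

definition tail :: "nat \<Rightarrow> real" where "tail i = max 0 (geo i - \<rho>)"
definition \<eta> :: real where "\<eta> = 1 / 2 ^ k"

lemma r_eq: "r = 1 / (1 + \<eta>)" and \<eta>_pos: "0 < \<eta>" and \<eta>_le: "\<eta> \<le> \<epsilon> / 2" "\<eta> \<le> 1 / 2"
  and \<eta>_ge: "1 / (4 * real E) \<le> \<eta>"
proof -
  show "r = 1 / (1 + \<eta>)" unfolding r_def q_def \<eta>_def by (simp add: field_simps)
  show "0 < \<eta>" by (simp add: \<eta>_def)
  have "real (2 * E) \<le> real (2 ^ k)" "real (2 ^ k) \<le> real (4 * E)"
    using k_bounds by (intro of_nat_mono; simp)+
  then have *: "2 * real E \<le> 2 ^ k" "2 ^ k \<le> 4 * real E" by simp_all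
  show "\<eta> \<le> \<epsilon> / 2" "1 / (4 * real E) \<le> \<eta>" using * E by (auto simp: \<eta>_def field_simps)
  have "\<epsilon> / 2 \<le> 1/2" using E by simp
  with \<open>\<eta> \<le> \<epsilon> / 2\<close> show "\<eta> \<le> 1/2" by linarith
qed

lemma r_bounds: "0 < r" "r < 1" "r * (1 + \<eta>) = 1"
  using \<eta>_pos \<eta>_le by (auto simp: r_eq field_simps)

lemma r_le_exp: "r \<le> exp (- (2 / (9 * real E)))"
proof -
  \<comment> \<open>The right side equals 2 / (8 E + 1), so this is E \<ge> 1; it is tight at E =
    1.\<close>
  have "2 / (9 * real E) \<le> 2 * (1 / (4 * real E)) / (2 + 1 / (4 * real E))"
    using E by (simp add: divide_simps)
  also have "\<dots> \<le> ln (1 + 1 / (4 * real E))"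
    by (rule ln_one_plus_ge) simp
  also have "\<dots> \<le> ln (1 + \<eta>)" using \<eta>_ge \<eta>_pos by (subst ln_le_cancel_iff) (auto intro: add_pos_nonneg)
  finally have "exp (2 / (9 * real E)) \<le> 1 + \<eta>"
    using \<eta>_pos by (subst (asm) ln_ge_iff) auto
  then show ?thesis unfolding r_eq exp_minus using \<eta>_pos by (simp add: field_simps)
qed

lemma r_power_le:
  assumes "9 / 2 * real E * y \<le> real a"
  shows "r ^ a \<le> exp (- y)"
proof -
  have "r ^ a \<le> exp (- (2 / (9 * real E))) ^ a"
    using r_le_exp r_bounds by (intro power_mono) auto
  also have "\<dots> = exp (- (2 / (9 * real E) * real a))"
    by (simp flip: exp_of_nat_mult)
  also have "\<dots> \<le> exp (- y)"
    using assms E by (simp add: field_simps)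
  finally show ?thesis .
qed

text \<open>Multiplied by 1 - \<gamma>, the right side is \<eta> times the mass \<gamma> / (n + 1)
  of a point under the uniform part: the slack that \<open>pmf_smp_ratio\<close> can spend. The
  logarithm in \<open>t0\<close> has base 2 while \<open>r ^ (t0 + 1)\<close> decays with base e;
  the surplus \<open>(5/4) ^ lg\<close> supplies a factor 2 that the 8 in \<open>lg\<close> alone
  would leave missing.\<close>

lemma \<rho>_le: "4 * \<rho> \<le> \<eta> / (real (G - 1) * (real n + 1))" and \<rho>_nonneg: "0 \<le> \<rho>"
proof -
  define X where "X = real (8 * (n + 1) * E * (G - 1))"
  have X: "X \<le> 2 ^ lg" unfolding X_def using of_nat_mono[OF lg_bounds(1), where 'a = real] by simp
  have X_eq: "X = 8 * (real n + 1) * real E * real (G - 1)" by (simp add: X_def)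
  have G1: "real (G - 1) > 0" using G by simp
  then have Xpos: "X > 0" unfolding X_eq using E by (intro mult_pos_pos) auto
  have aux: "4 * inverse (8 * a * b * g * 2) = 1 / (4 * b) / (g * a)" if "a > 0" "b > 0" "g > 0" for a b g :: real
    using that by (simp add: field_simps)
  have "r ^ (t0 + 1) \<le> exp (- real lg)"
    using t0_ge by (intro r_power_le) simp
  also have "exp (- real lg) = inverse (exp 1 ^ lg)"
    by (simp add: exp_minus flip: exp_of_nat_mult)
  also have "(5 / 2) ^ lg \<le> exp (1::real) ^ lg"
    using abs_le_D2[OF e_approx_32] by (intro power_mono) simp_all
  then have "inverse (exp 1 ^ lg) \<le> inverse ((5 / 2 :: real) ^ lg)"
    by (intro le_imp_inverse_le) auto
  also have "(5 / 2 :: real) ^ lg = 2 ^ lg * (5/4) ^ lg" by (simp flip: power_mult_distrib)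
  also have "inverse \<dots> \<le> inverse (X * 2)"
  proof (intro le_imp_inverse_le mult_mono X)
    have "(5/4::real) ^ 6 \<le> (5/4) ^ lg" using lg_bounds by (intro power_increasing) auto
    then show "2 \<le> (5/4::real) ^ lg" by (simp add: power_numeral_reduce)
  qed (use Xpos in auto)
  finally have *: "r ^ (t0 + 1) \<le> inverse (X * 2)" .
  have "\<rho> \<le> r ^ (t0 + 1)" unfolding \<rho>_def using r_bounds by (simp add: field_simps)
  then have "4 * \<rho> \<le> 4 * inverse (X * 2)" using * by linarith
  also have "\<dots> = 1 / (4 * real E) / (real (G - 1) * (real n + 1))"
    unfolding X_eq using E G1 by (intro aux) auto
  also have "\<dots> \<le> \<eta> / (real (G - 1) * (real n + 1))"
    using \<eta>_ge G by (intro divide_right_mono) auto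
  finally show "4 * \<rho> \<le> \<eta> / (real (G - 1) * (real n + 1))" .
  show "0 \<le> \<rho>" using r_bounds by (simp add: \<rho>_def)
qed

lemma geo_antimono: "i \<le> j \<Longrightarrow> geo j \<le> geo i"
  unfolding geo_def using r_bounds by (intro divide_right_mono power_decreasing) auto

lemma geo_pos: "geo i > 0"
  unfolding geo_def using r_bounds by auto

lemma geo_Suc_le: "geo (Suc i) \<le> r ^ i / 2"
  unfolding geo_def using r_bounds by (simp add: field_simps)

lemma \<rho>_geo: "\<rho> = geo (t0 + 1)" by (simp add: \<rho>_def geo_def)

lemma tail_le_geo: "tail i \<le> geo i" "geo i - \<rho> \<le> tail i" "0 \<le> tail i"
  unfolding tail_def using geo_pos[of i] \<rho>_nonneg by auto

lemma tail_antimono: "i \<le> j \<Longrightarrow> tail j \<le> tail i"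
  unfolding tail_def using geo_antimono[of i j] by auto

lemma tail_le_half: "i \<ge> 1 \<Longrightarrow> tail i \<le> 1 / 2"
  using geo_Suc_le[of 0] geo_antimono[of 1 i] tail_le_geo(1)[of i] by simp

text \<open>The factor \<open>2 ^ (k + 1) + 1\<close> of \<open>d'\<close> exists to cancel 1 + r,
  which is \<open>(2 ^ (k + 1) + 1) / q\<close>. What remains is \<open>q ^ (t0 + 1)\<close>, enough
  to clear the denominator of \<open>r ^ i\<close> for i up to \<open>t0 + 1\<close>.\<close>

lemma d'_geo:
  assumes "i \<le> t0 + 1"
  shows "real d' * geo i = 2 ^ (k * i) * real q ^ (t0 + 1 - i)"
proof -
  have "real d' / (1 + r) = real q ^ (t0 + 1)"
  proof -
    have "1 + p / (p + 1) = (2 * p + 1) / (p + 1)" if "p > 0" for p :: real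
      using that by (simp add: field_simps)
    from this[of "2 ^ k"] have "1 + r = (2 ^ (k + 1) + 1) / real q"
      by (simp add: r_def q_def add_ac)
    moreover have "(2 ^ (k + 1) + 1 :: real) > 0" by (simp add: add_pos_pos)
    moreover have "real d' = (2 ^ (k + 1) + 1) * real q ^ t0" by (simp add: d'_def del: mult_Suc)
    moreover have "real q > 0" by (simp add: q_def add_pos_pos)
    moreover have "a * b / (a / c) = c * b" if "a > 0" "c > 0" for a b c :: real
      using that by simp
    ultimately show ?thesis by simp
  qed
  then have "real d' * geo i = real q ^ (t0 + 1) * r ^ i"
    unfolding geo_def by (metis times_divide_eq_left times_divide_eq_right mult.commute)
  also have "real q ^ (t0 + 1) = real q ^ (t0 + 1 - i) * real q ^ i"
    using assms by (simp flip: power_add)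
  also have "real q ^ (t0 + 1 - i) * real q ^ i * r ^ i = real q ^ (t0 + 1 - i) * (real q * r) ^ i"
    by (simp add: power_mult_distrib)
  also have "real q * r = 2 ^ k" by (simp add: r_def q_def del: of_nat_Suc)
  finally show ?thesis by (simp add: power_mult)
qed

lemma d'_tail:
  shows "i \<le> t0 + 1 \<Longrightarrow> real d' * tail i = 2 ^ (k * i) * real q ^ (t0 + 1 - i) - 2 ^ (k * (t0 + 1))"
    and "t0 + 1 \<le> i \<Longrightarrow> tail i = 0"
proof -
  show "t0 + 1 \<le> i \<Longrightarrow> tail i = 0" unfolding tail_def \<rho>_geo using geo_antimono by auto
  assume i: "i \<le> t0 + 1"
  then have "tail i = geo i - geo (t0 + 1)" unfolding tail_def \<rho>_geo using geo_antimono by auto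
  then show "real d' * tail i = 2 ^ (k * i) * real q ^ (t0 + 1 - i) - 2 ^ (k * (t0 + 1))"
    using d'_geo[OF i] d'_geo[of "t0 + 1"] by (simp add: right_diff_distrib)
qed

text \<open>The distribution function of the truncated variable centered at c and clamped to {0..n}.
  Clamping at n is the first clause; clamping at 0 needs none, as the value at 0 already collects
  everything below.\<close>

definition gcdf :: "nat \<Rightarrow> nat \<Rightarrow> real" where
  "gcdf c z = (if n \<le> z then 1 else if z < c then tail (c - z) else 1 - tail (z + 1 - c))"

text \<open>The outer branches of \<open>fs_F'\<close> are constant because there the index of
  \<open>tail\<close> is at least \<open>t0 + 1\<close>. The index is \<open>c - z\<close> on the
  left but \<open>z + 1 - c\<close> on the right, since a distribution function includes its own
  point.\<close>

lemma fs_F'_eq: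
  assumes "c \<le> n"
  shows "real_of_int (fs_F' n \<epsilon> \<gamma> c (int z)) = real d' * gcdf c z"
proof -
  note [simp] = fs_k_eq fs_t0_eq fs_d'_eq
  consider (zn) "n \<le> z" | (far_left) "z < n" "z + t0 < c" | (left) "z < n" "z < c" "c \<le> z + t0" |
    (right) "z < n" "c \<le> z" "z < c + t0" | (far_right) "z < n" "c + t0 \<le> z"
    by linarith
  then show ?thesis
  proof cases
    case zn
    then show ?thesis using assms by (auto simp: fs_F'_def gcdf_def Let_def)
  next
    case far_left
    then show ?thesis using assms d'_tail(2)[of "c - z"] by (auto simp: fs_F'_def gcdf_def Let_def)
  next
    case left
    have "nat (int c - int z) = c - z" "nat (int t0 + 1 - (int c - int z)) = t0 + 1 - (c - z)" using left by linarith+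
    then show ?thesis
      using left d'_tail(1)[of "c - z"] by (auto simp: fs_F'_def gcdf_def Let_def q_def add_ac)
  next
    case right
    have "nat (int z - int c + 1) = z + 1 - c" "nat (int t0 - (int z - int c)) = t0 + 1 - (z + 1 - c)"
      using right by linarith+
    then show ?thesis
      using right d'_tail(1)[of "z + 1 - c"]
      by (auto simp: fs_F'_def gcdf_def Let_def q_def right_diff_distrib add_ac)
  next
    case far_right
    then show ?thesis using d'_tail(2)[of "z + 1 - c"] by (auto simp: fs_F'_def gcdf_def Let_def)
  qed
qed

lemma gcdf_bounds: "0 \<le> gcdf c z" "gcdf c z \<le> 1"
proof -
  have "tail (c - z) \<le> 1 / 2" if "z < c" using that by (intro tail_le_half) simp
  moreover have "tail (z + 1 - c) \<le> 1 / 2" if "\<not> z < c" using that by (intro tail_le_half) simp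
  ultimately show "0 \<le> gcdf c z" "gcdf c z \<le> 1"
    unfolding gcdf_def using tail_le_geo(3)[of "c - z"] tail_le_geo(3)[of "z + 1 - c"]
    by auto
qed

lemma gcdf_mono:
  assumes "z \<le> z'"
  shows "gcdf c z \<le> gcdf c z'"
proof -
  consider "n \<le> z'" | "z' < n" "z' < c" | "z' < n" "z < c" "c \<le> z'" | "z' < n" "c \<le> z"
    by linarith
  then show ?thesis
  proof cases
    case 1
    then show ?thesis using gcdf_bounds(2)[of c z] by (simp add: gcdf_def)
  next
    case 2
    then show ?thesis using assms tail_antimono[of "c - z'" "c - z"] by (simp add: gcdf_def)
  next
    case 3
    \<comment> \<open>The two points lie on different sides of the jump at the center: one value is
      at most 1/2, the other at least 1/2.\<close>
    then have "tail (c - z) \<le> 1 / 2" "tail (z' + 1 - c) \<le> 1 / 2"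
      by (intro tail_le_half; linarith)+
    then show ?thesis using 3 by (simp add: gcdf_def)
  next
    case 4
    then show ?thesis using assms tail_antimono[of "z + 1 - c" "z' + 1 - c"] by (simp add: gcdf_def)
  qed
qed

section \<open>Inverse transform sampling with integer thresholds\<close>

definition fsF :: "nat \<Rightarrow> nat \<Rightarrow> nat" where
  "fsF c z = (z + 1) * d' + (G - 1) * (n + 1) * nat (fs_F' n \<epsilon> \<gamma> c (int z))"

definition cdf :: "nat \<Rightarrow> nat \<Rightarrow> real" where
  "cdf c z = \<gamma> * ((real z + 1) / (real n + 1)) + (1 - \<gamma>) * gcdf c z"

lemma fs_F'_nonneg: "c \<le> n \<Longrightarrow> 0 \<le> fs_F' n \<epsilon> \<gamma> c (int z)"
  using fs_F'_eq[of c z] gcdf_bounds(1)[of c z]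
  by (metis of_int_0_le_iff of_nat_0_le_iff zero_le_mult_iff)

lemma fsF_eq:
  assumes "c \<le> n"
  shows "real (fsF c z) =
    (real z + 1) * real d' + (real G - 1) * (real n + 1) * real_of_int (fs_F' n \<epsilon> \<gamma> c (int z))"
proof -
  have G1: "real (G - 1) = real G - 1" using G by simp
  show ?thesis
    unfolding fsF_def of_nat_add of_nat_mult G1 using fs_F'_nonneg[OF assms, of z] by simp
qed

lemma fs_F_eq: "c \<le> n \<Longrightarrow> fs_F n \<epsilon> \<gamma> c (int z) = real (fsF c z)"
  by (simp add: fs_F_def fsF_eq fs_d'_eq)

text \<open>The three factors of \<open>d\<close> clear the denominators of the mixture:
  \<open>n + 1\<close> that of the uniform part, \<open>d'\<close> that of the geometric part,
  \<open>G\<close> that of the weights.\<close>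

lemma fsF_cdf:
  assumes "c \<le> n"
  shows "real (fsF c z) = real d * cdf c z"
proof -
  have d: "real d = (real n + 1) * real d' * real G" by (simp add: d_def del: mult_Suc)
  have "z1 * e + (g - 1) * m * (e * h) = m * e * g * (1 / g * (z1 / m) + (1 - 1 / g) * h)"
    if "g > 0" "m > 0" for z1 e g m h :: real
    using that by (simp add: field_simps)
  then show ?thesis
    unfolding fsF_eq[OF assms] fs_F'_eq[OF assms] d cdf_def using G by simp
qed

lemma cdf_mono: "z \<le> z' \<Longrightarrow> cdf c z \<le> cdf c z'"
  unfolding cdf_def using gcdf_mono[of z z' c] G by (intro add_mono mult_left_mono divide_right_mono) auto

lemma cdf_n: "cdf c n = 1"
  unfolding cdf_def gcdf_def by simp

lemma fsF_mono: "c \<le> n \<Longrightarrow> z \<le> z' \<Longrightarrow> fsF c z \<le> fsF c z'"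
  using fsF_cdf[of c z] fsF_cdf[of c z'] cdf_mono[of z z' c] d_pos
  by (metis mult_le_cancel_left_pos of_nat_0_less_iff of_nat_le_iff)

lemma fsF_n: "c \<le> n \<Longrightarrow> fsF c n = d"
  using fsF_cdf[of c n] cdf_n[of c] by simp

abbreviation fs :: "nat \<Rightarrow> nat \<Rightarrow> nat" where
  "fs \<equiv> fast_sample n \<epsilon> \<gamma>"

lemma fast_sample_props:
  assumes c: "c \<le> n" and u: "u \<le> d"
  shows "fs c u \<le> n" "u \<le> fsF c (fs c u)" "u \<le> fsF c z \<Longrightarrow> fs c u \<le> z"
proof -
  have fs: "fs c u = (LEAST z. z \<le> n \<and> u \<le> fsF c z)"
    by (simp add: fast_sample_def fs_F_eq[OF c])
  have "n \<le> n \<and> u \<le> fsF c n" using fsF_n[OF c] u by simp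
  from LeastI[of "\<lambda>z. z \<le> n \<and> u \<le> fsF c z", OF this]
  show 1: "fs c u \<le> n" "u \<le> fsF c (fs c u)" unfolding fs by blast+
  show "fs c u \<le> z" if "u \<le> fsF c z"
  proof (cases "z \<le> n")
    case True
    then show ?thesis unfolding fs using that by (intro Least_le) blast
  qed (use 1 in auto)
qed

text \<open>The thresholds are monotone in \<open>z\<close>, so the sampler is their generalized
  inverse. Both the law of the sample and the correctness of the binary search rest on this.\<close>

lemma fast_sample_le_iff:
  assumes "c \<le> n" "u \<le> d"
  shows "fs c u \<le> z \<longleftrightarrow> u \<le> fsF c z"
  using fast_sample_props[OF assms] fsF_mono[OF assms(1)] by (meson order_trans)

definition smp :: "nat \<Rightarrow> nat pmf" where
  "smp c = map_pmf (fs c) (pmf_of_set {1..d})"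

lemma prob_smp_le:
  assumes c: "c \<le> n" and z: "z \<le> n"
  shows "measure_pmf.prob (smp c) {..z} = cdf c z"
proof -
  have ne: "{1..d} \<noteq> {}" using d_pos by auto
  have "{1..d} \<inter> fs c -` {..z} = {1..fsF c z}"
    using fast_sample_le_iff[OF c] fsF_mono[OF c z] fsF_n[OF c] by auto
  then have "measure_pmf.prob (smp c) {..z} = real (fsF c z) / real d"
    unfolding smp_def by (simp add: measure_pmf_of_set[OF ne] del: One_nat_def)
  also have "\<dots> = cdf c z" using fsF_cdf[OF c, of z] d_pos by simp
  finally show ?thesis .
qed

lemma set_smp: "c \<le> n \<Longrightarrow> set_pmf (smp c) \<subseteq> {..n}"
  unfolding smp_def using fast_sample_props(1)[of c] d_pos by (auto simp: set_pmf_of_set)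


section \<open>Ratio of point masses at neighboring counts\<close>

definition gmass :: "nat \<Rightarrow> nat \<Rightarrow> real" where
  "gmass c z = (if z = 0 then gcdf c 0 else gcdf c z - gcdf c (z - 1))"

text \<open>The masses of the two-sided geometric distribution around \<open>c\<close>, clamped to \<open>{0..n}\<close>.\<close>

definition ideal :: "nat \<Rightarrow> nat \<Rightarrow> real" where
  "ideal c z = (if z = 0 then geo c else if z = n then geo (n - c)
     else (1 - r) * geo (if z < c then c - z else z - c))"

lemma geo_Suc: "geo (Suc i) = r * geo i"
  by (simp add: geo_def)

lemma geo_0_1: "1 - geo 1 = geo 0" "1 - 2 * geo 1 = (1 - r) * geo 0"
  using r_bounds by (simp_all add: geo_def field_simps)

text \<open>The bounds are asymmetric because the mass cut off, at most \<rho> on each side,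
  reappears at the center: only there can a mass grow, by up to 2 \<rho>, while every other mass can
  only lose, and at most \<rho>.\<close>

lemma gmass_ideal:
  assumes c: "c \<le> n" and z: "z \<le> n"
  shows "ideal c z - \<rho> \<le> gmass c z" "gmass c z \<le> ideal c z + 2 * \<rho>"
proof -
  have diff: "tail i - tail (Suc i) \<le> (1 - r) * geo i" "(1 - r) * geo i - \<rho> \<le> tail i - tail (Suc i)" for i
  proof -
    have "geo (Suc i) \<le> geo i" by (intro geo_antimono) simp
    then show "tail i - tail (Suc i) \<le> (1 - r) * geo i" "(1 - r) * geo i - \<rho> \<le> tail i - tail (Suc i)"
      using \<rho>_nonneg geo_pos[of "Suc i"] by (auto simp: tail_def geo_Suc algebra_simps)
  qed
  consider "z = 0" "c = 0" | "z = 0" "0 < c" | "0 < z" "z = n" "c < n" | "0 < z" "z = n" "c = n" |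
    "0 < z" "z < n" "z < c" | "0 < z" "z < n" "z = c" | "0 < z" "z < n" "c < z"
    using assms by linarith
  then have "ideal c z - \<rho> \<le> gmass c z \<and> gmass c z \<le> ideal c z + 2 * \<rho>"
  proof cases
    case 1
    then show ?thesis using n tail_le_geo[of 1] geo_0_1 \<rho>_nonneg
      by (simp add: ideal_def gmass_def gcdf_def)
  next
    case 2
    then show ?thesis using n tail_le_geo[of c] \<rho>_nonneg
      by (simp add: ideal_def gmass_def gcdf_def)
  next
    case 3
    then have "n - 1 + 1 - c = n - c" "\<not> n - 1 < c" "\<not> n \<le> n - 1" by linarith+
    with 3 have "gmass c z = tail (n - c)" unfolding gmass_def gcdf_def by auto
    then show ?thesis using 3 tail_le_geo[of "n - c"] \<rho>_nonneg by (simp add: ideal_def)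
  next
    case 4
    then have "n - (n - 1) = 1" "n - 1 < n" by linarith+
    with 4 have "gmass c z = 1 - tail 1" unfolding gmass_def gcdf_def by auto
    then show ?thesis using 4 tail_le_geo[of 1] geo_0_1 \<rho>_nonneg by (simp add: ideal_def)
  next
    case 5
    then have "c - (z - 1) = Suc (c - z)" "z - 1 < n" "z - 1 < c" by linarith+
    with 5 have "gmass c z = tail (c - z) - tail (Suc (c - z))" unfolding gmass_def gcdf_def by auto
    then show ?thesis using 5 diff[of "c - z"] \<rho>_nonneg by (simp add: ideal_def)
  next
    case 6
    then have "c - (z - 1) = 1" "z - 1 < n" "z - 1 < c" "z + 1 - c = 1" by linarith+
    with 6 have "gmass c z = 1 - 2 * tail 1" unfolding gmass_def gcdf_def by auto
    then show ?thesis using 6 tail_le_geo[of 1] geo_0_1 \<rho>_nonneg by (simp add: ideal_def)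
  next
    case 7
    then have "z - 1 + 1 - c = z - c" "z - 1 < n" "\<not> z - 1 < c" "z + 1 - c = Suc (z - c)" by linarith+
    with 7 have "gmass c z = tail (z - c) - tail (Suc (z - c))" unfolding gmass_def gcdf_def by auto
    then show ?thesis using 7 diff[of "z - c"] \<rho>_nonneg by (simp add: ideal_def)
  qed
  then show "ideal c z - \<rho> \<le> gmass c z" "gmass c z \<le> ideal c z + 2 * \<rho>" by auto
qed

lemma geo_ratio:
  assumes "i \<le> Suc j"
  shows "geo j \<le> (1 + \<eta>) * geo i"
proof -
  have "geo j = (1 + \<eta>) * geo (Suc j)"
    using r_bounds(3) by (simp add: geo_Suc mult.assoc[symmetric] mult.commute)
  also have "\<dots> \<le> (1 + \<eta>) * geo i"
    using assms \<eta>_pos by (intro mult_left_mono geo_antimono) auto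
  finally show ?thesis .
qed

text \<open>Interior masses are multiples of \<open>geo\<close> and the clamped end points are
  values of \<open>geo\<close> themselves, so moving the center by one changes each exponent by at
  most one, also at 0 and n.\<close>

lemma ideal_ratio:
  assumes "c \<le> c' + 1" "c' \<le> c + 1"
  shows "ideal c z \<le> (1 + \<eta>) * ideal c' z"
proof -
  have "(1 - r) * geo (if z < c then c - z else z - c) \<le>
    (1 - r) * ((1 + \<eta>) * geo (if z < c' then c' - z else z - c'))"
    using r_bounds assms by (intro mult_left_mono geo_ratio) auto
  moreover have "geo c \<le> (1 + \<eta>) * geo c'" "geo (n - c) \<le> (1 + \<eta>) * geo (n - c')"
    using assms by (intro geo_ratio; linarith)+
  ultimately show ?thesis by (simp add: ideal_def mult.left_commute)
qed

lemma pmf_smp: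
  assumes c: "c \<le> n" and z: "z \<le> n"
  shows "pmf (smp c) z = \<gamma> / (real n + 1) + (1 - \<gamma>) * gmass c z"
proof (cases "z = 0")
  case True
  then have "pmf (smp c) z = measure_pmf.prob (smp c) {..z}" by (simp add: measure_pmf_single atMost_0)
  then show ?thesis using True prob_smp_le[OF c z] by (simp add: cdf_def gmass_def)
next
  case False
  have "{..z} = insert z {..z - 1}" using False by auto
  then have "measure_pmf.prob (smp c) {..z} = pmf (smp c) z + measure_pmf.prob (smp c) {..z - 1}"
    using False measure_pmf.finite_measure_Union[of "{z}" "smp c" "{..z - 1}"]
    by (simp add: measure_pmf_single)
  then have "pmf (smp c) z = cdf c z - cdf c (z - 1)"
    using prob_smp_le[OF c z] prob_smp_le[OF c, of "z - 1"] z by simp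
  also have "\<dots> = \<gamma> * ((real z + 1) / (real n + 1) - real z / (real n + 1)) + (1 - \<gamma>) * gmass c z"
    using False by (simp add: cdf_def gmass_def of_nat_diff right_diff_distrib)
  also have "(real z + 1) / (real n + 1) - real z / (real n + 1) = 1 / (real n + 1)"
    by (simp add: diff_divide_distrib[symmetric])
  finally show ?thesis by simp
qed

lemma pmf_smp_ratio:
  assumes c: "c \<le> n" and c': "c' \<le> n" and cc': "c \<le> c' + 1" "c' \<le> c + 1"
  shows "pmf (smp c) z \<le> exp (\<epsilon> / 2) * pmf (smp c') z"
proof (cases "z \<le> n")
  case True
  have "gmass c z \<le> (1 + \<eta>) * (gmass c' z + \<rho>) + 2 * \<rho>"
    using gmass_ideal[OF c True] gmass_ideal[OF c' True] ideal_ratio[OF cc', of z] \<eta>_pos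
      mult_left_mono[of "ideal c' z" "gmass c' z + \<rho>" "1 + \<eta>"] by linarith
  \<comment> \<open>The errors add up to \<open>(3 + \<eta>) * \<rho>\<close>, and \<eta> \<le>
    1/2.\<close>
  also have "\<dots> \<le> (1 + \<eta>) * gmass c' z + 4 * \<rho>"
    using mult_right_mono[OF \<eta>_le(2) \<rho>_nonneg] \<rho>_nonneg by (simp add: algebra_simps)
  also have "\<dots> \<le> (1 + \<eta>) * gmass c' z + \<eta> / (real (G - 1) * (real n + 1))"
    using \<rho>_le by simp
  finally have "(1 - \<gamma>) * gmass c z \<le> (1 - \<gamma>) * ((1 + \<eta>) * gmass c' z + \<eta> / (real (G - 1) * (real n + 1)))"
    using G by (intro mult_left_mono) auto
  \<comment> \<open>The error has become \<eta> times the point mass of the uniform part, so the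
    factor \<open>1 + \<eta>\<close> covers the whole mixture and no additive term is left.\<close>
  also have "\<dots> = (1 + \<eta>) * ((1 - \<gamma>) * gmass c' z) + \<eta> * (\<gamma> / (real n + 1))"
  proof -
    have "(1 - 1 / g) * (h / ((g - 1) * m)) = h * ((1 / g) / m)" if "g > 1" "m > 0" for g h m :: real
      using that by (simp add: divide_simps)
    from this[of "real G" "real n + 1" \<eta>] show ?thesis
      using G by (simp add: of_nat_diff distrib_left)
  qed
  finally have "pmf (smp c) z \<le> (1 + \<eta>) * pmf (smp c') z"
    unfolding pmf_smp[OF c True] pmf_smp[OF c' True] distrib_left[of "1 + \<eta>"]
    by (simp only: distrib_right[of 1 \<eta> "\<gamma> / _"])
  also have "1 + \<eta> \<le> exp (\<epsilon> / 2)"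
    using exp_ge_add_one_self[of "\<epsilon> / 2"] \<eta>_le(1) by linarith
  then have "(1 + \<eta>) * pmf (smp c') z \<le> exp (\<epsilon> / 2) * pmf (smp c') z"
    by (intro mult_right_mono) auto
  finally show ?thesis .
next
  case False
  then have "pmf (smp c) z = 0" using set_smp[OF c] by (auto simp: set_pmf_eq)
  then show ?thesis by simp
qed

section \<open>Tails of the sampler\<close>

lemma prob_smp_greater:
  assumes c: "c \<le> n"
  shows "measure_pmf.prob (smp c) {z. c + a < z} \<le> \<gamma> * (real (n - (c + a)) / (real n + 1)) + geo (a + 1)"
proof (cases "c + a < n")
  case True
  have "measure_pmf.prob (smp c) {z. c + a < z} = 1 - measure_pmf.prob (smp c) {..c + a}"
    by (subst measure_pmf.prob_compl[symmetric]) (auto intro!: arg_cong[where f = "measure_pmf.prob _"])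
  also have "\<dots> = \<gamma> * (1 - (real (c + a) + 1) / (real n + 1)) + (1 - \<gamma>) * tail (a + 1)"
    using True by (subst prob_smp_le[OF c]) (auto simp: cdf_def gcdf_def algebra_simps)
  also have "1 - (real (c + a) + 1) / (real n + 1) = real (n - (c + a)) / (real n + 1)"
    using True by (simp add: of_nat_diff field_simps)
  also have "(1 - \<gamma>) * tail (a + 1) \<le> 1 * geo (a + 1)"
    using G tail_le_geo[of "a + 1"] by (intro mult_mono) auto
  finally show ?thesis by simp
next
  case False
  then have "measure_pmf.prob (smp c) {z. c + a < z} = 0"
    using set_smp[OF c] by (subst measure_pmf_zero_iff) auto
  then show ?thesis using geo_pos[of "a + 1"] by (simp add: less_imp_le)
qed

lemma prob_smp_less:
  assumes c: "c \<le> n"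
  shows "measure_pmf.prob (smp c) {z. z + a < c} \<le> \<gamma> * (real (c - a) / (real n + 1)) + geo (a + 1)"
proof (cases "a < c")
  case True
  have "{z. z + a < c} = {..c - a - 1}" using True by auto
  then have "measure_pmf.prob (smp c) {z. z + a < c} = cdf c (c - a - 1)"
    using prob_smp_le[OF c, of "c - a - 1"] c by simp
  also have "\<dots> = \<gamma> * (real (c - a) / (real n + 1)) + (1 - \<gamma>) * tail (a + 1)"
  proof -
    have "real (c - a - 1) + 1 = real (c - a)" "\<not> n \<le> c - a - 1" "c - a - 1 < c" "c - (c - a - 1) = a + 1"
      using True c by linarith+
    then show ?thesis unfolding cdf_def gcdf_def by auto
  qed
  also have "(1 - \<gamma>) * tail (a + 1) \<le> 1 * geo (a + 1)"
    using G tail_le_geo[of "a + 1"] by (intro mult_mono) auto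
  finally show ?thesis by simp
next
  case False
  then have "{z. z + a < c} = {}" by auto
  then show ?thesis using geo_pos[of "a + 1"] by (simp add: less_imp_le)
qed

lemma prob_smp_far:
  assumes c: "c \<le> n"
  shows "measure_pmf.prob (smp c) {z. \<bar>int z - int c\<bar> > int a} \<le> \<gamma> + r ^ a"
proof -
  have "{z. \<bar>int z - int c\<bar> > int a} = {z. c + a < z} \<union> {z. z + a < c}" by auto
  then have "measure_pmf.prob (smp c) {z. \<bar>int z - int c\<bar> > int a} \<le>
      measure_pmf.prob (smp c) {z. c + a < z} + measure_pmf.prob (smp c) {z. z + a < c}"
    by (simp add: measure_Un_le)
  also have "\<dots> \<le> \<gamma> * ((real (n - (c + a)) + real (c - a)) / (real n + 1)) + 2 * geo (a + 1)"
    using prob_smp_greater[OF c, of a] prob_smp_less[OF c, of a]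
    by (simp add: add_divide_distrib distrib_left)
  \<comment> \<open>The uniform shares of the two sides were kept as fractions of \<gamma>, so
    together they cost \<gamma> and not 2 \<gamma>. For the geometric tails, r / (1 + r) \<le>
    1/2.\<close>
  also have "\<dots> \<le> \<gamma> * 1 + 2 * (r ^ a / 2)"
    using c geo_Suc_le[of a] by (intro add_mono mult_left_mono) (auto simp: of_nat_diff divide_simps)
  finally show ?thesis by simp
qed

lemma prob_smp_1_greater:
  assumes "1 \<le> b"
  shows "measure_pmf.prob (smp 1) {z. b < z} \<le> \<gamma> + r ^ b"
proof -
  have "measure_pmf.prob (smp 1) {z. b < z} \<le> \<gamma> * (real (n - b) / (real n + 1)) + geo b"
    using prob_smp_greater[OF n, of "b - 1"] assms by simp
  also have "\<dots> \<le> \<gamma> * 1 + r ^ b"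
  proof (intro add_mono mult_left_mono)
    show "geo b \<le> r ^ b" unfolding geo_def using r_bounds by (simp add: divide_simps)
  qed (auto simp: divide_simps)
  finally show ?thesis by simp
qed

end

section \<open>Privacy and accuracy of the histogram\<close>

text \<open>\<open>(\<epsilon>, \<delta>)\<close>-indistinguishability, tested on functions into \<open>[0, 1]\<close> instead of events: in this form
  it passes to products with added parameters.\<close>

definition approx_dom :: "ennreal \<Rightarrow> ennreal \<Rightarrow> 'a pmf \<Rightarrow> 'a pmf \<Rightarrow> bool" where
  "approx_dom \<alpha> \<delta> P Q \<longleftrightarrow>
     (\<forall>f. (\<forall>x. f x \<le> 1) \<longrightarrow> (\<integral>\<^sup>+x. f x \<partial>P) \<le> \<alpha> * (\<integral>\<^sup>+x. f x \<partial>Q) + \<delta>)"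

lemma approx_domD:
  "approx_dom \<alpha> \<delta> P Q \<Longrightarrow> (\<And>x. f x \<le> 1) \<Longrightarrow> (\<integral>\<^sup>+x. f x \<partial>P) \<le> \<alpha> * (\<integral>\<^sup>+x. f x \<partial>Q) + \<delta>"
  by (auto simp: approx_dom_def)

lemma prob_not: "measure_pmf.prob M {x. \<not> P x} = 1 - measure_pmf.prob M {x. P x}"
proof -
  have "{x. \<not> P x} = UNIV - {x. P x}" by auto
  then show ?thesis using measure_pmf.prob_compl[of "{x. P x}" M] by simp
qed

lemma approx_dom_refl: "approx_dom 1 0 P P"
  by (simp add: approx_dom_def)

lemma approx_dom_mono: "approx_dom \<alpha> \<delta> P Q \<Longrightarrow> \<alpha> \<le> \<alpha>' \<Longrightarrow> \<delta> \<le> \<delta>' \<Longrightarrow> approx_dom \<alpha>' \<delta>' P Q"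
  unfolding approx_dom_def by (meson add_mono mult_right_mono order_trans zero_le)

lemma approx_dom_pointwise:
  assumes "\<And>x. pmf P x \<le> a * pmf Q x" "0 \<le> a"
  shows "approx_dom (ennreal a) 0 P Q"
  unfolding approx_dom_def
proof (intro allI impI)
  fix f :: "'a \<Rightarrow> ennreal"
  have "(\<integral>\<^sup>+x. f x \<partial>P) = (\<integral>\<^sup>+x. ennreal (pmf P x) * f x \<partial>count_space UNIV)"
    by (rule nn_integral_measure_pmf)
  also have "\<dots> \<le> (\<integral>\<^sup>+x. ennreal a * (ennreal (pmf Q x) * f x) \<partial>count_space UNIV)"
    using assms by (intro nn_integral_mono)
      (auto simp: mult.assoc[symmetric] ennreal_mult'[symmetric] intro!: mult_right_mono ennreal_leI)
  also have "\<dots> = ennreal a * (\<integral>\<^sup>+x. ennreal (pmf Q x) * f x \<partial>count_space UNIV)"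
    by (rule nn_integral_cmult) auto
  also have "(\<integral>\<^sup>+x. ennreal (pmf Q x) * f x \<partial>count_space UNIV) = (\<integral>\<^sup>+x. f x \<partial>Q)"
    by (rule nn_integral_measure_pmf[symmetric])
  finally show "(\<integral>\<^sup>+x. f x \<partial>P) \<le> ennreal a * (\<integral>\<^sup>+x. f x \<partial>Q) + 0" by simp
qed

text \<open>A test function into [0, 1] exceeds or undercuts its value at \<open>y\<close> by at
  most 1, and only off \<open>y\<close>. Both directions are required, since a count may vanish as
  well as appear.\<close>

lemma approx_dom_return:
  assumes "emeasure (measure_pmf P) (- {y}) \<le> \<delta>"
  shows "approx_dom 1 \<delta> P (return_pmf y)" "approx_dom 1 \<delta> (return_pmf y) P"
  unfolding approx_dom_def
proof safe
  fix f :: "'a \<Rightarrow> ennreal" assume f: "\<forall>x. f x \<le> 1"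
  have "(\<integral>\<^sup>+x. f x \<partial>P) \<le> (\<integral>\<^sup>+x. f y + indicator (- {y}) x \<partial>P)"
    using f by (intro nn_integral_mono) (auto simp: indicator_def intro: order_trans[OF _ add_increasing])
  also have "\<dots> = f y + emeasure P (- {y})"
    by (subst nn_integral_add) auto
  finally show "(\<integral>\<^sup>+x. f x \<partial>P) \<le> 1 * (\<integral>\<^sup>+x. f x \<partial>return_pmf y) + \<delta>"
    using assms by (auto intro: order_trans add_left_mono)
  have "f y = (\<integral>\<^sup>+x. f y \<partial>P)" by simp
  also have "\<dots> \<le> (\<integral>\<^sup>+x. f x + indicator (- {y}) x \<partial>P)"
    using f by (intro nn_integral_mono) (auto simp: indicator_def intro: order_trans[OF _ add_increasing])
  also have "\<dots> = (\<integral>\<^sup>+x. f x \<partial>P) + emeasure P (- {y})"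
    by (subst nn_integral_add) auto
  finally show "(\<integral>\<^sup>+x. f x \<partial>return_pmf y) \<le> 1 * (\<integral>\<^sup>+x. f x \<partial>P) + \<delta>"
    using assms by (auto intro: order_trans add_left_mono)
qed

lemma approx_dom_map: "approx_dom \<alpha> \<delta> P Q \<Longrightarrow> approx_dom \<alpha> \<delta> (map_pmf h P) (map_pmf h Q)"
  by (simp add: approx_dom_def)

lemma nn_integral_pair_pmf:
  "(\<integral>\<^sup>+z. f z \<partial>pair_pmf P Q) = (\<integral>\<^sup>+x. \<integral>\<^sup>+y. f (x, y) \<partial>Q \<partial>P)"
  by (simp add: pair_pmf_def)

text \<open>Direct chaining would multiply \<open>\<delta>2\<close> by \<open>\<alpha>1\<close>. The
  inner expectation is therefore capped at 1: the capped function \<open>g\<close> is again a legal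
  test function for the first components, and \<open>\<delta>2\<close> stays outside. The cap is
  harmless because the inner expectation under \<open>P2\<close> is at most 1 anyway.\<close>

lemma approx_dom_pair:
  assumes 1: "approx_dom \<alpha>1 \<delta>1 P1 Q1" and 2: "approx_dom \<alpha>2 \<delta>2 P2 Q2"
  shows "approx_dom (\<alpha>1 * \<alpha>2) (\<delta>1 + \<delta>2) (pair_pmf P1 P2) (pair_pmf Q1 Q2)"
  unfolding approx_dom_def
proof (intro allI impI)
  fix f :: "'a \<times> 'b \<Rightarrow> ennreal" assume f: "\<forall>z. f z \<le> 1"
  define g where "g x = min 1 (\<alpha>2 * (\<integral>\<^sup>+y. f (x, y) \<partial>Q2))" for x
  have "(\<integral>\<^sup>+y. f (x, y) \<partial>P2) \<le> g x + \<delta>2" for x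
  proof -
    have "(\<integral>\<^sup>+y. f (x, y) \<partial>P2) \<le> \<alpha>2 * (\<integral>\<^sup>+y. f (x, y) \<partial>Q2) + \<delta>2"
      using f by (intro approx_domD[OF 2]) auto
    moreover have "(\<integral>\<^sup>+y. f (x, y) \<partial>P2) \<le> (\<integral>\<^sup>+y. 1 \<partial>P2)"
      using f by (intro nn_integral_mono) auto
    then have "(\<integral>\<^sup>+y. f (x, y) \<partial>P2) \<le> 1 + \<delta>2" by (simp add: add_increasing2)
    ultimately show ?thesis unfolding g_def min_def by auto
  qed
  then have "(\<integral>\<^sup>+z. f z \<partial>pair_pmf P1 P2) \<le> (\<integral>\<^sup>+x. g x + \<delta>2 \<partial>P1)"
    unfolding nn_integral_pair_pmf by (intro nn_integral_mono) auto
  also have "\<dots> = (\<integral>\<^sup>+x. g x \<partial>P1) + \<delta>2"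
    by (subst nn_integral_add) auto
  also have "(\<integral>\<^sup>+x. g x \<partial>P1) \<le> \<alpha>1 * (\<integral>\<^sup>+x. g x \<partial>Q1) + \<delta>1"
    by (intro approx_domD[OF 1]) (simp add: g_def)
  also have "(\<integral>\<^sup>+x. g x \<partial>Q1) \<le> (\<integral>\<^sup>+x. \<alpha>2 * (\<integral>\<^sup>+y. f (x, y) \<partial>Q2) \<partial>Q1)"
    by (intro nn_integral_mono) (simp add: g_def)
  also have "\<dots> = \<alpha>2 * (\<integral>\<^sup>+z. f z \<partial>pair_pmf Q1 Q2)"
    unfolding nn_integral_pair_pmf by (rule nn_integral_cmult) auto
  finally show "(\<integral>\<^sup>+z. f z \<partial>pair_pmf P1 P2) \<le>
      \<alpha>1 * \<alpha>2 * (\<integral>\<^sup>+z. f z \<partial>pair_pmf Q1 Q2) + (\<delta>1 + \<delta>2)"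
    by (simp add: mult_left_mono mult.assoc add.assoc add_right_mono)
qed

lemma approx_dom_Pi_insert:
  assumes "finite A" "x \<notin> A" "approx_dom \<alpha>1 \<delta>1 (p x) (p' x)"
    "approx_dom \<alpha>2 \<delta>2 (Pi_pmf A dflt p) (Pi_pmf A dflt p')"
  shows "approx_dom (\<alpha>1 * \<alpha>2) (\<delta>1 + \<delta>2) (Pi_pmf (insert x A) dflt p) (Pi_pmf (insert x A) dflt p')"
  using assms by (simp add: Pi_pmf_insert approx_dom_map approx_dom_pair)

lemma approx_dom_prob:
  assumes "approx_dom (ennreal a) (ennreal d) P Q" "0 \<le> a" "0 \<le> d"
  shows "measure_pmf.prob P S \<le> a * measure_pmf.prob Q S + d"
proof -
  have "(\<integral>\<^sup>+x. indicator S x \<partial>P) \<le> ennreal a * (\<integral>\<^sup>+x. indicator S x \<partial>Q) + ennreal d"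
    by (rule approx_domD[OF assms(1)]) (auto simp: indicator_def)
  then have "ennreal (measure_pmf.prob P S) \<le> ennreal (a * measure_pmf.prob Q S + d)"
    using assms by (simp add: measure_pmf.emeasure_eq_measure ennreal_mult' ennreal_plus)
  then show ?thesis using assms by (subst (asm) ennreal_le_iff) auto
qed

section \<open>The histogram as a product of independent coordinates\<close>

definition released :: "(nat \<Rightarrow> nat \<Rightarrow> nat) \<Rightarrow> nat \<Rightarrow> nat \<Rightarrow> nat \<Rightarrow> nat option pmf" where
  "released M d b c =
     (if c = 0 then return_pmf None
      else map_pmf (\<lambda>u. if M c u > b then Some (M c u) else None) (pmf_of_set {1..d}))"

lemma row_count_le: "row_count D x \<le> length D"
proof -
  have "row_count D x \<le> card {..<length D}"
    unfolding row_count_def by (intro card_mono) auto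
  then show ?thesis by simp
qed

lemma row_count_pos_iff: "row_count D x > 0 \<longleftrightarrow> x \<in> set D"
  by (auto simp: row_count_def card_gt_0_iff in_set_conv_nth)

text \<open>Neighbors may have different sets of occurring elements, so comparing them requires
  products over a common index set. Elements that do not occur contribute the constant
  \<open>None\<close>. \<open>X\<close> is free because privacy uses the whole universe, while the
  union bound uses \<open>set D\<close>.\<close>

lemma stability_histogram_Pi_pmf:
  assumes "finite X" "set D \<subseteq> X"
  shows "stability_histogram M d b D = Pi_pmf X None (\<lambda>x. released M d b (row_count D x))"
proof -
  have fin: "finite (set D)" by simp
  have "stability_histogram M d b D = do { u \<leftarrow> Pi_pmf (set D) 0 (\<lambda>_. pmf_of_set {1..d});
      return_pmf (\<lambda>x. if x \<in> set D then if M (row_count D x) (u x) > b then Some (M (row_count D x) (u x))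
        else None else None) }"
    unfolding stability_histogram_def map_pmf_def Let_def
    by (auto simp: row_count_pos_iff fun_eq_iff intro!: bind_pmf_cong)
  also have "\<dots> = do { u \<leftarrow> Pi_pmf (set D) 0 (\<lambda>_. pmf_of_set {1..d});
      Pi_pmf (set D) None (\<lambda>x. return_pmf (if M (row_count D x) (u x) > b then Some (M (row_count D x) (u x))
        else None)) }"
    by simp
  also have "\<dots> = Pi_pmf (set D) None (\<lambda>x. map_pmf (\<lambda>u. if M (row_count D x) u > b
      then Some (M (row_count D x) u) else None) (pmf_of_set {1..d}))"
    unfolding map_pmf_def by (rule Pi_pmf_bind[OF fin, symmetric])
  also have "\<dots> = Pi_pmf (set D) None (\<lambda>x. released M d b (row_count D x))"
  proof (intro Pi_pmf_cong refl)
    fix x assume "x \<in> set D"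
    then have "row_count D x \<noteq> 0" using row_count_pos_iff[of D x] by simp
    then show "map_pmf (\<lambda>u. if M (row_count D x) u > b then Some (M (row_count D x) u) else None)
        (pmf_of_set {1..d}) = released M d b (row_count D x)" by (simp add: released_def)
  qed
  also have "\<dots> = Pi_pmf X None (\<lambda>x. released M d b (row_count D x))"
    using row_count_pos_iff[of D] assms
    by (intro Pi_pmf_subset'[symmetric]) (auto simp: released_def)
  finally show ?thesis .
qed

lemma neighbors_row_count:
  assumes "neighbors D D'"
  obtains x y where "x \<noteq> y" "x \<in> set D" "y \<in> set D'"
    "row_count D x = row_count D' x + 1" "row_count D' y = row_count D y + 1"
    "\<And>z. z \<noteq> x \<Longrightarrow> z \<noteq> y \<Longrightarrow> row_count D z = row_count D' z"
proof -
  have len: "length D = length D'" and "card {i. i < length D \<and> D ! i \<noteq> D' ! i} = 1"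
    using assms by (auto simp: neighbors_def)
  then obtain i where i: "{i. i < length D \<and> D ! i \<noteq> D' ! i} = {i}"
    by (elim card_1_singletonE)
  define C where "C z = card {j. j < length D \<and> j \<noteq> i \<and> D ! j = z}" for z
  have il: "i < length D" "D ! i \<noteq> D' ! i" using i by auto
  have same: "D ! j = D' ! j" if "j < length D" "j \<noteq> i" for j using i that by blast
  have "row_count D z = C z + (if D ! i = z then 1 else 0)" for z
  proof -
    have "{j. j < length D \<and> D ! j = z} =
        (if D ! i = z then insert i else (\<lambda>X. X)) {j. j < length D \<and> j \<noteq> i \<and> D ! j = z}"
      using il by auto
    then show ?thesis unfolding row_count_def C_def by simp
  qed
  moreover have "row_count D' z = C z + (if D' ! i = z then 1 else 0)" for z
  proof -
    have "{j. j < length D' \<and> D' ! j = z} =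
        (if D' ! i = z then insert i else (\<lambda>X. X)) {j. j < length D \<and> j \<noteq> i \<and> D ! j = z}"
      using il len same by auto
    then show ?thesis unfolding row_count_def C_def by simp
  qed
  ultimately show ?thesis using il len
    by (intro that[of "D ! i" "D' ! i"]) (auto simp: nth_mem)
qed

section \<open>Privacy and accuracy for a general threshold\<close>

context fast_sample_params
begin

abbreviation release :: "nat \<Rightarrow> nat \<Rightarrow> nat option pmf" where
  "release b \<equiv> released fs d b"

lemma release_pos: "c > 0 \<Longrightarrow> release b c = map_pmf (\<lambda>v. if v > b then Some v else None) (smp c)"
  by (simp add: released_def smp_def pmf.map_comp o_def)

text \<open>Each case pays only one of the two parameters: two positive counts cost the factor and
  no additive term, by postprocessing of the sampler; the counts 0 and 1 cost the additive term with
  factor 1.\<close>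

lemma approx_dom_release:
  assumes c: "c \<le> n" "c' \<le> n" "c = c' + 1 \<or> c' = c + 1" and b: "1 \<le> b" "\<gamma> + r ^ b \<le> \<delta> / 2"
  shows "approx_dom (ennreal (exp (\<epsilon> / 2))) (ennreal (\<delta> / 2)) (release b c) (release b c')"
proof -
  have e1: "1 \<le> exp (\<epsilon> / 2)" by simp
  have "measure_pmf.prob (release b 1) (- {None}) \<le> \<delta> / 2"
  proof -
    have "(\<lambda>v. if b < v then Some v else None) -` (- {None}) = {z. b < z}"
      by (auto split: if_splits)
    then show ?thesis using prob_smp_1_greater[OF b(1)] b(2) by (simp add: release_pos)
  qed
  then have 1: "emeasure (measure_pmf (release b 1)) (- {None}) \<le> ennreal (\<delta> / 2)"
    by (simp add: measure_pmf.emeasure_eq_measure ennreal_leI)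
  show ?thesis
  proof (cases "c = 0 \<or> c' = 0")
    case True
    moreover have "release b 0 = return_pmf None" by (simp add: released_def)
    ultimately have "approx_dom 1 (ennreal (\<delta> / 2)) (release b c) (release b c')"
      using c(3) approx_dom_return[OF 1] by auto
    then show ?thesis by (rule approx_dom_mono) (use e1 in auto)
  next
    case False
    have "pmf (smp c) z \<le> exp (\<epsilon> / 2) * pmf (smp c') z" for z
      using c by (intro pmf_smp_ratio) auto
    then have "approx_dom (ennreal (exp (\<epsilon> / 2))) 0 (smp c) (smp c')"
      by (rule approx_dom_pointwise) simp
    then have "approx_dom (ennreal (exp (\<epsilon> / 2))) 0 (release b c) (release b c')"
      using False by (auto simp: release_pos intro: approx_dom_map)
    then show ?thesis by (rule approx_dom_mono) auto
  qed
qed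

lemma stability_histogram_private:
  assumes b: "1 \<le> b" "\<gamma> + r ^ b \<le> \<delta> / 2"
  shows "differentially_private n m \<epsilon> \<delta> (stability_histogram fs d b)"
  unfolding differentially_private_def
proof (intro ballI impI allI)
  fix D D' S
  assume D: "D \<in> datasets n m" and D': "D' \<in> datasets n m" and nb: "neighbors D D'"
  have "0 < \<gamma> + r ^ b" using G r_bounds by (intro add_pos_pos) auto
  then have \<delta>: "0 \<le> \<delta>" using b(2) by linarith
  obtain x y where xy: "x \<noteq> y" "x \<in> set D" "y \<in> set D'"
    "row_count D x = row_count D' x + 1" "row_count D' y = row_count D y + 1"
    "\<And>z. z \<noteq> x \<Longrightarrow> z \<noteq> y \<Longrightarrow> row_count D z = row_count D' z"
    using neighbors_row_count[OF nb] by blast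
  have sub: "set D \<subseteq> {1..m}" "set D' \<subseteq> {1..m}" and len: "length D = n" "length D' = n"
    using D D' by (auto simp: datasets_def)
  define X where "X = {1..m} - {x, y}"
  have X: "{1..m} = insert x (insert y X)" using xy(2,3) sub by (auto simp: X_def)
  have fin: "finite X" "finite (insert y X)" by (simp_all add: X_def)
  let ?p = "\<lambda>x. release b (row_count D x)" and ?p' = "\<lambda>x. release b (row_count D' x)"
  have eqX: "Pi_pmf X None ?p = Pi_pmf X None ?p'"
    using xy(6) by (intro Pi_pmf_cong) (auto simp: X_def)
  have le: "row_count D z \<le> n" "row_count D' z \<le> n" for z
    using row_count_le[of D z] row_count_le[of D' z] len by auto
  have dx: "approx_dom (ennreal (exp (\<epsilon> / 2))) (ennreal (\<delta> / 2)) (?p x) (?p' x)"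
    using xy(4) by (intro approx_dom_release le b) simp
  have dy: "approx_dom (ennreal (exp (\<epsilon> / 2))) (ennreal (\<delta> / 2)) (?p y) (?p' y)"
    using xy(5) by (intro approx_dom_release le b) simp
  have dX: "approx_dom 1 0 (Pi_pmf X None ?p) (Pi_pmf X None ?p')"
    unfolding eqX by (rule approx_dom_refl)
  have "approx_dom (ennreal (exp (\<epsilon> / 2)) * (ennreal (exp (\<epsilon> / 2)) * 1)) (ennreal (\<delta> / 2) + (ennreal (\<delta> / 2) + 0))
      (Pi_pmf (insert x (insert y X)) None ?p) (Pi_pmf (insert x (insert y X)) None ?p')"
    by (intro approx_dom_Pi_insert dx dy dX fin) (use xy(1) in \<open>auto simp: X_def\<close>)
  moreover have "ennreal (exp (\<epsilon> / 2)) * (ennreal (exp (\<epsilon> / 2)) * 1) = ennreal (exp \<epsilon>)"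
    by (simp add: ennreal_mult'[symmetric] mult_exp_exp)
  moreover have "ennreal (\<delta> / 2) + (ennreal (\<delta> / 2) + 0) = ennreal \<delta>"
    using \<delta> by (simp flip: ennreal_plus)
  ultimately have "approx_dom (ennreal (exp \<epsilon>)) (ennreal \<delta>) (Pi_pmf {1..m} None ?p) (Pi_pmf {1..m} None ?p')"
    by (simp only: X)
  then show "measure_pmf.prob (stability_histogram fs d b D) S
      \<le> exp \<epsilon> * measure_pmf.prob (stability_histogram fs d b D') S + \<delta>"
    using sub \<delta> by (simp add: stability_histogram_Pi_pmf[of "{1..m}"] approx_dom_prob)
qed

lemma prob_hist_value:
  assumes D: "D \<in> datasets n m" and x: "x \<in> {1..m}" and c: "row_count D x > 0"
  shows "measure_pmf.prob (stability_histogram fs d b D) {h. P (hist_value h x)} =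
    measure_pmf.prob (smp (row_count D x)) {v. P (if v > b then v else 0)}"
proof -
  have sub: "set D \<subseteq> {1..m}" using D by (auto simp: datasets_def)
  have "measure_pmf.prob (stability_histogram fs d b D) {h. P (hist_value h x)} =
      measure_pmf.prob (map_pmf (\<lambda>h. h x) (Pi_pmf {1..m} None (\<lambda>x. release b (row_count D x))))
        {v. P (case v of None \<Rightarrow> 0 | Some v \<Rightarrow> v)}"
    using sub by (simp add: stability_histogram_Pi_pmf[of "{1..m}"] hist_value_def vimage_def)
  also have "map_pmf (\<lambda>h. h x) (Pi_pmf {1..m} None (\<lambda>x. release b (row_count D x))) = release b (row_count D x)"
    using x by (subst Pi_pmf_component) auto
  also have "measure_pmf.prob \<dots> {v. P (case v of None \<Rightarrow> 0 | Some v \<Rightarrow> v)} =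
      measure_pmf.prob (smp (row_count D x)) {v. P (if v > b then v else 0)}"
    using c by (simp add: release_pos vimage_def if_distrib cong: if_cong)
  finally show ?thesis .
qed

text \<open>\<open>P\<close> is required of the thresholded value because the two accuracy notions
  deal with suppression differently: for counts larger than a + b no close sample is suppressed,
  whereas with tolerance a + b suppression itself is tolerable, as the count is then at most a +
  b.\<close>

lemma prob_hist_value_far:
  assumes D: "D \<in> datasets n m" and x: "x \<in> {1..m}"
    and P: "\<And>v. \<bar>int v - int (row_count D x)\<bar> \<le> int a \<Longrightarrow> P (if v > b then v else 0)"
    and c: "row_count D x > 0"
  shows "measure_pmf.prob (stability_histogram fs d b D) {h. \<not> P (hist_value h x)} \<le> \<gamma> + r ^ a"
proof -
  have "row_count D x \<le> n" using row_count_le[of D x] D by (simp add: datasets_def)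
  have "measure_pmf.prob (stability_histogram fs d b D) {h. \<not> P (hist_value h x)} =
      measure_pmf.prob (smp (row_count D x)) {v. \<not> P (if v > b then v else 0)}"
    using assms by (intro prob_hist_value) auto
  also have "\<dots> \<le> measure_pmf.prob (smp (row_count D x)) {z. \<bar>int z - int (row_count D x)\<bar> > int a}"
  proof (intro measure_pmf.finite_measure_mono subsetI)
    fix v assume "v \<in> {v. \<not> P (if v > b then v else 0)}"
    then show "v \<in> {z. \<bar>int z - int (row_count D x)\<bar> > int a}"
      using P[of v] by (simp only: mem_Collect_eq not_le[symmetric]) blast
  qed simp
  also have "\<dots> \<le> \<gamma> + r ^ a" by (rule prob_smp_far) fact
  finally show ?thesis .
qed

lemma stability_histogram_per_query:
  assumes \<beta>: "\<gamma> + r ^ a \<le> \<beta>" and t: "int a + int b \<le> t"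
  shows "per_query_accuracy n m (int a) \<beta> t (stability_histogram fs d b)"
  unfolding per_query_accuracy_def
proof (intro ballI impI)
  fix D x assume D: "D \<in> datasets n m" and x: "x \<in> {1..m}" and c: "t < int (row_count D x)"
  let ?P = "\<lambda>v. \<bar>int v - int (row_count D x)\<bar> \<le> int a"
  have c0: "row_count D x > 0" using c t by linarith
  have P: "?P (if v > b then v else 0)" if "?P v" for v
    using that c t by (auto split: if_splits)
  have "measure_pmf.prob (stability_histogram fs d b D) {h. \<not> ?P (hist_value h x)} \<le> \<gamma> + r ^ a"
    using D x P c0 by (rule prob_hist_value_far)
  then show "1 - \<beta> \<le> measure_pmf.prob (stability_histogram fs d b D) {h. ?P (hist_value h x)}"
    using \<beta> by (subst (asm) prob_not) linarith
qed

lemma stability_histogram_simultaneous: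
  assumes \<beta>: "real n * (\<gamma> + r ^ a) \<le> \<beta>" and t: "int a + int b \<le> t"
  shows "simultaneous_accuracy n m t \<beta> (stability_histogram fs d b)"
  unfolding simultaneous_accuracy_def
proof (intro ballI)
  fix D assume D: "D \<in> datasets n m"
  let ?H = "stability_histogram fs d b D"
  let ?P = "\<lambda>x v. \<bar>int v - int (row_count D x)\<bar> \<le> t"
  have sub: "set D \<subseteq> {1..m}" and len: "length D = n" using D by (auto simp: datasets_def)
  have each: "measure_pmf.prob ?H {h. \<not> ?P x (hist_value h x)} \<le> \<gamma> + r ^ a" if "x \<in> set D" for x
    using that t sub by (intro prob_hist_value_far[OF D]) (auto simp: row_count_pos_iff split: if_splits)
  \<comment> \<open>Elements outside the dataset are released as 0 on the whole support, and the
    tolerance is nonnegative. The union bound thus runs over at most n elements instead of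
    m.\<close>
  have bad: "{h. \<not> (\<forall>x\<in>{1..m}. ?P x (hist_value h x))} \<inter> set_pmf ?H \<subseteq>
      (\<Union>x\<in>set D. {h. \<not> ?P x (hist_value h x)})"
  proof
    fix h assume h: "h \<in> {h. \<not> (\<forall>x\<in>{1..m}. ?P x (hist_value h x))} \<inter> set_pmf ?H"
    then obtain x where x: "\<not> ?P x (hist_value h x)" by auto
    have "x \<in> set D"
    proof (rule ccontr)
      assume n: "x \<notin> set D"
      have "h \<in> set_pmf (Pi_pmf (set D) None (\<lambda>x. release b (row_count D x)))"
        using h by (simp add: stability_histogram_Pi_pmf[of "set D"])
      then have "h x = None" using n set_Pi_pmf_subset[of "set D" None] by (auto simp: PiE_dflt_def)
      moreover have "row_count D x = 0" using n row_count_pos_iff[of D x] by simp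
      ultimately show False using x t by (simp add: hist_value_def)
    qed
    then show "h \<in> (\<Union>x\<in>set D. {h. \<not> ?P x (hist_value h x)})" using x by auto
  qed
  have "measure_pmf.prob ?H {h. \<not> (\<forall>x\<in>{1..m}. ?P x (hist_value h x))} \<le>
      measure_pmf.prob ?H (\<Union>x\<in>set D. {h. \<not> ?P x (hist_value h x)})"
    using bad by (subst measure_Int_set_pmf[symmetric]) (intro measure_pmf.finite_measure_mono; auto)
  also have "\<dots> \<le> (\<Sum>x\<in>set D. measure_pmf.prob ?H {h. \<not> ?P x (hist_value h x)})"
    by (intro measure_pmf.finite_measure_subadditive_finite) auto
  also have "\<dots> \<le> (\<Sum>x\<in>set D. \<gamma> + r ^ a)"
    by (intro sum_mono each)
  also have "\<dots> = real (card (set D)) * (\<gamma> + r ^ a)" by simp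
  also have "\<dots> \<le> real n * (\<gamma> + r ^ a)"
    using card_length[of D] len G r_bounds by (intro mult_right_mono) auto
  also have "\<dots> \<le> \<beta>" by (rule \<beta>)
  finally show "1 - \<beta> \<le> measure_pmf.prob ?H {h. \<forall>x\<in>{1..m}. ?P x (hist_value h x)}"
    unfolding prob_not by linarith
qed

end

section \<open>Search trees with step counts\<close>

text \<open>Deterministic runs: the result is exact and only the number of steps is estimated, so
  that bounds simply add under sequencing.\<close>

definition returns :: "'a run \<Rightarrow> 'a \<Rightarrow> nat \<Rightarrow> bool" where
  "returns p v T \<longleftrightarrow> (\<exists>s\<le>T. p = charge s v)"

lemma returns_charge: "s \<le> T \<Longrightarrow> returns (charge s v) v T"
  unfolding returns_def by blast

lemma returns_ret: "returns (ret v) v 0"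
  by (auto simp: returns_def ret_def)

lemma returns_weaken: "returns p v T \<Longrightarrow> v = v' \<Longrightarrow> T \<le> T' \<Longrightarrow> returns p v' T'"
  unfolding returns_def using order_trans by blast

lemma returns_bind:
  assumes "returns p v T" "returns (f v) y T'"
  shows "returns (p \<bind> f) y (T + T')"
proof -
  obtain s s' where s: "s \<le> T" "p = charge s v" "s' \<le> T'" "f v = charge s' y"
    using assms by (auto simp: returns_def)
  then have "p \<bind> f = charge (s + s') y"
    by (simp add: bind_run_def charge_def bind_return_pmf)
  with s show ?thesis by (auto simp: returns_def intro!: exI[of _ "s + s'"])
qed

lemma returns_if_True: "b \<Longrightarrow> returns p v T \<Longrightarrow> returns (if b then p else q) v T"
  by simp

lemma returns_if_False: "\<not> b \<Longrightarrow> returns q v T \<Longrightarrow> returns (if b then p else q) v T"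
  by simp

text \<open>The states are existential because a search tree is known only through its invariants,
  not as a closed expression.\<close>

lemma returns_for_each:
  assumes step: "\<And>i s. i < length xs \<Longrightarrow> I i s \<Longrightarrow> \<exists>s'. returns (f (xs ! i) s) s' C \<and> I (Suc i) s'"
    and "I 0 s"
  shows "\<exists>s'. returns (for_each xs f s) s' (length xs * (C + 1) + 1) \<and> I (length xs) s'"
  using assms
proof (induction xs arbitrary: I s)
  case Nil
  then show ?case by (auto intro!: returns_charge)
next
  case (Cons x xs)
  obtain s1 where s1: "returns (f x s) s1 C" "I 1 s1"
    using Cons.prems(1)[of 0 s] Cons.prems(2) by auto
  obtain s2 where s2: "returns (for_each xs f s1) s2 (length xs * (C + 1) + 1)" "I (Suc (length xs)) s2"
    using Cons.IH[of "\<lambda>i. I (Suc i)" s1] Cons.prems(1)[of "Suc _"] s1(2) by auto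
  have "returns (for_each (x # xs) f s) s2 (1 + (C + (length xs * (C + 1) + 1)))"
    unfolding for_each.simps by (intro returns_bind[OF returns_charge[OF order_refl]] returns_bind[OF s1(1)] s2(1))
  then show ?case using s2(2) by (auto intro!: exI[of _ s2] elim: returns_weaken)
qed

lemma returns_loop:
  assumes step: "\<And>i s. i < l \<Longrightarrow> I i s \<Longrightarrow> \<exists>s'. returns (f s) s' C \<and> I (Suc i) s'"
    and "I 0 s"
  shows "\<exists>s'. returns (loop l f s) s' (l * (C + 1) + 1) \<and> I l s'"
  using assms
proof (induction l arbitrary: I s)
  case 0
  then show ?case by (auto intro!: returns_charge)
next
  case (Suc l)
  obtain s1 where s1: "returns (f s) s1 C" "I 1 s1"
    using Suc.prems(1)[of 0 s] Suc.prems(2) by auto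
  obtain s2 where s2: "returns (loop l f s1) s2 (l * (C + 1) + 1)" "I (Suc l) s2"
    using Suc.IH[of "\<lambda>i. I (Suc i)" s1] Suc.prems(1)[of "Suc _"] s1(2) by auto
  have "returns (loop (Suc l) f s) s2 (1 + (C + (l * (C + 1) + 1)))"
    unfolding loop.simps by (intro returns_bind[OF returns_charge[OF order_refl]] returns_bind[OF s1(1)] s2(1))
  then show ?case using s2(2) by (auto intro!: exI[of _ s2] elim: returns_weaken)
qed

text \<open>Only the view \<open>h\<close> of the result has to have distribution \<open>\<mu>\<close>; the shape of a search tree depends
  on the order of its insertions.\<close>

definition runs :: "'a run \<Rightarrow> ('a \<Rightarrow> 'b) \<Rightarrow> 'b pmf \<Rightarrow> ('a \<Rightarrow> bool) \<Rightarrow> nat \<Rightarrow> bool" where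
  "runs p h \<mu> J T \<longleftrightarrow> map_pmf (\<lambda>(t, s). h t) (outcomes p) = \<mu> \<and>
     (\<forall>(t, s) \<in> set_pmf (outcomes p). J t \<and> s \<le> T)"

lemma runs_returns: "returns p v T \<Longrightarrow> J v \<Longrightarrow> runs p h (return_pmf (h v)) J T"
  by (auto simp: returns_def runs_def charge_def)

lemma runs_weaken: "runs p h \<mu> J T \<Longrightarrow> T \<le> T' \<Longrightarrow> runs p h \<mu> J T'"
  by (fastforce simp: runs_def)

lemma runs_bind_returns:
  assumes "returns p v T" "runs (f v) h \<mu> J T'"
  shows "runs (p \<bind> f) h \<mu> J (T + T')"
proof -
  obtain s where s: "s \<le> T" "p = charge s v" using assms by (auto simp: returns_def)
  then have "outcomes (p \<bind> f) = map_pmf (\<lambda>(y, s'). (y, s + s')) (outcomes (f v))"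
    by (simp add: bind_run_def charge_def bind_return_pmf)
  then show ?thesis using assms(2) s(1)
    by (fastforce simp: runs_def pmf.map_comp o_def case_prod_beta')
qed

lemma runs_bind_rand_oracle:
  assumes "d > 0" "\<And>u. u \<in> {1..d} \<Longrightarrow> runs (f u) h (\<nu> u) J T"
  shows "runs (rand_oracle d \<bind> f) h (pmf_of_set {1..d} \<bind> \<nu>) J (1 + T)"
proof -
  have set: "set_pmf (pmf_of_set {1..d}) = {1..d}" using assms(1) by (intro set_pmf_of_set) auto
  have out: "outcomes (rand_oracle d \<bind> f) =
      bind_pmf (pmf_of_set {1..d}) (\<lambda>u. map_pmf (\<lambda>(y, s'). (y, 1 + s')) (outcomes (f u)))"
    by (simp add: bind_run_def rand_oracle_def bind_map_pmf)
  have "map_pmf (\<lambda>(t, s). h t) (outcomes (rand_oracle d \<bind> f)) =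
      bind_pmf (pmf_of_set {1..d}) (\<lambda>u. map_pmf (\<lambda>(t, s). h t) (outcomes (f u)))"
    unfolding out by (simp add: map_bind_pmf pmf.map_comp o_def case_prod_beta')
  also have "\<dots> = pmf_of_set {1..d} \<bind> \<nu>"
    using assms(2) by (intro bind_pmf_cong) (auto simp: set runs_def simp del: One_nat_def)
  finally show ?thesis
    using assms(2) unfolding runs_def out by (fastforce simp: set simp del: One_nat_def)
qed

section \<open>AVL trees: balance, order and height\<close>

abbreviation entries :: "dict \<Rightarrow> (nat \<times> nat) list" where
  "entries t \<equiv> map fst (inorder t)"

lemma entries_rotate_right [simp]: "entries (rotate_right l p r) = entries l @ p # entries r"
  by (cases "(l, p, r)" rule: rotate_right.cases) (auto simp: mk_node_def)

lemma entries_rotate_left [simp]: "entries (rotate_left l p r) = entries l @ p # entries r"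
  by (cases "(l, p, r)" rule: rotate_left.cases) (auto simp: mk_node_def)

lemma entries_lean_left [simp]: "entries (lean_left t) = entries t"
  by (cases t rule: lean_left.cases) auto

lemma entries_lean_right [simp]: "entries (lean_right t) = entries t"
  by (cases t rule: lean_right.cases) auto

lemma entries_rebalance [simp]: "entries (rebalance l p r) = entries l @ p # entries r"
  by (simp add: rebalance_def mk_node_def)

lemma avl_rebalance_left:
  assumes "avl l" "avl r" "ht l = ht r + 2"
  shows "avl (rebalance l p r) \<and> ht (rebalance l p r) \<in> {ht l, ht l + 1}"
proof -
  obtain ll q h lr where l: "l = Node ll (q, h) lr" using assms(3) by (cases l) auto
  show ?thesis
  proof (cases "ht ll < ht lr")
    case True
    then obtain a s h' b where lr: "lr = Node a (s, h') b" by (cases lr) auto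
    show ?thesis using assms True unfolding l lr
      by (auto simp: rebalance_def mk_node_def max_def split: if_splits)
  next
    case False
    then show ?thesis using assms unfolding l
      by (auto simp: rebalance_def mk_node_def max_def split: if_splits)
  qed
qed

lemma avl_rebalance_right:
  assumes "avl l" "avl r" "ht r = ht l + 2"
  shows "avl (rebalance l p r) \<and> ht (rebalance l p r) \<in> {ht r, ht r + 1}"
proof -
  obtain rl q h rr where r: "r = Node rl (q, h) rr" using assms(3) by (cases r) auto
  show ?thesis
  proof (cases "ht rr < ht rl")
    case True
    then obtain a s h' b where rl: "rl = Node a (s, h') b" by (cases rl) auto
    show ?thesis using assms True unfolding r rl
      by (auto simp: rebalance_def mk_node_def max_def split: if_splits)
  next
    case False
    then show ?thesis using assms unfolding r
      by (auto simp: rebalance_def mk_node_def max_def split: if_splits)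
  qed
qed

text \<open>The last clause excludes the lower of the two heights when no rotation takes place. With
  it, an update never lowers a tree and raises it by at most one, which keeps the induction over the
  search path going.\<close>

lemma avl_rebalance:
  assumes "avl l" "avl r" "ht l \<le> ht r + 2" "ht r \<le> ht l + 2"
  shows "avl (rebalance l p r)"
    and "ht (rebalance l p r) \<in> {max (ht l) (ht r), 1 + max (ht l) (ht r)}"
    and "ht l \<le> ht r + 1 \<Longrightarrow> ht r \<le> ht l + 1 \<Longrightarrow> ht (rebalance l p r) = 1 + max (ht l) (ht r)"
proof -
  consider "ht l = ht r + 2" | "ht r = ht l + 2" | "ht l \<le> ht r + 1" "ht r \<le> ht l + 1"
    using assms(3,4) by linarith
  then show "avl (rebalance l p r)"
    "ht (rebalance l p r) \<in> {max (ht l) (ht r), 1 + max (ht l) (ht r)}"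
    "ht l \<le> ht r + 1 \<Longrightarrow> ht r \<le> ht l + 1 \<Longrightarrow> ht (rebalance l p r) = 1 + max (ht l) (ht r)"
    using assms avl_rebalance_left[of l r p] avl_rebalance_right[of l r p]
    by (cases; auto simp: rebalance_def mk_node_def)+
qed

text \<open>This says height \<le> 2 log (size + 1), weaker than the Fibonacci bound but with an
  elementary induction. In \<open>aux\<close>, x belongs to the higher subtree; the other one is
  lower by at most one, which yields the factor 2 in front of \<open>y\<^sup>2\<close>.\<close>

lemma avl_ht_le: "avl t \<Longrightarrow> 2 ^ ht t \<le> (size1 t)\<^sup>2"
proof (induction t)
  case (Node l a r)
  obtain p h where a: "a = (p, h)" by fastforce
  have IH: "2 ^ ht l \<le> (size1 l)\<^sup>2" "2 ^ ht r \<le> (size1 r)\<^sup>2" and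
    h: "h = 1 + max (ht l) (ht r)" "ht l \<le> ht r + 1" "ht r \<le> ht l + 1"
    using Node a by auto
  have aux: "2 * 2 ^ i \<le> (x + y)\<^sup>2" if xy: "2 ^ i \<le> x\<^sup>2" "2 ^ i \<le> 2 * y\<^sup>2" for i x y :: nat
  proof -
    have sq: "(x + y)\<^sup>2 = x\<^sup>2 + y\<^sup>2 + 2 * (x * y)" by (simp add: power2_eq_square algebra_simps)
    show ?thesis
    proof (cases "x \<le> y")
      case True
      then have "x\<^sup>2 \<le> y\<^sup>2" by (rule power_mono) simp
      then show ?thesis using xy unfolding sq by linarith
    next
      case False
      then have "y\<^sup>2 \<le> x * y" by (simp add: power2_eq_square)
      then show ?thesis using xy unfolding sq by linarith
    qed
  qed
  show ?case
  proof (cases "ht r \<le> ht l")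
    case True
    have "(2::nat) ^ ht l \<le> 2 ^ (ht r + 1)" using h by (intro power_increasing) auto
    then have "2 ^ ht l \<le> 2 * (size1 r)\<^sup>2" using IH(2) by simp
    from aux[OF IH(1) this] show ?thesis using True h(1) a by (simp add: max_def)
  next
    case False
    have "(2::nat) ^ ht r \<le> 2 ^ (ht l + 1)" using h by (intro power_increasing) auto
    then have "2 ^ ht r \<le> 2 * (size1 l)\<^sup>2" using IH(1) by simp
    from aux[OF IH(2) this] show ?thesis using False h(1) a by (simp add: max_def add.commute)
  qed
qed simp

lemma avl_search_tree_iff: "avl_search_tree t \<longleftrightarrow> avl t \<and> sorted_wrt (<) (map fst (entries t))"
  by (simp add: avl_search_tree_def)

text \<open>Order is expressed through the domains of the maps because the induction for updates
  knows a changed subtree only by the map it represents.\<close>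

lemma sorted_wrt_map_of:
  fixes xs :: "(nat \<times> nat) list"
  shows "sorted_wrt (<) (map fst (xs @ (y, v) # zs)) \<longleftrightarrow>
    sorted_wrt (<) (map fst xs) \<and> sorted_wrt (<) (map fst zs) \<and>
    (\<forall>z \<in> dom (map_of xs). z < y) \<and> (\<forall>z \<in> dom (map_of zs). y < z)"
  unfolding dom_map_of_conv_image_fst
  by (auto simp: sorted_wrt_append) (use order.strict_trans in fastforce)

lemma avl_search_tree_Node:
  "avl_search_tree (Node l ((y, v), h) r) \<longleftrightarrow>
     avl (Node l ((y, v), h) r) \<and> avl_search_tree l \<and> avl_search_tree r \<and>
     (\<forall>z \<in> dom (dict_map l). z < y) \<and> (\<forall>z \<in> dom (dict_map r). y < z)"
proof -
  have eq: "entries (Node l ((y, v), h) r) = entries l @ (y, v) # entries r" by simp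
  show ?thesis unfolding avl_search_tree_iff eq sorted_wrt_map_of dict_map_def by auto
qed

lemma size_avl_search_tree:
  assumes "avl_search_tree t"
  shows "size t = card (dom (dict_map t))"
proof -
  have "distinct (map fst (entries t))"
    using assms by (auto simp: avl_search_tree_def strict_sorted_iff)
  then have "card (dom (dict_map t)) = length (entries t)"
    unfolding dict_map_def dom_map_of_conv_image_fst set_map[symmetric] by (simp only: distinct_card length_map)
  then show ?thesis by simp
qed

lemma ht_avl_search_tree:
  assumes t: "avl_search_tree t" and K: "dom (dict_map t) \<subseteq> K" "finite K" "card K \<le> n"
  shows "ht t \<le> 2 * floorlog 2 (n + 1)"
proof -
  have "size1 t \<le> n + 1"
    using size_avl_search_tree[OF t] card_mono[OF K(2,1)] K(3) by (simp add: size1_size)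
  also have "\<dots> < 2 ^ floorlog 2 (n + 1)" using floorlog_bounds[of "n + 1" 2] by simp
  finally have "(size1 t)\<^sup>2 \<le> (2 ^ floorlog 2 (n + 1))\<^sup>2" by (intro power_mono) auto
  with avl_ht_le[of t] t have "2 ^ ht t \<le> (2 ^ floorlog 2 (n + 1) :: nat)\<^sup>2"
    unfolding avl_search_tree_def by linarith
  also have "\<dots> = (2::nat) ^ (2 * floorlog 2 (n + 1))" by (simp add: power_mult[symmetric] mult.commute)
  finally show ?thesis by (subst (asm) power_increasing_iff) auto
qed

text \<open>Each level costs at most two key comparisons of 2 W steps and one step of rebalancing,
  hence \<open>4 * W + 1\<close>; the remaining summands pay for \<open>f\<close> and for a new
  leaf. The claim on the height serves the induction, where it bounds the imbalance before
  rebalancing by 2.\<close>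

lemma returns_dict_update:
  fixes w
  assumes "avl_search_tree t"
    and f: "returns (f (dict_map t x)) v C"
    and W: "word_count w x \<le> W" "\<And>y. y \<in> dom (dict_map t) \<Longrightarrow> word_count w y \<le> W"
  shows "\<exists>t'. returns (dict_update w x f t) t' (ht t * (4 * W + 1) + C + W + 1) \<and>
      avl_search_tree t' \<and> dict_map t' = (dict_map t)(x \<mapsto> v) \<and> ht t' \<in> {ht t, ht t + 1}"
  using assms(1,2,4)
proof (induction t)
  case Leaf
  have "returns (dict_update w x f Leaf) (mk_node Leaf (x, v) Leaf) (C + (W + 1))"
    unfolding dict_update.simps
    by (rule returns_bind[where v = v]) (use Leaf(2) W(1) in \<open>auto simp: dict_map_def intro: returns_charge\<close>)
  then show ?case
    by (intro exI[of _ "mk_node Leaf (x, v) Leaf"])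
      (auto simp: mk_node_def avl_search_tree_def dict_map_def elim: returns_weaken)
next
  case (Node l a r)
  obtain y u h where a: "a = ((y, u), h)" by (metis surj_pair)
  let ?t = "Node l ((y, u), h) r"
  have t: "avl_search_tree l" "avl_search_tree r" "h = 1 + max (ht l) (ht r)"
    "ht l \<le> ht r + 1" "ht r \<le> ht l + 1" "avl l" "avl r"
    and dom: "\<forall>z \<in> dom (dict_map l). z < y" "\<forall>z \<in> dom (dict_map r). y < z"
    using Node.prems(1) unfolding a avl_search_tree_Node by auto
  \<comment> \<open>\<open>map_of\<close> prefers earlier entries, so the left subtree overrides the
    root and the right subtree.\<close>
  have map: "dict_map ?t = (dict_map r)(y \<mapsto> u) ++ dict_map l" by (simp add: dict_map_def)
  have domt: "dom (dict_map ?t) = insert y (dom (dict_map l) \<union> dom (dict_map r))"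
    unfolding map by auto
  have Wy: "word_count w y \<le> W" and Wl: "\<And>z. z \<in> dom (dict_map l) \<Longrightarrow> word_count w z \<le> W"
    and Wr: "\<And>z. z \<in> dom (dict_map r) \<Longrightarrow> word_count w z \<le> W"
    using Node.prems(3) unfolding a domt by auto
  have less: "returns (op_less w i j) (i < j) (2 * W)" if "word_count w i \<le> W" "word_count w j \<le> W" for i j
    unfolding op_less_def using that by (intro returns_charge) auto
  consider "x < y" | "y < x" | "x = y" by linarith
  then show ?case
  proof cases
    case 1
    have "dict_map r x = None" using dom(2) 1 by (metis domI not_less_iff_gr_or_eq option.exhaust)
    then have "dict_map l x = dict_map ?t x"
      using 1 unfolding map by (auto simp: map_add_def split: option.splits)
    then have fl: "returns (f (dict_map l x)) v C" using Node.prems(2) a by simp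
    obtain l' where l': "returns (dict_update w x f l) l' (ht l * (4 * W + 1) + C + W + 1)"
      "avl_search_tree l'" "dict_map l' = (dict_map l)(x \<mapsto> v)" "ht l' \<in> {ht l, ht l + 1}"
      using Node.IH(1)[OF t(1) fl Wl] by blast
    let ?t' = "rebalance l' (y, u) r"
    have bal: "avl l'" "ht l' \<le> ht r + 2" "ht r \<le> ht l' + 2"
      using l'(2,4) t by (auto simp: avl_search_tree_def)
    have "returns (dict_update w x f ?t) ?t' (2 * W + ((ht l * (4 * W + 1) + C + W + 1) + 1))"
      unfolding dict_update.simps
      by (rule returns_bind[OF less[OF W(1) Wy]], rule returns_if_True[OF 1],
        rule returns_bind[OF l'(1)], rule returns_charge[OF order_refl])
    moreover have "(ht l + 1) * (4 * W + 1) \<le> h * (4 * W + 1)"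
      unfolding t(3) by (intro mult_right_mono) auto
    then have "2 * W + ((ht l * (4 * W + 1) + C + W + 1) + 1) \<le> ht ?t * (4 * W + 1) + C + W + 1"
      by (simp add: algebra_simps)
    ultimately have "returns (dict_update w x f ?t) ?t' (ht ?t * (4 * W + 1) + C + W + 1)"
      by (auto elim: returns_weaken)
    moreover have "dict_map ?t' = (dict_map ?t)(x \<mapsto> v)"
      using l'(3) by (simp add: dict_map_def)
    moreover have "sorted_wrt (<) (map fst (entries ?t'))"
      unfolding entries_rebalance sorted_wrt_map_of dict_map_def[symmetric] l'(3)
      using l'(2) t(2) dom 1 by (simp add: avl_search_tree_iff)
    moreover have "avl ?t'" by (rule avl_rebalance(1)[OF bal(1) t(7) bal(2,3)])
    moreover have "ht ?t' \<in> {ht ?t, ht ?t + 1}"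
      using avl_rebalance(2,3)[OF bal(1) t(7) bal(2,3), of "(y, u)"] l'(4) t(3,4,5)
      by (cases "ht l' = ht r + 2") (auto simp: max_def split: if_splits)
    ultimately show ?thesis unfolding a avl_search_tree_iff by blast
  next
    case 2
    have "dict_map l x = None" using dom(1) 2 by (metis domI not_less_iff_gr_or_eq option.exhaust)
    then have "dict_map r x = dict_map ?t x"
      using 2 unfolding map by (auto simp: map_add_def split: option.splits)
    then have fr: "returns (f (dict_map r x)) v C" using Node.prems(2) a by simp
    obtain r' where r': "returns (dict_update w x f r) r' (ht r * (4 * W + 1) + C + W + 1)"
      "avl_search_tree r'" "dict_map r' = (dict_map r)(x \<mapsto> v)" "ht r' \<in> {ht r, ht r + 1}"
      using Node.IH(2)[OF t(2) fr Wr] by blast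
    let ?t' = "rebalance l (y, u) r'"
    have bal: "avl r'" "ht l \<le> ht r' + 2" "ht r' \<le> ht l + 2"
      using r'(2,4) t by (auto simp: avl_search_tree_def)
    have "returns (dict_update w x f ?t) ?t' (2 * W + (2 * W + ((ht r * (4 * W + 1) + C + W + 1) + 1)))"
      unfolding dict_update.simps
      by (rule returns_bind[OF less[OF W(1) Wy]], rule returns_if_False, use 2 in simp,
        rule returns_bind[OF less[OF Wy W(1)]], rule returns_if_True[OF 2],
        rule returns_bind[OF r'(1)], rule returns_charge[OF order_refl])
    moreover have "(ht r + 1) * (4 * W + 1) \<le> h * (4 * W + 1)"
      unfolding t(3) by (intro mult_right_mono) auto
    then have "2 * W + (2 * W + ((ht r * (4 * W + 1) + C + W + 1) + 1)) \<le> ht ?t * (4 * W + 1) + C + W + 1"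
      by (simp add: algebra_simps)
    ultimately have "returns (dict_update w x f ?t) ?t' (ht ?t * (4 * W + 1) + C + W + 1)"
      by (auto elim: returns_weaken)
    moreover have "dict_map ?t' = (dict_map ?t)(x \<mapsto> v)"
    proof -
      have "x \<notin> dom (dict_map l)" using dom(1) 2 order.asym by blast
      moreover have "dict_map ?t' = (dict_map r')(y \<mapsto> u) ++ dict_map l" by (simp add: dict_map_def)
      ultimately show ?thesis unfolding map r'(3) using 2
        by (auto simp: fun_eq_iff map_add_def split: option.splits)
    qed
    moreover have "sorted_wrt (<) (map fst (entries ?t'))"
      unfolding entries_rebalance sorted_wrt_map_of dict_map_def[symmetric] r'(3)
      using r'(2) t(1) dom 2 by (simp add: avl_search_tree_iff)
    moreover have "avl ?t'" by (rule avl_rebalance(1)[OF t(6) bal])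
    moreover have "ht ?t' \<in> {ht ?t, ht ?t + 1}"
      using avl_rebalance(2,3)[OF t(6) bal, of "(y, u)"] r'(4) t(3,4,5)
      by (cases "ht r' = ht l + 2") (auto simp: max_def split: if_splits)
    ultimately show ?thesis unfolding a avl_search_tree_iff by blast
  next
    case 3
    let ?t' = "Node l ((y, v), h) r"
    have ndl: "y \<notin> dom (dict_map l)" using dom(1) by auto
    then have "dict_map ?t x = Some u" using 3 unfolding map by (auto simp: map_add_def split: option.splits)
    then have fu: "returns (f (Some u)) v C" using Node.prems(2) a by simp
    have "returns (dict_update w x f ?t) ?t' (2 * W + (2 * W + (C + 1)))"
      unfolding dict_update.simps
      by (rule returns_bind[OF less[OF W(1) Wy]], rule returns_if_False, use 3 in simp,
        rule returns_bind[OF less[OF Wy W(1)]], rule returns_if_False, use 3 in simp,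
        rule returns_bind[OF fu], rule returns_charge[OF order_refl])
    moreover have "1 * (4 * W + 1) \<le> h * (4 * W + 1)"
      unfolding t(3) by (intro mult_right_mono) auto
    then have "2 * W + (2 * W + (C + 1)) \<le> ht ?t * (4 * W + 1) + C + W + 1"
      by (simp add: algebra_simps)
    ultimately have "returns (dict_update w x f ?t) ?t' (ht ?t * (4 * W + 1) + C + W + 1)"
      by (auto elim: returns_weaken)
    moreover have "dict_map ?t' = (dict_map ?t)(x \<mapsto> v)"
      using 3 ndl unfolding map by (simp add: dict_map_def map_add_upd_left)
    moreover have "avl_search_tree ?t'" using Node.prems(1) unfolding a avl_search_tree_Node by auto
    ultimately show ?thesis unfolding a by (auto intro!: exI[of _ ?t'])
  qed
qed

section \<open>Correctness and cost of the implementation\<close>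

lemma word_count_mono: "x \<le> y \<Longrightarrow> word_count w x \<le> word_count w y"
  unfolding word_count_def by (intro max.mono div_le_mono diff_le_mono add_mono floorlog_mono) auto

text \<open>Both sides are the least l with x \<le> \<open>2 ^ l\<close>; this is why
  \<open>ceil_log2_run\<close> counts the bits of x - 1.\<close>

lemma floorlog_pred: "1 \<le> x \<Longrightarrow> floorlog 2 (x - 1) = ceillog2 x"
proof -
  assume x: "1 \<le> x"
  have "floorlog 2 (x - 1) \<le> l \<longleftrightarrow> ceillog2 x \<le> l" for l
    using x ceillog2_le_iff[of x l] by (auto simp: floorlog_le_iff)
  then show ?thesis by (metis order.antisym order_refl)
qed

text \<open>\<open>U\<close> is one price for every arithmetic operation on numbers up to 16 d. The
  factor 2 accounts for two operands. Multiplication is bounded for every length up to that of 16 d,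
  as \<open>mul_time\<close> need not be monotone.\<close>

locale fast_sample_cost = fast_sample_params +
  fixes w :: nat and mul_time :: "nat \<Rightarrow> nat" and U :: nat
  assumes U_word: "2 * word_count w (16 * d) \<le> U"
    and U_mul: "\<And>x. x \<le> floorlog 2 (16 * d) \<Longrightarrow> mul_time x \<le> U"
begin

text \<open>The factor 16 leaves room for the largest value of the setup,
  \<open>8 * (n + 1) * E * (G - 1)\<close>, which is at most 8 d, and for the literal 9.\<close>

definition N :: nat where "N = 16 * d"

lemma word_count_U: "x \<le> N \<Longrightarrow> 2 * word_count w x \<le> U"
  using word_count_mono[of x N w] U_word unfolding N_def by linarith

lemma U_pos: "2 \<le> U"
  using word_count_U[of 0] by (simp add: word_count_def)

lemma returns_op_add: "x + y = z \<Longrightarrow> x \<le> N \<Longrightarrow> y \<le> N \<Longrightarrow> returns (op_add w x y) z U"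
  unfolding op_add_def using word_count_U[of x] word_count_U[of y] by (auto intro: returns_charge)

lemma returns_op_sub: "x - y = z \<Longrightarrow> x \<le> N \<Longrightarrow> y \<le> N \<Longrightarrow> returns (op_sub w x y) z U"
  unfolding op_sub_def using word_count_U[of x] word_count_U[of y] by (auto intro: returns_charge)

lemma returns_op_less: "x \<le> N \<Longrightarrow> y \<le> N \<Longrightarrow> returns (op_less w x y) (x < y) U"
  unfolding op_less_def using word_count_U[of x] word_count_U[of y] by (auto intro: returns_charge)

lemma returns_op_half: "x div 2 = z \<Longrightarrow> x \<le> N \<Longrightarrow> returns (op_half w x) z U"
  unfolding op_half_def using word_count_U[of x] by (auto intro: returns_charge)

lemma returns_op_odd: "returns (op_odd x) (odd x) U"
  unfolding op_odd_def using U_pos by (auto intro: returns_charge)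

lemma returns_op_shift: "x * 2 ^ i = z \<Longrightarrow> i \<le> N \<Longrightarrow> z \<le> N \<Longrightarrow> returns (op_shift w x i) z U"
  unfolding op_shift_def using word_count_U[of i] word_count_U[of z] by (auto intro: returns_charge)

lemma returns_op_mult: "x * y = z \<Longrightarrow> x \<le> N \<Longrightarrow> y \<le> N \<Longrightarrow> returns (op_mult mul_time x y) z U"
  unfolding op_mult_def using floorlog_mono[of x N 2] floorlog_mono[of y N 2]
  by (auto simp: N_def intro!: returns_charge U_mul)

lemma returns_op_bits: "floorlog 2 x = z \<Longrightarrow> x \<le> N \<Longrightarrow> returns (op_bits w x) z (U + w)"
  unfolding op_bits_def using word_count_U[of x] by (auto intro: returns_charge)

lemma returns_ceil_log2:
  assumes "ceillog2 x = z" "1 \<le> x" "x \<le> N"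
  shows "returns (ceil_log2_run w x) z (U + (U + w))"
  unfolding ceil_log2_run_def using assms floorlog_pred[of x]
  by (intro returns_bind[OF returns_op_sub[OF refl]] returns_op_bits) auto

lemmas returns_ops = returns_op_add returns_op_sub returns_op_less returns_op_half returns_op_odd
  returns_op_shift returns_op_mult returns_op_bits returns_ret

lemma returns_pow_run:
  assumes x: "1 \<le> x" and xe: "x ^ e \<le> N" and e: "e \<le> N" and l: "floorlog 2 e \<le> l"
  shows "returns (pow_run w mul_time x e) (x ^ e) (l * (4 * U + 1) + U + w + 1)"
proof -
  define step where "step = (\<lambda>(acc, y, i). do {
          o1 \<leftarrow> op_odd i;
          acc' \<leftarrow> (if o1 then op_mult mul_time acc y else ret acc);
          y' \<leftarrow> op_mult mul_time y y;
          i' \<leftarrow> op_half w i;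
          ret (acc', y', i') })"
  define I where "I s t = (t = (x ^ (e mod 2 ^ s), x ^ (2 ^ s), e div 2 ^ s))" for s and t :: "nat \<times> nat \<times> nat"
  have "\<exists>t'. returns (step t) t' (4 * U) \<and> I (Suc s) t'" if s: "s < floorlog 2 e" and t: "I s t" for s t
  proof -
    have e0: "e > 0" using s by (cases e) (auto simp: floorlog_def)
    have le: "2 ^ s \<le> e"
    proof -
      have "(2::nat) ^ s \<le> 2 ^ (floorlog 2 e - 1)" using s by (intro power_increasing) auto
      also have "\<dots> \<le> e" using floorlog_bounds[OF e0, of 2] by simp
      finally show ?thesis .
    qed
    have b: "x ^ (e mod 2 ^ s) \<le> N" "x ^ (2 ^ s) \<le> N" "e div 2 ^ s \<le> N"
      using power_increasing[OF _ x, of "e mod 2 ^ s" e] power_increasing[OF le x] xe e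
      by (auto intro: order_trans[OF div_le_dividend] order_trans[OF _ xe])
    have md: "e mod 2 ^ Suc s = e mod 2 ^ s + 2 ^ s * (e div 2 ^ s mod 2)"
      using mod_mult2_eq[of e "2 ^ s" 2] by (simp add: mult.commute)
    have eqs: "x ^ 2 ^ s * x ^ 2 ^ s = x ^ 2 ^ Suc s" "e div 2 ^ s div 2 = e div 2 ^ Suc s"
      by (simp_all add: mult_2 power_add div_mult2_eq[symmetric] mult.commute)
    have "returns (step (x ^ (e mod 2 ^ s), x ^ (2 ^ s), e div 2 ^ s))
       (x ^ (e mod 2 ^ Suc s), x ^ (2 ^ Suc s), e div 2 ^ Suc s) (U + (U + (U + (U + 0))))"
      unfolding step_def prod.case
    proof (rule returns_bind[OF returns_op_odd], rule returns_bind[where v = "x ^ (e mod 2 ^ Suc s)"])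
      show "returns (if odd (e div 2 ^ s) then op_mult mul_time (x ^ (e mod 2 ^ s)) (x ^ (2 ^ s))
           else ret (x ^ (e mod 2 ^ s))) (x ^ (e mod 2 ^ Suc s)) U"
        using b unfolding md
        by (auto simp: odd_iff_mod_2_eq_one even_iff_mod_2_eq_zero power_add
            intro!: returns_op_mult returns_weaken[OF returns_ret])
    qed (rule returns_bind returns_ops b eqs)+
    then show ?thesis using t unfolding I_def by (auto elim: returns_weaken)
  qed
  from returns_loop[where I = I and f = step, OF this]
  obtain t where t: "returns (loop (floorlog 2 e) step (1, x, e)) t (floorlog 2 e * (4 * U + 1) + 1)"
    "I (floorlog 2 e) t" by (auto simp: I_def)
  have "e mod 2 ^ floorlog 2 e = e" by (intro mod_less) (simp add: floorlog_leD)
  then obtain y i where t_eq: "t = (x ^ e, y, i)" using t(2) by (auto simp: I_def)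
  have "returns (pow_run w mul_time x e) (x ^ e) ((U + w) + ((floorlog 2 e * (4 * U + 1) + 1) + 0))"
    unfolding pow_run_def step_def[symmetric]
    by (rule returns_bind[OF returns_op_bits[OF refl e]], rule returns_bind[OF t(1)[unfolded t_eq]])
      (simp add: returns_ret)
  moreover have "floorlog 2 e * (4 * U + 1) \<le> l * (4 * U + 1)" using l by (intro mult_right_mono) auto
  ultimately show ?thesis by (auto elim: returns_weaken)
qed

section \<open>Sizes of the numbers and cost of one sample\<close>

definition p :: nat where "p = 2 ^ (k * (t0 + 1))"
definition ell :: nat where "ell = floorlog 2 (t0 + 1)"
definition pow_cost :: nat where "pow_cost = ell * (4 * U + 1) + U + w + 1"

lemma shifted_power_le: "i \<le> t0 + 1 \<Longrightarrow> 2 ^ (k * i) * q ^ (t0 + 1 - i) \<le> d'"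
proof -
  assume i: "i \<le> t0 + 1"
  have "2 ^ (k * i) * q ^ (t0 + 1 - i) \<le> q ^ i * q ^ (t0 + 1 - i)"
    unfolding power_mult by (intro mult_right_mono power_mono) (auto simp: q_def)
  also have "\<dots> = q * q ^ t0" using i by (simp flip: power_add)
  also have "\<dots> \<le> d'" unfolding d'_def by (intro mult_right_mono) (auto simp: q_def)
  finally show ?thesis .
qed

lemma q_power_le: "e \<le> t0 + 1 \<Longrightarrow> q ^ e \<le> d'"
  using shifted_power_le[of 0] power_increasing[of e "t0 + 1" q] by (simp add: q_def)

lemma p_le: "p \<le> d'" using shifted_power_le[of "t0 + 1"] by (simp add: p_def)

lemma size_bounds:
  shows "d' * (n + 1) \<le> d" "d' \<le> d" "n + 1 \<le> d" "G \<le> d" "8 * (n + 1) * E * (G - 1) \<le> 8 * d"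
    "k * (t0 + 1) \<le> d'" "t0 + 1 \<le> d'" "k \<le> d'" "2 * 2 ^ k \<le> d'" "4 * E \<le> 2 * d'" "q \<le> d'"
    "9 * E * lg \<le> 2 * d'" "lg \<le> d'" "9 * E \<le> 2 * d'"
proof -
  have d'1: "1 \<le> d'" using d'_pos by simp
  have d_eq: "d = d' * (n + 1) * G" by (simp add: d_def mult.commute)
  have G1: "1 \<le> G" using G by simp
  show "d' * (n + 1) \<le> d" unfolding d_eq using G1 by (metis mult_le_mono2 nat_mult_1_right)
  then show "d' \<le> d" using mult_le_mono2[of 1 "n + 1" d'] by linarith
  have "1 * (n + 1) \<le> d' * (n + 1)" using d'1 by (intro mult_right_mono) auto
  then have "n + 1 \<le> d' * (n + 1)" by (simp only: nat_mult_1)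
  then show "n + 1 \<le> d" using \<open>d' * (n + 1) \<le> d\<close> by (rule order_trans)
  have "1 * 1 * G \<le> d' * (n + 1) * G" using d'1 by (intro mult_right_mono mult_le_mono) auto
  then show "G \<le> d" unfolding d_eq by simp
  have A: "2 * 2 ^ k \<le> d'"
  proof -
    have "2 * 2 ^ k * 1 \<le> (2 ^ (k + 1) + 1) * q ^ t0"
      by (intro mult_le_mono) (auto simp: q_def Suc_leI)
    then show ?thesis by (simp add: d'_def)
  qed
  then show "2 * 2 ^ k \<le> d'" .
  show "4 * E \<le> 2 * d'" using A k_bounds by linarith
  then have E: "E \<le> d'" by linarith
  have "(n + 1) * E * (G - 1) \<le> (n + 1) * d' * G" using E by (intro mult_le_mono) auto
  then show "8 * (n + 1) * E * (G - 1) \<le> 8 * d" unfolding d_def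
    by (metis mult.assoc mult_le_mono2)
  have "k * (t0 + 1) \<le> p" unfolding p_def by (rule less_imp_le[OF less_exp])
  then show "k * (t0 + 1) \<le> d'" using p_le by linarith
  have "1 \<le> k" unfolding k_def using fast_sample_params.E[OF fast_sample_params_axioms]
    by (subst ceillog2_ge_iff) auto
  then have "1 * (t0 + 1) \<le> k * (t0 + 1)" by (rule mult_le_mono1)
  then have "t0 + 1 \<le> k * (t0 + 1)" by (simp only: nat_mult_1)
  then show t0: "t0 + 1 \<le> d'" using \<open>k * (t0 + 1) \<le> d'\<close> by (rule order_trans)
  have "k * 1 \<le> k * (t0 + 1)" by (rule mult_le_mono2) simp
  then have "k \<le> k * (t0 + 1)" by (simp only: nat_mult_1_right)
  then show "k \<le> d'" using \<open>k * (t0 + 1) \<le> d'\<close> by (rule order_trans)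
  show "q \<le> d'" using q_power_le[of 1] by simp
  have "9 * E * lg \<le> 2 * (t0 + 1)" unfolding t0_Suc by simp
  also have "\<dots> \<le> 2 * d'" using t0 by (rule mult_le_mono2)
  finally show B: "9 * E * lg \<le> 2 * d'" .
  have "1 * lg \<le> 9 * E * lg" "9 * E * 1 \<le> 9 * E * lg" and C: "2 * lg \<le> 9 * E * lg"
    using fast_sample_params.E[OF fast_sample_params_axioms] lg_bounds(2)
    by (intro mult_right_mono mult_left_mono; simp)+
  with B show "9 * E \<le> 2 * d'" "lg \<le> d'" by linarith+
qed

lemma N_bounds:
  shows "E \<le> N" "1 \<le> N" "3 \<le> N" "9 \<le> N" "2 * E \<le> N" "n \<le> N" "n + 1 \<le> N" "G \<le> N" "G - 1 \<le> N"
    "(n + 1) * E \<le> N" "(n + 1) * E * (G - 1) \<le> N" "8 * (n + 1) * E * (G - 1) \<le> N" "9 * E \<le> N" "lg \<le> N"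
    "9 * E * lg \<le> N" "9 * E * lg + 1 \<le> N" "t0 \<le> N" "t0 + 1 \<le> N" "k \<le> N" "2 ^ k \<le> N" "q \<le> N"
    "2 ^ (k + 1) \<le> N" "2 ^ (k + 1) + 1 \<le> N" "k * (t0 + 1) \<le> N" "p \<le> N" "d' \<le> N" "d' + p \<le> N"
    "(n + 1) * d' \<le> N" "d \<le> N" "(9 * E * lg + 1) div 2 \<le> N"
proof -
  note s = size_bounds p_le N_def d_pos
  have "(n + 1) * E * 1 \<le> (n + 1) * E * (G - 1)" using G by (intro mult_left_mono) auto
  then show "(n + 1) * E \<le> N" using s by linarith
  have "(2::nat) ^ (k + 1) = 2 * 2 ^ k" by simp
  with s show "2 ^ (k + 1) \<le> N" "2 ^ (k + 1) + 1 \<le> N" by linarith+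
  have "(n + 1) * d' = d' * (n + 1)" by (rule mult.commute)
  with s show "(n + 1) * d' \<le> N" by linarith
  show "(9 * E * lg + 1) div 2 \<le> N" using s by linarith
qed (use size_bounds p_le N_def d_pos in linarith)+

lemma returns_fs_setup:
  "returns (fs_setup_run w mul_time n E G) (k, t0, q, p, d', d) (30 * U + 2 * w + pow_cost)"
proof -
  \<comment> \<open>The values of the intermediate results; the reflexive equations say that a
    result is kept in the form in which it arises.\<close>
  have eqs: "E * 2 ^ 1 = 2 * E" "ceillog2 (2 * E) = k" "n + 1 = n + 1" "G - 1 = G - 1"
    "(n + 1) * E = (n + 1) * E" "(n + 1) * E * (G - 1) = (n + 1) * E * (G - 1)"
    "ceillog2 (8 * (n + 1) * E * (G - 1)) = lg" "9 * E = 9 * E" "9 * E * lg = 9 * E * lg"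
    "9 * E * lg + 1 = 9 * E * lg + 1" "t0 + 1 - 1 = t0"
    "1 * 2 ^ k = (2::nat) ^ k" "2 ^ k + 1 = q" "2 ^ k * 2 ^ 1 = (2::nat) ^ (k + 1)"
    "2 ^ (k + 1) + 1 = (2::nat) ^ (k + 1) + 1" "(2 ^ (k + 1) + 1) * q ^ t0 = d'" "t0 + 1 = t0 + 1"
    "k * (t0 + 1) = k * (t0 + 1)" "1 * 2 ^ (k * (t0 + 1)) = p" "(n + 1) * d' = (n + 1) * d'"
    "(n + 1) * d' * G = d"
    by (simp_all add: k_def lg_def q_def d'_def p_def d_def del: mult_Suc)
  have eqs': "(n + 1) * E * (G - 1) * 2 ^ 3 = 8 * (n + 1) * E * (G - 1)" "(9 * E * lg + 1) div 2 = t0 + 1"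
    using t0_Suc by (simp_all only: mult.assoc) (simp add: mult_ac del: mult_Suc)
  have ones: "1 \<le> 2 * E" "1 \<le> 8 * (n + 1) * E * (G - 1)" using E G by auto
  have pw: "returns (pow_run w mul_time q t0) (q ^ t0) pow_cost"
    unfolding pow_cost_def using q_power_le[of t0] N_bounds
    by (intro returns_pow_run) (auto simp: q_def ell_def intro: floorlog_mono)
  have qt: "q ^ t0 \<le> N" using q_power_le[of t0] N_bounds by linarith
  show ?thesis
    apply (rule returns_weaken)
    unfolding fs_setup_run_def
    apply (rule returns_bind returns_ops returns_ceil_log2 pw eqs eqs' N_bounds qt ones)+
     apply (rule refl)
    apply simp
    done
qed


lemma q_shift_le:
  assumes "i \<le> t0 + 1"
  shows "q ^ (t0 + 1 - i) * 2 ^ (k * i) \<le> d'" "k * i \<le> N" "q ^ (t0 + 1 - i) \<le> N"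
proof -
  show "q ^ (t0 + 1 - i) * 2 ^ (k * i) \<le> d'" using shifted_power_le[OF assms] by (simp add: mult.commute)
  have "k * i \<le> k * (t0 + 1)" using assms by (rule mult_le_mono2)
  then show "k * i \<le> N" using N_bounds by linarith
  show "q ^ (t0 + 1 - i) \<le> N" using q_power_le[of "t0 + 1 - i"] N_bounds by linarith
qed

lemma returns_pow_q: "e \<le> t0 + 1 \<Longrightarrow> returns (pow_run w mul_time q e) (q ^ e) pow_cost"
  unfolding pow_cost_def using q_power_le[of e] N_bounds
  by (intro returns_pow_run) (auto simp: q_def ell_def intro: floorlog_mono)

lemma returns_fs_F':
  assumes c: "c \<le> n" and z: "z < n"
  shows "returns (fs_F'_run w mul_time n (k, t0, q, p, d', d) c z) (nat (fs_F' n \<epsilon> \<gamma> c (int z)))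
    (13 * U + pow_cost)"
proof -
  note [simp] = fs_k_eq fs_t0_eq fs_d'_eq
  let ?f = "nat (fs_F' n \<epsilon> \<gamma> c (int z))"
  have ct: "c \<le> N" "z \<le> N" "z + t0 \<le> N" "c + t0 \<le> N"
    using c z size_bounds d_pos by (auto simp: N_def)
  consider (far_left) "z + t0 < c" | (left) "z < c" "c \<le> z + t0" |
    (right) "c \<le> z" "z < c + t0" | (far_right) "c + t0 \<le> z"
    by linarith
  then show ?thesis
  proof cases
    case far_left
    then have f: "?f = 0" by (auto simp: fs_F'_def Let_def)
    have "returns (fs_F'_run w mul_time n (k, t0, q, p, d', d) c z) 0 (U + (U + 0))"
      unfolding fs_F'_run_def prod.case
      by (rule returns_bind[OF returns_op_add[OF refl ct(2) N_bounds(17)]],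
        rule returns_bind[OF returns_op_less[OF ct(3,1)]], rule returns_if_True[OF far_left], rule returns_ret)
    then show ?thesis unfolding f by (auto elim: returns_weaken)
  next
    case left
    define i where "i = c - z"
    have i: "i \<le> t0 + 1" and not: "\<not> z + t0 < c" using left by (auto simp: i_def)
    have "nat (int c - int z) = i" "nat (int t0 + 1 - (int c - int z)) = t0 + 1 - i"
      using left by (auto simp: i_def)
    then have "fs_F' n \<epsilon> \<gamma> c (int z) = int (q ^ (t0 + 1 - i) * 2 ^ (k * i)) - int p"
      using left z by (simp add: fs_F'_def Let_def q_def p_def mult.commute max_def add.commute)
    then have f: "q ^ (t0 + 1 - i) * 2 ^ (k * i) - p = ?f" by (simp only: nat_minus_as_int)
    note b = q_shift_le[OF i]
    have bd: "i \<le> N" "q ^ (t0 + 1 - i) * 2 ^ (k * i) \<le> N" using b N_bounds i by linarith+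
    have "t0 + 1 - i \<le> t0 + 1" by simp
    note pw = returns_pow_q[OF this]
    have eqs: "c - z = i" "k * i = k * i" "t0 + 1 = t0 + 1" "t0 + 1 - i = t0 + 1 - i"
      "q ^ (t0 + 1 - i) * 2 ^ (k * i) = q ^ (t0 + 1 - i) * 2 ^ (k * i)" "z + t0 = z + t0" by (simp_all add: i_def)
    show ?thesis
      apply (rule returns_weaken)
        unfolding fs_F'_run_def prod.case
        apply (rule returns_bind returns_if_False[OF not] returns_if_True[OF left(1)] returns_ops pw f eqs b bd ct N_bounds)+
      by simp_all
  next
    case right
    \<comment> \<open>This is the program's \<open>i1\<close>; its \<open>i\<close> is one less, so
      that its exponent \<open>t0 - i\<close> becomes \<open>t0 + 1 - i\<close> here.\<close>
    define i where "i = z + 1 - c"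
    have i: "i \<le> t0 + 1" and not: "\<not> z + t0 < c" "\<not> z < c" and yes: "z < c + t0 \<and> z < n"
      using right z by (auto simp: i_def)
    have "nat (int z - int c + 1) = i" "nat (int t0 - (int z - int c)) = t0 + 1 - i"
      using right by (auto simp: i_def)
    then have "fs_F' n \<epsilon> \<gamma> c (int z) = int (d' + p) - int (q ^ (t0 + 1 - i) * 2 ^ (k * i))"
      using right z by (simp add: fs_F'_def Let_def q_def p_def mult.commute max_def add.commute)
    then have f: "d' + p - q ^ (t0 + 1 - i) * 2 ^ (k * i) = ?f" by (simp only: nat_minus_as_int)
    note b = q_shift_le[OF i]
    have bd: "z - c \<le> N" "i \<le> N" "q ^ (t0 + 1 - i) * 2 ^ (k * i) \<le> N" using b N_bounds i ct by linarith+
    have "t0 + 1 - i \<le> t0 + 1" by simp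
    note pw = returns_pow_q[OF this]
    have eqs: "z - c = z - c" "z - c + 1 = i" "k * i = k * i" "t0 - (z - c) = t0 + 1 - i" "c + t0 = c + t0"
      "d' + p = d' + p" "q ^ (t0 + 1 - i) * 2 ^ (k * i) = q ^ (t0 + 1 - i) * 2 ^ (k * i)" "z + t0 = z + t0"
      using right by (simp_all add: i_def)
    have nN: "n \<le> N" by (rule N_bounds)
    show ?thesis
      apply (rule returns_weaken)
        unfolding fs_F'_run_def prod.case
        apply (rule returns_bind returns_if_False[OF not(1)] returns_if_False[OF not(2)] returns_if_True[OF yes]
          returns_ops pw f eqs b bd ct nN N_bounds)+
      by simp_all
  next
    case far_right
    then have "\<not> z + t0 < c" "\<not> z < c" and no: "\<not> (z < c + t0 \<and> z < n)" by auto
    have f: "d' = ?f" using far_right z by (auto simp: fs_F'_def Let_def)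
    have eqs: "c + t0 = c + t0" "z + t0 = z + t0" by simp_all
    show ?thesis
      apply (rule returns_weaken)
        unfolding fs_F'_run_def prod.case
        apply (rule returns_bind returns_if_False[OF \<open>\<not> z + t0 < c\<close>] returns_if_False[OF \<open>\<not> z < c\<close>]
          returns_if_False[OF no] returns_ops eqs ct N_bounds)+
      using f by simp_all
  qed
qed

lemma returns_fs_F:
  assumes c: "c \<le> n" and z: "z < n"
  shows "returns (fs_F_run w mul_time n G (k, t0, q, p, d', d) c z) (fsF c z) (20 * U + pow_cost)"
proof -
  let ?f = "nat (fs_F' n \<epsilon> \<gamma> c (int z))"
  have le: "fsF c z \<le> d" using fsF_mono[OF c, of z n] fsF_n[OF c] z by simp
  have f: "(z + 1) * d' + (G - 1) * (n + 1) * ?f = fsF c z" by (simp only: fsF_def)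
  have "(z + 1) * d' \<le> N" "(G - 1) * (n + 1) * ?f \<le> N" using le f by (auto simp: N_def)
  moreover have "(G - 1) * (n + 1) \<le> N"
  proof -
    have "(n + 1) * 1 * (G - 1) \<le> (n + 1) * E * (G - 1)" using E by (intro mult_le_mono) auto
    then show ?thesis using N_bounds(11) by (simp add: mult.commute)
  qed
  moreover have "?f \<le> N"
  proof -
    have "real_of_int (fs_F' n \<epsilon> \<gamma> c (int z)) \<le> real d' * 1"
      unfolding fs_F'_eq[OF c] using gcdf_bounds by (intro mult_left_mono) auto
    then have "?f \<le> d'" by linarith
    then show ?thesis using N_bounds by linarith
  qed
  moreover have "z \<le> N" "z + 1 \<le> N" using z N_bounds by linarith+
  ultimately have b: "(z + 1) * d' \<le> N" "(G - 1) * (n + 1) * ?f \<le> N" "(G - 1) * (n + 1) \<le> N" "?f \<le> N"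
    "z \<le> N" "z + 1 \<le> N" by blast+
  have eqs: "z + 1 = z + 1" "(z + 1) * d' = (z + 1) * d'" "G - 1 = G - 1" "n + 1 = n + 1"
    "(G - 1) * (n + 1) = (G - 1) * (n + 1)" "(G - 1) * (n + 1) * ?f = (G - 1) * (n + 1) * ?f" by simp_all
  show ?thesis
    apply (rule returns_weaken)
      unfolding fs_F_run_def prod.case
      apply (rule returns_bind returns_fs_F'[OF c z] returns_ops f eqs b N_bounds)+
    by simp_all
qed

definition sample_cost :: nat where
  "sample_cost = floorlog 2 n * (25 * U + pow_cost + 1) + U + w + 1"

lemma returns_fast_sample:
  assumes c: "c \<le> n" and u: "u \<le> d"
  shows "returns (fast_sample_run w mul_time n G (k, t0, q, p, d', d) c u) (fs c u) sample_cost"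
proof -
  define step where "step = (\<lambda>(lo, hi). do {
          more \<leftarrow> op_less w lo hi;
          if more then do {
            s \<leftarrow> op_add w lo hi;
            mid \<leftarrow> op_half w s;
            v \<leftarrow> fs_F_run w mul_time n G (k, t0, q, p, d', d) c mid;
            small \<leftarrow> op_less w v u;
            if small then do { lo' \<leftarrow> op_add w mid 1; ret (lo', hi) } else ret (lo, mid) }
          else ret (lo, hi) })"
  let ?l = "floorlog 2 n" and ?C = "25 * U + pow_cost"
  \<comment> \<open>Initially the gap is n < \<open>2 ^ floorlog 2 n\<close>. After all rounds it is
    less than 1, so \<open>lo\<close> equals the answer.\<close>
  define I where "I s t = (case t of (lo, hi) \<Rightarrow> lo \<le> fs c u \<and> fs c u \<le> hi \<and> hi \<le> n \<and> hi - lo < 2 ^ (?l - s))"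
    for s and t :: "nat \<times> nat"
  have "\<exists>t'. returns (step t) t' ?C \<and> I (Suc s) t'" if s: "s < ?l" and t: "I s t" for s t
  proof -
    obtain lo hi where t_eq: "t = (lo, hi)" by fastforce
    have I: "lo \<le> fs c u" "fs c u \<le> hi" "hi \<le> n" "hi - lo < 2 ^ (?l - s)" using t by (auto simp: I_def t_eq)
    have pow: "(2::nat) ^ (?l - s) = 2 * 2 ^ (?l - Suc s)" using s by (simp flip: power_Suc add: Suc_diff_Suc)
    have N: "lo \<le> N" "hi \<le> N" "lo + hi \<le> N" using I size_bounds d_pos by (auto simp: N_def)
    show ?thesis
    proof (cases "lo < hi")
      case False
      have "returns (step t) t (U + 0)"
        unfolding step_def t_eq prod.case
        by (rule returns_bind[OF returns_op_less[OF N(1,2)]], rule returns_if_False[OF False], rule returns_ret)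
      then have "returns (step t) t ?C" by (rule returns_weaken) auto
      moreover have "I (Suc s) t" using I False by (auto simp: I_def t_eq)
      ultimately show ?thesis by blast
    next
      case True
      define mid where "mid = (lo + hi) div 2"
      have mid: "mid < n" "mid < hi" "lo \<le> mid" using True I by (auto simp: mid_def)
      have le: "fsF c mid \<le> N" using fsF_mono[OF c, of mid n] fsF_n[OF c] mid by (simp add: N_def)
      have uN: "u \<le> N" "mid \<le> N" using u mid N by (auto simp: N_def)
      have eqs: "lo + hi = lo + hi" "(lo + hi) div 2 = mid" "mid + 1 = mid + 1" by (simp_all add: mid_def)
      define t' where "t' = (if fsF c mid < u then (mid + 1, hi) else (lo, mid))"
      have "returns (step t) t' (U + (U + (U + ((20 * U + pow_cost) + (U + (U + 0))))))"
      proof (cases "fsF c mid < u")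
        case small: True
        then have "t' = (mid + 1, hi)" by (simp add: t'_def)
        then show ?thesis unfolding step_def t_eq prod.case
          by (simp only:) (rule returns_bind returns_if_True[OF True] returns_if_True[OF small]
            returns_fs_F[OF c mid(1)] returns_ops eqs uN le N N_bounds)+
      next
        case small: False
        then have "t' = (lo, mid)" by (simp add: t'_def)
        moreover have "returns (step t) (lo, mid) (U + (U + (U + ((20 * U + pow_cost) + (U + 0)))))"
          unfolding step_def t_eq prod.case
          by (rule returns_bind returns_if_True[OF True] returns_if_False[OF small]
            returns_fs_F[OF c mid(1)] returns_ops eqs uN le N N_bounds)+
        ultimately show ?thesis by (auto elim: returns_weaken)
      qed
      then have "returns (step t) t' ?C" by (rule returns_weaken) auto
      moreover have "I (Suc s) t'"
        using fast_sample_le_iff[OF c u, of mid] I True mid pow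
        by (auto simp: I_def t'_def mid_def not_le[symmetric])
      ultimately show ?thesis by blast
    qed
  qed
  note body = this
  have "n < 2 ^ ?l" by (simp add: floorlog_leD)
  then have "I 0 (0, n)" using fast_sample_props(1)[OF c u] by (simp add: I_def)
  from returns_loop[where I = I and f = step, OF body this]
  obtain t where t: "returns (loop ?l step (0, n)) t (?l * (?C + 1) + 1)" "I ?l t" by blast
  then obtain hi where t_eq: "t = (fs c u, hi)" by (auto simp: I_def)
  have "returns (fast_sample_run w mul_time n G (k, t0, q, p, d', d) c u) (fs c u)
      ((U + w) + ((?l * (?C + 1) + 1) + 0))"
    unfolding fast_sample_run_def step_def[symmetric]
    by (rule returns_bind[OF returns_op_bits[OF refl N_bounds(6)]], rule returns_bind[OF t(1)[unfolded t_eq]])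
      (simp add: returns_ret)
  then show ?thesis by (auto simp: sample_cost_def elim: returns_weaken)
qed



section \<open>Building the two dictionaries\<close>

definition height_bound :: nat where "height_bound = 2 * floorlog 2 (n + 1)"

definition update_cost :: "nat \<Rightarrow> nat" where
  "update_cost W = height_bound * (4 * W + 1) + U + W + 1"

text \<open>All keys come from \<open>set D\<close>, so at most n of them are ever stored and the
  search path stays logarithmic in n, whatever the universe.\<close>

lemma returns_update:
  assumes t: "avl_search_tree t" "dom (dict_map t) \<subseteq> set D" and D: "length D = n" and x: "x \<in> set D"
    and W: "\<And>y. y \<in> set D \<Longrightarrow> word_count w y \<le> W"
    and f: "returns (f (dict_map t x)) v U"
  shows "\<exists>t'. returns (dict_update w x f t) t' (update_cost W) \<and> avl_search_tree t' \<and>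
    dict_map t' = (dict_map t)(x \<mapsto> v)"
proof -
  have "ht t \<le> height_bound"
    unfolding height_bound_def using t D card_length[of D] by (intro ht_avl_search_tree) auto
  then have "ht t * (4 * W + 1) \<le> height_bound * (4 * W + 1)" by (rule mult_le_mono1)
  then have cost: "ht t * (4 * W + 1) + U + W + 1 \<le> update_cost W" by (simp add: update_cost_def)
  have "\<exists>t'. returns (dict_update w x f t) t' (ht t * (4 * W + 1) + U + W + 1) \<and>
      avl_search_tree t' \<and> dict_map t' = (dict_map t)(x \<mapsto> v) \<and> ht t' \<in> {ht t, ht t + 1}"
    by (rule returns_dict_update[of t f x v U w W]) (use t f x W in auto)
  then obtain t' where t': "returns (dict_update w x f t) t' (ht t * (4 * W + 1) + U + W + 1)"
    "avl_search_tree t'" "dict_map t' = (dict_map t)(x \<mapsto> v)"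
    by (elim exE conjE)
  show ?thesis by (intro exI[of _ t'] conjI returns_weaken[OF t'(1) refl cost] t'(2,3))
qed

lemma row_count_filter: "row_count D x = length (filter (\<lambda>y. y = x) D)"
  unfolding row_count_def by (simp add: length_filter_conv_card)

definition counts :: "nat list \<Rightarrow> partial_histogram" where
  "counts D x = (if row_count D x = 0 then None else Some (row_count D x))"

lemma returns_counts:
  assumes D: "length D = n" and W: "\<And>y. y \<in> set D \<Longrightarrow> word_count w y \<le> W"
  shows "\<exists>t. returns (for_each D (dict_increment w) Leaf) t (n * (update_cost W + 1) + 1) \<and>
    avl_search_tree t \<and> dict_map t = counts D"
proof -
  define I where "I i t \<longleftrightarrow> avl_search_tree t \<and> dict_map t = counts (take i D)" for i t
  have step: "\<exists>t'. returns (dict_increment w (D ! i) t) t' (update_cost W) \<and> I (Suc i) t'"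
    if i: "i < length D" and t: "I i t" for i t
  proof -
    let ?x = "D ! i" and ?D = "take i D"
    have dm: "dict_map t = counts ?D" and avl: "avl_search_tree t" using t by (auto simp: I_def)
    have dom: "dom (dict_map t) \<subseteq> set D"
      using row_count_pos_iff[of ?D] unfolding dm by (auto simp: counts_def dom_def dest: in_set_takeD split: if_splits)
    have le: "row_count ?D ?x \<le> N" "1 \<le> N"
      using row_count_le[of ?D ?x] D N_bounds by (auto intro: order_trans)
    have "returns (case dict_map t ?x of None \<Rightarrow> ret 1 | Some c' \<Rightarrow> op_add w c' 1) (row_count ?D ?x + 1) U"
      unfolding dm counts_def using le by (auto intro: returns_op_add returns_weaken[OF returns_ret])
    from returns_update[OF avl dom D nth_mem[OF i] W, of "\<lambda>c. case c of None \<Rightarrow> ret 1 | Some c' \<Rightarrow> op_add w c' 1", OF _ this]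
    obtain t' where t': "returns (dict_increment w ?x t) t' (update_cost W)" "avl_search_tree t'"
      "dict_map t' = (dict_map t)(?x \<mapsto> row_count ?D ?x + 1)"
      unfolding dict_increment_def by blast
    moreover have "dict_map t' = counts (take (Suc i) D)"
      unfolding t'(3) dm by (auto simp: fun_eq_iff counts_def row_count_filter take_Suc_conv_app_nth[OF i])
    ultimately show ?thesis unfolding I_def by blast
  qed
  have "I 0 Leaf" by (simp add: I_def avl_search_tree_def dict_map_def counts_def row_count_def fun_eq_iff)
  from returns_for_each[where I = I and f = "dict_increment w", OF step this] D show ?thesis
    unfolding I_def by auto
qed

definition release_cost :: "nat \<Rightarrow> nat" where
  "release_cost W = 1 + (sample_cost + (U + update_cost W))"

text \<open>The program draws its seeds one by one, in the order of the tree, while the mechanism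
  draws them jointly; independence allows one coordinate of the product to be split off per round.
  For the induction the statement is generalized to an arbitrary tree \<open>rel\<close> of earlier
  releases, which supplies the value wherever nothing new is released. The function
  \<open>cc\<close> makes the law independent of the order of the list.\<close>

lemma runs_release:
  fixes b :: nat and cc :: "nat \<Rightarrow> nat"
  assumes D: "length D = n" and W: "\<And>y. y \<in> set D \<Longrightarrow> word_count w y \<le> W" and b: "b \<le> n"
  defines "body \<equiv> (\<lambda>(x, c) rel. do {
          u \<leftarrow> rand_oracle d;
          v \<leftarrow> fast_sample_run w mul_time n G (k, t0, q, p, d', d) c u;
          keep \<leftarrow> op_less w b v;
          if keep then dict_insert w x v rel else ret rel })"
  assumes cs: "distinct (map fst cs)" "\<And>x c. (x, c) \<in> set cs \<Longrightarrow> x \<in> set D \<and> c = cc x \<and> c \<le> n"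
    and rel: "avl_search_tree rel" "dom (dict_map rel) \<subseteq> set D"
  shows "runs (for_each cs body rel) dict_map
     (map_pmf (\<lambda>u y. if y \<in> fst ` set cs \<and> fs (cc y) (u y) > b then Some (fs (cc y) (u y)) else dict_map rel y)
       (Pi_pmf (fst ` set cs) 0 (\<lambda>_. pmf_of_set {1..d})))
     avl_search_tree (length cs * (release_cost W + 1) + 1)"
  using cs rel
proof (induction cs arbitrary: rel)
  case Nil
  then show ?case using runs_returns[OF returns_charge[of 1 1 rel], of avl_search_tree dict_map] by simp
next
  case (Cons z cs)
  obtain x c where z: "z = (x, c)" by fastforce
  let ?unif = "pmf_of_set {1..d}" and ?A = "fst ` set cs"
  let ?g = "\<lambda>A (u :: nat \<Rightarrow> nat) y. if y \<in> A \<and> fs (cc y) (u y) > b then Some (fs (cc y) (u y)) else dict_map rel y"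
  have x: "x \<in> set D" "c = cc x" "c \<le> n" "x \<notin> ?A" and dist: "distinct (map fst cs)"
    using Cons.prems(1,2) by (auto simp: z)
  have sub: "y \<in> set D \<and> e = cc y \<and> e \<le> n" if "(y, e) \<in> set cs" for y e
    using Cons.prems(2)[of y e] that by simp
  define new where "new u = (if fs c u > b then (dict_map rel)(x \<mapsto> fs c u) else dict_map rel)" for u
  have step: "\<exists>rel'. returns (fast_sample_run w mul_time n G (k, t0, q, p, d', d) c u \<bind> (\<lambda>v.
          op_less w b v \<bind> (\<lambda>keep. if keep then dict_insert w x v rel else ret rel)))
        rel' (sample_cost + (U + update_cost W)) \<and> avl_search_tree rel' \<and> dict_map rel' = new u"
    if u: "u \<in> {1..d}" for u
  proof -
    have ud: "u \<le> d" using u by simp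
    have le: "b \<le> N" "fs c u \<le> N" using b fast_sample_props(1)[OF x(3) ud] N_bounds(6) by linarith+
    show ?thesis
    proof (cases "b < fs c u")
      case True
      have "returns (charge (word_count w (fs c u)) (fs c u)) (fs c u) U"
        using word_count_U[OF le(2)] by (auto intro: returns_charge)
      from returns_update[OF Cons.prems(3,4) D x(1) W, of "\<lambda>_. charge (word_count w (fs c u)) (fs c u)", OF _ this]
      obtain rel' where rel': "returns (dict_insert w x (fs c u) rel) rel' (update_cost W)" "avl_search_tree rel'"
        "dict_map rel' = (dict_map rel)(x \<mapsto> fs c u)"
        unfolding dict_insert_def by blast
      have "returns (fast_sample_run w mul_time n G (k, t0, q, p, d', d) c u \<bind> (\<lambda>v.
          op_less w b v \<bind> (\<lambda>keep. if keep then dict_insert w x v rel else ret rel)))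
        rel' (sample_cost + (U + update_cost W))"
        by (rule returns_bind[OF returns_fast_sample[OF x(3) ud]], rule returns_bind[OF returns_op_less[OF le]],
          rule returns_if_True[OF True], rule rel'(1))
      then show ?thesis using rel'(2,3) True by (auto simp: new_def)
    next
      case False
      have "returns (fast_sample_run w mul_time n G (k, t0, q, p, d', d) c u \<bind> (\<lambda>v.
          op_less w b v \<bind> (\<lambda>keep. if keep then dict_insert w x v rel else ret rel)))
        rel (sample_cost + (U + 0))"
        by (rule returns_bind[OF returns_fast_sample[OF x(3) ud]], rule returns_bind[OF returns_op_less[OF le]],
          rule returns_if_False[OF False], rule returns_ret)
      then have "returns (fast_sample_run w mul_time n G (k, t0, q, p, d', d) c u \<bind> (\<lambda>v.
          op_less w b v \<bind> (\<lambda>keep. if keep then dict_insert w x v rel else ret rel)))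
        rel (sample_cost + (U + update_cost W))"
        by (rule returns_weaken) auto
      then show ?thesis using Cons.prems(3) False by (auto simp: new_def)
    qed
  qed
  let ?h = "\<lambda>u u' y. if y \<in> ?A \<and> fs (cc y) (u' y) > b then Some (fs (cc y) (u' y)) else new u y"
  let ?rest = "\<lambda>u. map_pmf (?h u) (Pi_pmf ?A 0 (\<lambda>_. ?unif))"
  have bind_assoc: "(P \<bind> F) \<bind> F' = P \<bind> (\<lambda>x. F x \<bind> F')"
    for P :: "nat run" and F :: "nat \<Rightarrow> dict run" and F' :: "dict \<Rightarrow> dict run"
    by (simp add: bind_run_def bind_assoc_pmf bind_map_pmf map_bind_pmf pmf.map_comp o_def case_prod_beta' add.assoc)
  have "runs (rand_oracle d \<bind> (\<lambda>u. (fast_sample_run w mul_time n G (k, t0, q, p, d', d) c u \<bind> (\<lambda>v.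
          op_less w b v \<bind> (\<lambda>keep. if keep then dict_insert w x v rel else ret rel))) \<bind> for_each cs body))
     dict_map (?unif \<bind> ?rest) avl_search_tree
     (1 + ((sample_cost + (U + update_cost W)) + (length cs * (release_cost W + 1) + 1)))"
  proof (rule runs_bind_rand_oracle[OF d_pos])
    fix u assume u: "u \<in> {1..d}"
    obtain rel' where rel': "returns (fast_sample_run w mul_time n G (k, t0, q, p, d', d) c u \<bind> (\<lambda>v.
          op_less w b v \<bind> (\<lambda>keep. if keep then dict_insert w x v rel else ret rel)))
        rel' (sample_cost + (U + update_cost W))" "avl_search_tree rel'" "dict_map rel' = new u"
      using step[OF u] by blast
    have "dom (dict_map rel') \<subseteq> set D" unfolding rel'(3) new_def using Cons.prems(4) x(1) by auto
    from Cons.IH[OF dist sub rel'(2) this]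
    have "runs (for_each cs body rel') dict_map (?rest u) avl_search_tree (length cs * (release_cost W + 1) + 1)"
      unfolding rel'(3) .
    then show "runs ((fast_sample_run w mul_time n G (k, t0, q, p, d', d) c u \<bind> (\<lambda>v.
          op_less w b v \<bind> (\<lambda>keep. if keep then dict_insert w x v rel else ret rel))) \<bind> for_each cs body)
        dict_map (?rest u) avl_search_tree
        ((sample_cost + (U + update_cost W)) + (length cs * (release_cost W + 1) + 1))"
      by (rule runs_bind_returns[OF rel'(1)])
  qed
  then have "runs (body z rel \<bind> for_each cs body) dict_map (?unif \<bind> ?rest) avl_search_tree
     (release_cost W + (length cs * (release_cost W + 1) + 1))"
    unfolding body_def z prod.case bind_assoc by (simp add: release_cost_def add.assoc)
  then have "runs (for_each (z # cs) body rel) dict_map (?unif \<bind> ?rest) avl_search_tree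
     (1 + (release_cost W + (length cs * (release_cost W + 1) + 1)))"
    unfolding for_each.simps by (rule runs_bind_returns[OF returns_charge[OF order_refl]])
  moreover have "?unif \<bind> ?rest = map_pmf (?g (insert x ?A)) (Pi_pmf (insert x ?A) 0 (\<lambda>_. ?unif))"
    using x(4) by (subst Pi_pmf_insert')
      (auto simp: map_bind_pmf map_pmf_def bind_assoc_pmf bind_return_pmf new_def x(2) fun_eq_iff
        intro!: bind_pmf_cong arg_cong[where f = return_pmf])
  moreover have "fst ` set (z # cs) = insert x ?A" by (simp add: z)
  moreover have "1 + (release_cost W + (length cs * (release_cost W + 1) + 1)) =
      length (z # cs) * (release_cost W + 1) + 1" by simp
  ultimately show ?case by (simp only:)
qed

definition total_cost :: "nat \<Rightarrow> nat" where
  "total_cost W = (30 * U + 2 * w + pow_cost) + ((n * (update_cost W + 1) + 1) +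
     ((1 + 4 * n) + (n * (release_cost W + 1) + 1)))"

lemma stability_histogram_run_implements:
  assumes D: "D \<in> datasets n m" and W: "\<And>y. y \<le> m \<Longrightarrow> word_count w y \<le> W" and b: "b \<le> n"
  shows "implements_within (stability_histogram_run w mul_time n E G b D)
    (stability_histogram fs d b D) (real (total_cost W))"
proof -
  have len: "length D = n" and sub: "set D \<subseteq> {1..m}" using D by (auto simp: datasets_def)
  have W': "word_count w y \<le> W" if "y \<in> set D" for y using that sub by (intro W) auto
  obtain t where t: "returns (for_each D (dict_increment w) Leaf) t (n * (update_cost W + 1) + 1)"
    "avl_search_tree t" "dict_map t = counts D"
    using returns_counts[OF len W'] by blast
  let ?cs = "entries t"
  have dist: "distinct (map fst ?cs)" using t(2) by (auto simp: avl_search_tree_iff strict_sorted_iff)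
  have dom: "dom (dict_map t) = set D"
    unfolding t(3) using row_count_pos_iff[of D] by (auto simp: counts_def dom_def split: if_splits)
  then have fst_cs: "fst ` set ?cs = set D" by (simp add: dict_map_def dom_map_of_conv_image_fst)
  have cs: "x \<in> set D \<and> c = row_count D x \<and> c \<le> n" if "(x, c) \<in> set ?cs" for x c
  proof -
    have "counts D x = Some c" using that dist unfolding t(3)[symmetric] dict_map_def by simp
    then show ?thesis using row_count_pos_iff[of D x] row_count_le[of D x] len
      by (auto simp: counts_def split: if_splits)
  qed
  have size: "size t \<le> n" using size_avl_search_tree[OF t(2)] dom card_length[of D] len by simp
  then have ent: "returns (dict_entries t) ?cs (1 + 4 * n)"
    unfolding dict_entries_def by (intro returns_charge) simp
  have len_cs: "length ?cs \<le> n" using size by simp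
  have leaf: "avl_search_tree Leaf" "dict_map Leaf = (\<lambda>_. None)"
    by (simp_all add: avl_search_tree_def dict_map_def fun_eq_iff)
  \<comment> \<open>For the empty start tree the fallback value is \<open>None\<close>, and the law
    of the loop becomes the defining one.\<close>
  have H: "stability_histogram fs d b D =
    map_pmf (\<lambda>u y. if y \<in> fst ` set ?cs \<and> fs (row_count D y) (u y) > b
       then Some (fs (row_count D y) (u y)) else dict_map Leaf y)
       (Pi_pmf (fst ` set ?cs) 0 (\<lambda>_. pmf_of_set {1..d}))"
    unfolding stability_histogram_def Let_def fst_cs leaf(2) by (simp add: row_count_pos_iff)
  have "runs (for_each ?cs
       (\<lambda>(x, c) rel. do {
          u \<leftarrow> rand_oracle d;
          v \<leftarrow> fast_sample_run w mul_time n G (k, t0, q, p, d', d) c u;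
          keep \<leftarrow> op_less w b v;
          if keep then dict_insert w x v rel else ret rel }) Leaf) dict_map
      (stability_histogram fs d b D) avl_search_tree (length ?cs * (release_cost W + 1) + 1)"
    unfolding H using cs leaf by (intro runs_release[OF len W' b dist]) auto
  then have "runs (for_each ?cs
       (\<lambda>(x, c) rel. do {
          u \<leftarrow> rand_oracle d;
          v \<leftarrow> fast_sample_run w mul_time n G (k, t0, q, p, d', d) c u;
          keep \<leftarrow> op_less w b v;
          if keep then dict_insert w x v rel else ret rel }) Leaf) dict_map
      (stability_histogram fs d b D) avl_search_tree (n * (release_cost W + 1) + 1)"
    by (rule runs_weaken) (use len_cs in \<open>simp only: add_le_mono1 mult_le_mono1\<close>)
  then have "runs (stability_histogram_run w mul_time n E G b D) dict_map (stability_histogram fs d b D)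
      avl_search_tree (total_cost W)"
    unfolding stability_histogram_run_def total_cost_def
    by (intro runs_bind_returns[OF returns_fs_setup] runs_bind_returns[OF t(1)] runs_bind_returns[OF ent])
      (simp only: prod.case, intro runs_bind_returns[OF t(1)] runs_bind_returns[OF ent])
  then show ?thesis by (auto simp: runs_def implements_within_def)
qed

end

section \<open>Running time bound\<close>

text \<open>The tangent bound \<open>ln x \<le> x - 1\<close> is too weak for large x. Applied to x
  / 2 it gives \<open>ln x \<le> x / 2\<close>, and 1/2 is below ln 2.\<close>

lemma log2_le_self:
  fixes x :: real
  assumes "0 < x"
  shows "log 2 x \<le> x"
proof -
  have "ln x = ln (x / 2) + ln 2" using assms by (simp add: ln_div)
  also have "ln (x / 2) \<le> x / 2 - 1" using assms by (intro ln_le_minus_one) auto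
  also have "ln 2 \<le> (1::real)" using ln_le_minus_one[of "2::real"] by simp
  also have "x / 2 - 1 + 1 \<le> x * ln 2"
    using mult_left_mono[OF ln2_ge_two_thirds, of x] assms by simp
  finally show ?thesis by (simp add: log_def divide_simps)
qed

lemma floorlog_le_log: "1 \<le> x \<Longrightarrow> real (floorlog 2 x) \<le> log 2 (real x) + 1"
  by (auto simp: floorlog_def)

text \<open>A word holds at least one bit; for w = 0 the division yields 0 and the count is 1.
  Pricing by bits makes \<open>U\<close> independent of the word length.\<close>

lemma word_count_le: "word_count w x \<le> max 1 (floorlog 2 x)"
proof (cases "w = 0")
  case False
  have "floorlog 2 x + w - 1 < (floorlog 2 x + 1) * w" using False by (cases w) auto
  then have "(floorlog 2 x + w - 1) div w < floorlog 2 x + 1" by (rule less_mult_imp_div_less)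
  then show ?thesis unfolding word_count_def by (intro max.mono) auto
qed (simp add: word_count_def)

text \<open>The assumption on \<open>mul_time\<close> is asymptotic and does not make it monotone.
  The finitely many early values are absorbed by their sum \<open>M\<close>, which is possible since
  \<open>x * log 2 x ^ j\<close> is at least 1 for x \<ge> 2; the later ones follow from
  monotonicity of the bound.\<close>

lemma soft_bigo_envelope:
  fixes f :: "nat \<Rightarrow> nat"
  assumes "(\<lambda>x. real (f x)) \<in> soft_bigo at_top real"
  obtains C j where "0 \<le> C" "\<And>x y. 2 \<le> x \<Longrightarrow> y \<le> x \<Longrightarrow> real (f y) \<le> C * (real x * log 2 (real x) ^ j)"
proof -
  obtain j where "(\<lambda>x. real (f x)) \<in> O(\<lambda>x. real x * log 2 (real x) ^ j)"
    using assms by (auto simp: soft_bigo_def)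
  then obtain c where c: "c > 0" "eventually (\<lambda>x. norm (real (f x)) \<le> c * norm (real x * log 2 (real x) ^ j)) at_top"
    by (auto elim: landau_o.bigE)
  then obtain y0 where y0: "\<And>y. y \<ge> y0 \<Longrightarrow> norm (real (f y)) \<le> c * norm (real y * log 2 (real y) ^ j)"
    by (auto simp: eventually_at_top_linorder)
  define M where "M = (\<Sum>y<max 2 y0. real (f y))"
  have M: "0 \<le> M" unfolding M_def by (intro sum_nonneg) auto
  show thesis
  proof (rule that[of "c + M" j])
    show "0 \<le> c + M" using c M by simp
    fix x y :: nat assume x: "2 \<le> x" and y: "y \<le> x"
    have log1: "1 \<le> log 2 (real x)" using x by simp
    have ge: "1 \<le> real x * log 2 (real x) ^ j"
      using mult_mono[of 1 "real x" 1 "log 2 (real x) ^ j"] x one_le_power[OF log1, of j] by simp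
    show "real (f y) \<le> (c + M) * (real x * log 2 (real x) ^ j)"
    proof (cases "y < max 2 y0")
      case True
      then have "real (f y) \<le> M" unfolding M_def by (intro member_le_sum) auto
      also have "\<dots> \<le> (c + M) * 1" using c by simp
      also have "\<dots> \<le> (c + M) * (real x * log 2 (real x) ^ j)"
        using ge c M by (intro mult_left_mono) auto
      finally show ?thesis .
    next
      case False
      then have "real (f y) \<le> c * (real y * log 2 (real y) ^ j)" using y0[of y] by (simp add: abs_mult)
      also have "\<dots> \<le> c * (real x * log 2 (real x) ^ j)"
        using False y c by (intro mult_left_mono mult_mono power_mono) auto
      also have "\<dots> \<le> (c + M) * (real x * log 2 (real x) ^ j)"
        using ge M by (intro mult_right_mono) auto
      finally show ?thesis .
    qed
  qed
qed

text \<open>Here l stands for log n, L for the logarithm of the soft-O argument and m for log of the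
  universe size. Since l and L are at least 3 and U at least 2, each lower-order term is below a
  third or a sixth of a main term.\<close>

lemma total_cost_arith:
  fixes n U w L l m pow samp upd rls :: real
  assumes "1 \<le> n" "2 \<le> U" "0 \<le> w" "3 \<le> l" "l \<le> L" "0 \<le> m"
    and pow: "pow \<le> 4 * L * (4 * U + 1) + U + w + 1"
    and samp: "samp \<le> 2 * l * (25 * U + pow + 1) + U + w + 1"
    and upd: "upd \<le> 4 * l * (4 * (1 + m) + 1) + U + (1 + m) + 1"
    and rls: "rls \<le> 1 + (samp + (U + upd))"
  shows "(30 * U + 2 * w + pow) + ((n * (upd + 1) + 1) + ((1 + 4 * n) + (n * (rls + 1) + 1)))
    \<le> n * (300 * (l * L * U) + 6 * (l * w) + 40 * (l * m))"
proof -
  have L: "3 \<le> L" "0 \<le> l" "0 \<le> L" "0 \<le> U" using assms by auto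
  have a1: "3 * U \<le> L * U" and a2: "3 * w \<le> l * w" and a3: "3 * m \<le> l * m"
    and a4: "3 * (L * U) \<le> l * (L * U)" and a6: "3 * 2 \<le> L * U"
    using assms L by (intro mult_right_mono mult_left_mono mult_mono; simp)+
  have pow': "pow \<le> 22 * (L * U) + w"
  proof -
    have "L * 2 \<le> L * U" using assms L by (intro mult_left_mono) auto
    moreover have "pow \<le> 16 * (L * U) + 4 * L + U + w + 1" using pow by (simp add: algebra_simps)
    ultimately show ?thesis using a1 a6 by linarith
  qed
  have "25 * U + pow + 1 \<le> 48 * (L * U) + w" using pow' a1 a6 by linarith
  then have "2 * l * (25 * U + pow + 1) \<le> 2 * l * (48 * (L * U) + w)"
    using L by (intro mult_left_mono) auto
  also have "\<dots> = 96 * (l * (L * U)) + 2 * (l * w)" by (simp add: algebra_simps)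
  finally have samp': "samp \<le> 98 * (l * (L * U)) + 3 * (l * w)"
    using samp a1 a2 a4 a6 assms by linarith
  have upd': "upd \<le> 30 * (l * (L * U)) + 17 * (l * m)"
  proof -
    have "upd \<le> 20 * l + 16 * (l * m) + U + m + 2" using upd by (simp add: algebra_simps)
    moreover have "l * 6 \<le> l * (L * U)" using a6 L by (intro mult_left_mono) auto
    ultimately show ?thesis using a1 a3 a4 a6 assms by linarith
  qed
  have rest: "30 * U + 2 * w + pow + 3 \<le> 60 * (l * (L * U)) + 2 * (l * w)"
    using pow' a1 a2 a4 a6 assms by linarith
  have "0 \<le> l * (L * U)" "0 \<le> l * w" using L assms by auto
  then have "60 * (l * (L * U)) + 2 * (l * w) \<le> n * (60 * (l * (L * U)) + 2 * (l * w))"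
    using mult_right_mono[OF assms(1), of "60 * (l * (L * U)) + 2 * (l * w)"] by simp
  moreover have "upd + rls + 6 \<le> 240 * (l * (L * U)) + 3 * (l * w) + 40 * (l * m)"
    using upd' rls samp' a1 a3 a4 a6 assms by linarith
  then have "n * (upd + rls + 6) \<le> n * (240 * (l * (L * U)) + 3 * (l * w) + 40 * (l * m))"
    using assms by (intro mult_left_mono) auto
  moreover have "n * (upd + 1) + 4 * n + n * (rls + 1) = n * (upd + rls + 6)" by (simp add: algebra_simps)
  moreover have "n * (240 * (l * (L * U)) + 3 * (l * w) + 40 * (l * m)) + n * (60 * (l * (L * U)) + 2 * (l * w)) =
     n * (300 * (l * (L * U)) + 5 * (l * w) + 40 * (l * m))" by (simp add: algebra_simps)
  moreover have "n * (300 * (l * (L * U)) + 5 * (l * w) + 40 * (l * m)) \<le> n * (300 * (l * L * U) + 6 * (l * w) + 40 * (l * m))"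
    using assms \<open>0 \<le> l * w\<close> by (intro mult_left_mono) (auto simp: mult.assoc)
  ultimately show ?thesis using rest by linarith
qed

text \<open>\<open>E\<close>, \<open>B\<close> and \<open>\<Delta>\<close> are the reciprocals of
  \<epsilon>, \<open>\<beta>0\<close> and \<delta>. The bound 8 \<le> n comes from b \<le> n and
  \<open>threshold_ge_8\<close>, and gives \<open>log 2 n \<ge> 3\<close>.\<close>

locale histogram_params =
  fixes n E B \<Delta> :: nat
  assumes n8: "8 \<le> n" and E1: "1 \<le> E" and B1: "1 \<le> B" and \<Delta>1: "1 \<le> \<Delta>"
begin

definition G :: nat where "G = max (2 * n * B) (4 * \<Delta>)"

lemma G_ge: "4 \<le> G" using \<Delta>1 by (simp add: G_def)

sublocale fast_sample_params n E G
  using n8 E1 G_ge by unfold_locales auto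

text \<open>The maximum keeps the bound positive for \<open>\<beta>0 = \<delta> = 1\<close>, where
  the logarithm vanishes.\<close>

definition \<Lambda> :: real where "\<Lambda> = max 1 (log 2 (real (B * \<Delta>)))"
definition g :: real where "g = real n * real E * \<Lambda>"
definition L :: real where "L = log 2 g"

lemma \<Lambda>_ge: "1 \<le> \<Lambda>" by (simp add: \<Lambda>_def)

lemma log_bounds:
  shows "3 \<le> log 2 (real n)" "log 2 (real n) \<le> L" "log 2 (real E) \<le> L" "log 2 (real E * \<Lambda>) \<le> L" "3 \<le> L"
proof -
  have "log 2 8 \<le> log 2 (real n)" using n8 by (subst log_le_cancel_iff) auto
  moreover have "log 2 8 = (3::real)" using log_pow_cancel[of 2 3] by simp
  ultimately show 3: "3 \<le> log 2 (real n)" by simp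
  have nE: "1 \<le> real n" "1 \<le> real E" using n8 E1 by auto
  have "real n * 1 * 1 \<le> g" unfolding g_def using nE \<Lambda>_ge by (intro mult_mono) auto
  then show n: "log 2 (real n) \<le> L" unfolding L_def using nE by simp
  have "1 * real E * 1 \<le> g" unfolding g_def using nE \<Lambda>_ge by (intro mult_mono) auto
  then show "log 2 (real E) \<le> L" unfolding L_def using nE by simp
  have "1 * (real E * \<Lambda>) \<le> real n * (real E * \<Lambda>)" using nE \<Lambda>_ge by (intro mult_right_mono) auto
  then show "log 2 (real E * \<Lambda>) \<le> L" unfolding L_def g_def using nE \<Lambda>_ge
    by (subst log_le_cancel_iff) (auto simp: mult.assoc)
  show "3 \<le> L" using 3 n by linarith
qed

lemma log_n1: "log 2 (real (n + 1)) \<le> 1 + log 2 (real n)"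
proof -
  have "log 2 (real (n + 1)) \<le> log 2 (2 * real n)" using n8 by (subst log_le_cancel_iff) auto
  also have "\<dots> = 1 + log 2 (real n)" using n8 by (simp add: log_mult)
  finally show ?thesis .
qed

lemma log_G: "log 2 (real G) \<le> 3 + L + \<Lambda>"
proof -
  have "2 * n * B * 1 \<le> 2 * n * B * (4 * \<Delta>)" "1 * (4 * \<Delta>) \<le> 2 * n * B * (4 * \<Delta>)"
    using n8 B1 \<Delta>1 by (intro mult_le_mono; simp)+
  then have "G \<le> 8 * (n * (B * \<Delta>))" unfolding G_def by simp
  then have "log 2 (real G) \<le> log 2 (8 * (real n * real (B * \<Delta>)))"
    using G_ge n8 B1 \<Delta>1 by (subst log_le_cancel_iff) (auto simp flip: of_nat_mult)
  also have "\<dots> = log 2 8 + (log 2 (real n) + log 2 (real (B * \<Delta>)))"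
    using n8 B1 \<Delta>1 by (subst log_mult; simp)+
  also have "log 2 8 = (3::real)" using log_pow_cancel[of 2 3] by simp
  also have "log 2 (real n) \<le> L" by (rule log_bounds)
  also have "log 2 (real (B * \<Delta>)) \<le> \<Lambda>" by (simp add: \<Lambda>_def)
  finally show ?thesis by simp
qed

lemma L\<Lambda>_bounds: "3 * \<Lambda> \<le> L * \<Lambda>" "L \<le> L * \<Lambda>" "3 \<le> L * \<Lambda>"
proof -
  show a: "3 * \<Lambda> \<le> L * \<Lambda>" using log_bounds \<Lambda>_ge by (intro mult_right_mono) auto
  show "L \<le> L * \<Lambda>" using log_bounds \<Lambda>_ge mult_left_mono[of 1 \<Lambda> L] by simp
  show "3 \<le> L * \<Lambda>" using a \<Lambda>_ge by linarith
qed

lemma lg_le: "real lg \<le> 6 * (L * \<Lambda>)"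
proof -
  have pos: "0 < 8 * (n + 1) * E * (G - 1)" using E1 G_ge by simp
  have "8 * (n + 1) * E * (G - 1) \<le> 8 * (n + 1) * E * G" by (rule mult_le_mono2) simp
  then have le: "real (8 * (n + 1) * E * (G - 1)) \<le> real (8 * (n + 1) * E * G)" by (rule of_nat_mono)
  have "real lg \<le> log 2 (real (8 * (n + 1) * E * (G - 1))) + 1"
    unfolding lg_def using ceillog2_less_log[OF pos] by simp
  also have "log 2 (real (8 * (n + 1) * E * (G - 1))) \<le> log 2 (real (8 * (n + 1) * E * G))"
    using le pos E1 G_ge by (subst log_le_cancel_iff) (simp_all del: of_nat_mult)
  also have "real (8 * (n + 1) * E * G) = 8 * (real (n + 1) * (real E * real G))" by simp
  also have "log 2 \<dots> = log 2 8 + (log 2 (real (n + 1)) + (log 2 (real E) + log 2 (real G)))"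
    using E1 G_ge by (subst log_mult; simp)+
  also have "log 2 8 = (3::real)" using log_pow_cancel[of 2 3] by simp
  \<comment> \<open>The sum is at most 8 + 3 L + \<Lambda>, and \<open>L\<Lambda>_bounds\<close>
    turns its terms into 8/3, 3 and 1/3 multiples of L \<Lambda>, six in all.\<close>
  finally show ?thesis using log_n1 log_bounds log_G L\<Lambda>_bounds by linarith
qed

lemma t0_le: "real (t0 + 1) \<le> 30 * (real E * (L * \<Lambda>))"
proof -
  have "2 * (t0 + 1) \<le> 9 * E * lg + 1" unfolding t0_Suc by simp
  moreover have "1 * 1 \<le> E * lg" using E1 lg_bounds by (intro mult_le_mono) auto
  ultimately have "t0 + 1 \<le> 5 * (E * lg)" by (simp add: mult.assoc)
  then have "real (t0 + 1) \<le> real (5 * (E * lg))" by (rule of_nat_mono)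
  also have "\<dots> = 5 * (real E * real lg)" by simp
  also have "\<dots> \<le> 5 * (real E * (6 * (L * \<Lambda>)))" using lg_le by (intro mult_left_mono) auto
  finally show ?thesis by simp
qed

lemma k_le: "real k \<le> L + 2"
proof -
  have "real k < log 2 (real (2 * E)) + 1" unfolding k_def using E1 by (intro ceillog2_less_log) auto
  also have "log 2 (real (2 * E)) = 1 + log 2 (real E)" using E1 by (simp add: log_mult)
  finally show ?thesis using log_bounds by linarith
qed

text \<open>One factor L is the number of bits \<open>k\<close> of the base \<open>q\<close>, the
  other the logarithm \<open>lg\<close> inside the exponent \<open>t0\<close>.\<close>

lemma log_d'_le: "log 2 (real d') \<le> 90 * (real E * L\<^sup>2 * \<Lambda>)"
proof -
  have "2 ^ (k + 1) + 1 \<le> (2::nat) ^ (k + 2)" by simp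
  moreover have "q \<le> 2 ^ (k + 2)" by (simp add: q_def)
  ultimately have "d' \<le> 2 ^ (k + 2) * (2 ^ (k + 2)) ^ t0"
    unfolding d'_def by (intro mult_le_mono power_mono) auto
  also have "\<dots> = 2 ^ ((k + 2) * (t0 + 1))" unfolding power_mult by simp
  finally have "real d' \<le> 2 ^ ((k + 2) * (t0 + 1))" using of_nat_mono by fastforce
  then have "log 2 (real d') \<le> log 2 (2 ^ ((k + 2) * (t0 + 1)))"
    using d'_pos by (subst log_le_cancel_iff) auto
  also have "\<dots> = (real k + 2) * real (t0 + 1)" 
  proof -
    have "log 2 (2 ^ i :: real) = real i" for i by simp
    then show ?thesis by (simp only: of_nat_mult of_nat_add of_nat_numeral)
  qed
  also have "\<dots> \<le> (3 * L) * (30 * (real E * (L * \<Lambda>)))"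
    using k_le t0_le log_bounds(5) by (intro mult_mono) auto
  also have "\<dots> = 90 * (real E * L\<^sup>2 * \<Lambda>)" by (simp add: power2_eq_square)
  finally show ?thesis .
qed

definition X :: nat where "X = floorlog 2 (16 * d)"

lemma EL2\<Lambda>_ge: "3 * (L * \<Lambda>) \<le> real E * L\<^sup>2 * \<Lambda>"
proof -
  have "1 * (3 * (L * \<Lambda>)) \<le> real E * (L * (L * \<Lambda>))"
    using E1 log_bounds(5) L\<Lambda>_bounds by (intro mult_mono) auto
  then show ?thesis by (simp add: power2_eq_square mult.assoc)
qed

lemma X_le: "real X \<le> 100 * (real E * L\<^sup>2 * \<Lambda>)" and X_ge: "2 \<le> X"
proof -
  have "real X \<le> log 2 (real (16 * d)) + 1" unfolding X_def using d_pos by (intro floorlog_le_log) simp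
  also have "real (16 * d) = 16 * (real (n + 1) * (real d' * real G))" by (simp add: d_def del: mult_Suc)
  also have "log 2 \<dots> = log 2 16 + (log 2 (real (n + 1)) + (log 2 (real d') + log 2 (real G)))"
    using d'_pos G_ge by (subst log_mult; simp)+
  also have "log 2 16 = (4::real)" using log_pow_cancel[of 2 4] by simp
  finally show "real X \<le> 100 * (real E * L\<^sup>2 * \<Lambda>)"
    using log_n1 log_bounds log_G log_d'_le EL2\<Lambda>_ge L\<Lambda>_bounds by linarith
  have "2 ^ (2 - 1) \<le> 16 * d" using d_pos by simp
  then show "2 \<le> X" unfolding X_def by (rule floorlog_geI) simp
qed

text \<open>The number of bits is polynomial in quantities with logarithm at most L, so the
  logarithmic factors of \<open>mul_time\<close> turn into powers of L. For the factor
  \<open>L\<^sup>2\<close> the crude \<open>log 2 L \<le> L\<close> is enough.\<close>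

lemma log_X_le: "log 2 (real X) \<le> 6 * L"
proof -
  have pos: "0 < real E * \<Lambda>" "0 < L" using E1 \<Lambda>_ge log_bounds by auto
  have "log 2 (real X) \<le> log 2 (100 * (real E * L\<^sup>2 * \<Lambda>))" using X_le X_ge by (subst log_le_cancel_iff) auto
  also have "100 * (real E * L\<^sup>2 * \<Lambda>) = 100 * ((real E * \<Lambda>) * (L * L))" by (simp add: power2_eq_square)
  also have "log 2 \<dots> = log 2 100 + (log 2 (real E * \<Lambda>) + (log 2 L + log 2 L))"
    using pos by (simp only: log_mult_pos mult_pos_pos zero_less_numeral)
  also have "log 2 100 \<le> log 2 (2 ^ 7 :: real)" by (subst log_le_cancel_iff) auto
  also have "log 2 (2 ^ 7 :: real) = 7" by (subst log_pow_cancel) simp_all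
  finally show ?thesis using log_bounds log2_le_self[OF pos(2)] by linarith
qed

lemma ell_le: "real (floorlog 2 (t0 + 1)) \<le> 4 * L"
proof -
  have pos: "0 < real E * \<Lambda>" "0 < L" using E1 \<Lambda>_ge log_bounds by auto
  have "real (floorlog 2 (t0 + 1)) \<le> log 2 (real (t0 + 1)) + 1" by (rule floorlog_le_log) simp
  also have "log 2 (real (t0 + 1)) \<le> log 2 (32 * ((real E * \<Lambda>) * L))"
    using t0_le pos by (subst log_le_cancel_iff) (auto simp: mult_ac intro: order_trans)
  also have "\<dots> = log 2 32 + (log 2 (real E * \<Lambda>) + log 2 L)"
    using pos by (simp only: log_mult_pos mult_pos_pos zero_less_numeral)
  also have "log 2 32 = (5::real)" using log_pow_cancel[of 2 5] by simp
  finally show ?thesis using log_bounds log2_le_self[OF pos(2)] by linarith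
qed

text \<open>The exponent j + 4 collects two powers of L from the length of the numbers, j from
  \<open>mul_time\<close>, one from the rounds of the binary search and one from the rounds of
  repeated squaring.\<close>

lemma running_time:
  fixes mul_time :: "nat \<Rightarrow> nat" and C K :: real and j :: nat
  assumes C: "0 \<le> C" "\<And>x y. 2 \<le> x \<Longrightarrow> y \<le> x \<Longrightarrow> real (mul_time y) \<le> C * (real x * log 2 (real x) ^ j)"
    and w: "real w \<le> K * (log 2 (real n) + log 2 (real m))" and K: "0 \<le> K" and m: "1 \<le> m"
    and D: "D \<in> datasets n m" and b: "b \<le> n"
  shows "\<exists>T. implements_within (stability_histogram_run w mul_time n E G b D) (stability_histogram fs d b D) T \<and>
    T \<le> (300 * ((4 + C) * 6 ^ j * 100) + 6 * K) * (g * L ^ (j + 4)) +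
        (6 * K + 40) * (real n * log 2 (real n) * log 2 (real m))"
proof -
  define U where "U = max (2 * X) (Max (mul_time ` {..X}))"
  have U_mul: "mul_time y \<le> U" if "y \<le> X" for y
  proof -
    have "mul_time y \<le> Max (mul_time ` {..X})" using that by (intro Max_ge) auto
    then show ?thesis by (simp add: U_def)
  qed
  interpret fast_sample_cost n E G w mul_time U
  proof
    have "2 * word_count w (16 * d) \<le> 2 * X"
      using word_count_le[of w "16 * d"] X_ge unfolding X_def by simp
    then show "2 * word_count w (16 * d) \<le> U" unfolding U_def by (rule max.coboundedI1)
  qed (use U_mul in \<open>simp add: X_def\<close>)
  have L1: "1 \<le> L" using log_bounds by simp
  have E\<Lambda>: "0 \<le> real E * \<Lambda>" "1 \<le> real E * \<Lambda>" using \<Lambda>_ge E1 mult_mono[of 1 "real E" 1 \<Lambda>] by auto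
  have logX: "0 \<le> log 2 (real X)" using X_ge by simp
  have pow6: "1 \<le> (6 * L) ^ j" using L1 by (intro one_le_power) simp
  have U_le: "real U \<le> ((4 + C) * 6 ^ j * 100) * (real E * \<Lambda> * L ^ (j + 2))"
  proof -
    have "Max (mul_time ` {..X}) \<in> mul_time ` {..X}" by (intro Max_in) auto
    then obtain y where y: "y \<le> X" "Max (mul_time ` {..X}) = mul_time y" by (elim imageE) simp
    have "real U \<le> real (2 * X) + real (mul_time y)" unfolding U_def y(2) by simp
    also have "real (mul_time y) \<le> C * (real X * log 2 (real X) ^ j)" using C(2)[OF X_ge y(1)] .
    also have "\<dots> \<le> C * (real X * (6 * L) ^ j)"
      using C(1) logX log_X_le by (intro mult_left_mono power_mono) auto
    also have "real (2 * X) \<le> 4 * (real X * (6 * L) ^ j)"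
      using mult_left_mono[OF pow6, of "real X"] by simp
    also have "4 * (real X * (6 * L) ^ j) + C * (real X * (6 * L) ^ j) = (4 + C) * ((6 * L) ^ j * real X)"
      by (simp add: algebra_simps)
    also have "\<dots> \<le> (4 + C) * ((6 * L) ^ j * (100 * (real E * L\<^sup>2 * \<Lambda>)))"
      using X_le C(1) pow6 by (intro mult_left_mono) auto
    also have "\<dots> = ((4 + C) * 6 ^ j * 100) * (real E * \<Lambda> * L ^ (j + 2))"
      by (simp add: power_mult_distrib power_add power2_eq_square)
    finally show ?thesis by simp
  qed
  define W where "W = max 1 (floorlog 2 m)"
  have W: "word_count w y \<le> W" if "y \<le> m" for y
    using word_count_le[of w y] floorlog_mono[OF that, of 2] unfolding W_def by linarith
  have logm: "0 \<le> log 2 (real m)" using m by simp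
  have W_le: "real W \<le> 1 + log 2 (real m)" using floorlog_le_log[OF m] logm by (simp add: W_def)
  let ?l = "log 2 (real n)" and ?m = "log 2 (real m)"
  have fl_n: "real (floorlog 2 n) \<le> 2 * ?l" using floorlog_le_log[of n] n8 log_bounds by simp
  have hb: "real height_bound \<le> 4 * ?l"
    using floorlog_le_log[of "n + 1"] log_n1 log_bounds unfolding height_bound_def by simp
  have "real (total_cost W) = (30 * real U + 2 * real w + real pow_cost) + ((real n * (real (update_cost W) + 1) + 1) +
     ((1 + 4 * real n) + (real n * (real (release_cost W) + 1) + 1)))"
    by (simp add: total_cost_def algebra_simps)
  also have "\<dots> \<le> real n * (300 * (?l * L * real U) + 6 * (?l * real w) + 40 * (?l * ?m))"
  proof (rule total_cost_arith[where samp = "real sample_cost"])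
    show "1 \<le> real n" using n8 by simp
    show "2 \<le> real U" using U_pos by simp
    show "real pow_cost \<le> 4 * L * (4 * real U + 1) + real U + real w + 1"
    proof -
      have "real pow_cost = real (floorlog 2 (t0 + 1)) * (4 * real U + 1) + real U + real w + 1"
        by (simp only: pow_cost_def ell_def of_nat_add of_nat_mult of_nat_numeral of_nat_1)
      then show ?thesis using mult_right_mono[OF ell_le, of "4 * real U + 1"] by linarith
    qed
    show "real sample_cost \<le> 2 * ?l * (25 * real U + real pow_cost + 1) + real U + real w + 1"
    proof -
      have "real sample_cost = real (floorlog 2 n) * (25 * real U + real pow_cost + 1) + real U + real w + 1"
        by (simp only: sample_cost_def of_nat_add of_nat_mult of_nat_numeral of_nat_1)
      then show ?thesis using mult_right_mono[OF fl_n, of "25 * real U + real pow_cost + 1"] by linarith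
    qed
    have "real height_bound * (4 * real W + 1) \<le> 4 * ?l * (4 * (1 + ?m) + 1)"
      using hb W_le log_bounds by (intro mult_mono) auto
    moreover have "real (update_cost W) = real height_bound * (4 * real W + 1) + real U + real W + 1"
      by (simp only: update_cost_def of_nat_add of_nat_mult of_nat_numeral of_nat_1)
    ultimately show "real (update_cost W) \<le> 4 * ?l * (4 * (1 + ?m) + 1) + real U + (1 + ?m) + 1"
      using W_le by linarith
    show "real (release_cost W) \<le> 1 + (real sample_cost + (real U + real (update_cost W)))"
      by (simp add: release_cost_def)
  qed (use log_bounds logm in auto)
  also have "\<dots> \<le> (300 * ((4 + C) * 6 ^ j * 100) + 6 * K) * (g * L ^ (j + 4)) + (6 * K + 40) * (real n * ?l * ?m)"
  proof -
    let ?c = "(4 + C) * 6 ^ j * 100"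
    have "?l * L * real U \<le> L * L * (?c * (real E * \<Lambda> * L ^ (j + 2)))"
      using U_le log_bounds by (intro mult_mono) auto
    also have "\<dots> = ?c * (real E * \<Lambda> * L ^ (j + 4))" by (simp add: power_add power2_eq_square power4_eq_xxxx)
    finally have 1: "?l * L * real U \<le> ?c * (real E * \<Lambda> * L ^ (j + 4))" .
    \<comment> \<open>The word length is O(log n + log m). Its first part goes into the soft-O term,
      its second into the term with the universe.\<close>
    have "?l * real w \<le> ?l * (K * (?l + ?m))" using w log_bounds by (intro mult_left_mono) auto
    also have "\<dots> = K * (?l * ?l) + K * (?l * ?m)" by (simp add: algebra_simps)
    also have "?l * ?l \<le> L * L" using log_bounds by (intro mult_mono) auto
    then have "K * (?l * ?l) \<le> K * (L ^ 2)" using K by (intro mult_left_mono) (auto simp: power2_eq_square)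
    also have "K * (L ^ 2) \<le> K * (real E * \<Lambda> * L ^ (j + 4))"
    proof (intro mult_left_mono K)
      have "1 * L ^ 2 \<le> real E * \<Lambda> * L ^ (j + 4)"
        using E\<Lambda> L1 by (intro mult_mono power_increasing) auto
      then show "L ^ 2 \<le> real E * \<Lambda> * L ^ (j + 4)" by simp
    qed
    finally have 2: "?l * real w \<le> K * (real E * \<Lambda> * L ^ (j + 4)) + K * (?l * ?m)" by simp
    have "real n * (300 * (?l * L * real U) + 6 * (?l * real w) + 40 * (?l * ?m)) \<le>
      real n * (300 * (?c * (real E * \<Lambda> * L ^ (j + 4))) + 6 * (K * (real E * \<Lambda> * L ^ (j + 4)) + K * (?l * ?m)) + 40 * (?l * ?m))"
      using 1 2 by (intro mult_left_mono) auto
    also have "\<dots> = (300 * ?c + 6 * K) * (g * L ^ (j + 4)) + (6 * K + 40) * (real n * ?l * ?m)"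
      unfolding g_def by (simp add: algebra_simps)
    finally show ?thesis .
  qed
  finally show ?thesis using stability_histogram_run_implements[OF D W b] by blast
qed

end

lemma unit_fractionsE:
  assumes "x \<in> unit_fractions"
  obtains k :: nat where "k \<ge> 1" "x = 1 / real k"
  using assms by (auto simp: unit_fractions_def Suc_le_eq)

lemma ceiling_add_le: "\<lceil>x\<rceil> + \<lceil>y\<rceil> \<le> \<lceil>x + y\<rceil> + (1 :: int)" for x y :: real
  by linarith

lemma per_query_accuracy_trivial: "1 \<le> \<beta> \<Longrightarrow> per_query_accuracy n m a \<beta> t H"
  unfolding per_query_accuracy_def by (intro ballI impI order_trans[OF _ measure_nonneg]) simp

lemma simultaneous_accuracy_trivial: "1 \<le> \<beta> \<Longrightarrow> simultaneous_accuracy n m a \<beta> H"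
  unfolding simultaneous_accuracy_def by (intro ballI order_trans[OF _ measure_nonneg]) simp

lemma inverse_max:
  fixes a b :: nat
  assumes "1 \<le> a" "1 \<le> b"
  shows "1 / real (max a b) = min (1 / real a) (1 / real b)"
proof (cases "a \<le> b")
  case True
  then have "1 / real b \<le> 1 / real a" using assms by (intro divide_left_mono) auto
  then show ?thesis using True by (simp add: max_absorb2 min_absorb2)
next
  case False
  then have "1 / real a \<le> 1 / real b" using assms by (intro divide_left_mono) auto
  then show ?thesis using False by (simp add: max_absorb1 min_absorb1)
qed

lemma implements_within_mono: "implements_within p H T \<Longrightarrow> T \<le> T' \<Longrightarrow> implements_within p H T'"
  by (fastforce simp: implements_within_def)

text \<open>The absolute value appears because the sign of \<open>K\<close> is not
  restricted.\<close>

lemma word_length_ok_le: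
  assumes "word_length_ok K n m w" "1 \<le> n" "1 \<le> m"
  shows "real w \<le> \<bar>K\<bar> * (log 2 (real n) + log 2 (real m))"
proof -
  let ?s = "log 2 (real n) + log 2 (log 2 (real m))"
  have "0 \<le> log 2 (log 2 (real m)) \<and> log 2 (log 2 (real m)) \<le> log 2 (real m)"
  proof (cases "m = 1")
    case False
    then have "1 \<le> log 2 (real m)" using assms(3) by simp
    then show ?thesis using log2_le_self[of "log 2 (real m)"] by simp
  qed (simp add: log_def)
  moreover have "0 \<le> log 2 (real n)" using assms(2) by simp
  ultimately have s: "0 \<le> ?s" "?s \<le> log 2 (real n) + log 2 (real m)" by auto
  have "real w \<le> K * ?s" using assms(1) by (simp add: word_length_ok_def)
  also have "\<dots> \<le> \<bar>K\<bar> * ?s" using s by (intro mult_right_mono) auto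
  also have "\<dots> \<le> \<bar>K\<bar> * (log 2 (real n) + log 2 (real m))" using s by (intro mult_left_mono) auto
  finally show ?thesis .
qed

section \<open>The concrete threshold and its accuracy\<close>

context fast_sample_params
begin

definition threshold :: "real \<Rightarrow> nat" where
  "threshold \<delta> = 1 + nat \<lceil>9 / 2 * real E * ln (4 / \<delta>)\<rceil>"

text \<open>Applied with x = \<delta>/4 for the threshold, x = \<beta>/2 for a single query and x =
  \<beta>/(2n) for all queries at once.\<close>

lemma r_power_ceiling:
  assumes "0 < x" "nat \<lceil>9 / 2 * real E * ln (1 / x)\<rceil> \<le> a"
  shows "r ^ a \<le> x"
proof -
  have "9 / 2 * real E * ln (1 / x) \<le> real a" using assms(2) by linarith
  then have "r ^ a \<le> exp (- ln (1 / x))" by (rule r_power_le)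
  also have "\<dots> = x" using assms(1) by (simp add: ln_div)
  finally show ?thesis .
qed

lemma threshold_private:
  assumes "0 < \<delta>" "\<gamma> \<le> \<delta> / 4"
  shows "differentially_private n m \<epsilon> \<delta> (stability_histogram fs d (threshold \<delta>))"
proof (rule stability_histogram_private)
  have eq: "1 / (\<delta> / 4) = 4 / \<delta>" by simp
  have "r ^ threshold \<delta> \<le> \<delta> / 4"
  proof (rule r_power_ceiling)
    show "nat \<lceil>9 / 2 * real E * ln (1 / (\<delta> / 4))\<rceil> \<le> threshold \<delta>"
      unfolding threshold_def eq by (rule le_add2)
  qed (use assms(1) in simp)
  then show "\<gamma> + r ^ threshold \<delta> \<le> \<delta> / 2" using assms(2) by linarith
qed (simp add: threshold_def)

text \<open>Origin of the 2 in the accuracy bounds: one unit is the 1 in the threshold, the other is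
  lost when two ceilings are merged into the ceiling of a sum.\<close>

lemma ceiling_thresholds:
  fixes x \<delta> :: real
  assumes "0 < x" "x \<le> 1" "0 < \<delta>" "\<delta> \<le> 1"
  shows "int (nat \<lceil>9 / 2 * real E * ln (1 / x)\<rceil>) + int (threshold \<delta>) \<le> 2 + \<lceil>9 / 2 * real E * ln (4 / (x * \<delta>))\<rceil>"
proof -
  have pos: "0 \<le> \<lceil>9 / 2 * real E * ln (1 / x)\<rceil>" "0 \<le> \<lceil>9 / 2 * real E * ln (4 / \<delta>)\<rceil>"
  proof -
    have "0 \<le> 9 / 2 * real E * ln (1 / x)" "0 \<le> 9 / 2 * real E * ln (4 / \<delta>)"
      using assms by (intro mult_nonneg_nonneg ln_ge_zero; simp add: field_simps)+
    then show "0 \<le> \<lceil>9 / 2 * real E * ln (1 / x)\<rceil>" "0 \<le> \<lceil>9 / 2 * real E * ln (4 / \<delta>)\<rceil>"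
      by linarith+
  qed
  have "4 / (x * \<delta>) = (1 / x) * (4 / \<delta>)" by simp
  moreover have "ln ((1 / x) * (4 / \<delta>)) = ln (1 / x) + ln (4 / \<delta>)" using assms by (intro ln_mult_pos) auto
  ultimately have "ln (4 / (x * \<delta>)) = ln (1 / x) + ln (4 / \<delta>)" by (simp only:)
  then have eq: "9 / 2 * real E * ln (4 / (x * \<delta>)) = 9 / 2 * real E * ln (1 / x) + 9 / 2 * real E * ln (4 / \<delta>)"
    by (simp only: distrib_left)
  have "int (nat \<lceil>9 / 2 * real E * ln (1 / x)\<rceil>) = \<lceil>9 / 2 * real E * ln (1 / x)\<rceil>"
    "int (threshold \<delta>) = 1 + \<lceil>9 / 2 * real E * ln (4 / \<delta>)\<rceil>"
    unfolding threshold_def of_nat_add by (simp_all only: int_nat_eq pos if_True of_nat_1)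
  then show ?thesis
    unfolding eq using ceiling_add_le[of "9 / 2 * real E * ln (1 / x)" "9 / 2 * real E * ln (4 / \<delta>)"] by linarith
qed

lemma threshold_per_query:
  assumes "0 < \<delta>" "\<delta> \<le> 1" "2 * \<gamma> \<le> \<beta>"
  shows "per_query_accuracy n m \<lceil>9 / (2 * \<epsilon>) * ln (2 / \<beta>)\<rceil> \<beta> (2 + \<lceil>9 / (2 * \<epsilon>) * ln (8 / (\<beta> * \<delta>))\<rceil>)
    (stability_histogram fs d (threshold \<delta>))"
\<comment> \<open>For \<beta> > 2 the logarithm is negative and so may be the tolerance, but for
  \<beta> \<ge> 1 nothing is claimed.\<close>
proof (cases "1 \<le> \<beta>")
  case True
  then show ?thesis by (rule per_query_accuracy_trivial)
next
  case False
  have "0 < 2 * \<gamma>" using G by simp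
  then have \<beta>: "0 < \<beta>" using assms(3) by linarith
  define a where "a = nat \<lceil>9 / 2 * real E * ln (1 / (\<beta> / 2))\<rceil>"
  have "0 \<le> 9 / 2 * real E * ln (2 / \<beta>)"
    using \<beta> False by (intro mult_nonneg_nonneg ln_ge_zero) (auto simp: field_simps)
  then have a: "\<lceil>9 / (2 * \<epsilon>) * ln (2 / \<beta>)\<rceil> = int a" unfolding a_def by simp
  have "r ^ a \<le> \<beta> / 2" using \<beta> by (intro r_power_ceiling) (simp_all add: a_def)
  then have "\<gamma> + r ^ a \<le> \<beta>" using assms(3) by linarith
  moreover have "int a + int (threshold \<delta>) \<le> 2 + \<lceil>9 / (2 * \<epsilon>) * ln (8 / (\<beta> * \<delta>))\<rceil>"
    using ceiling_thresholds[of "\<beta> / 2" \<delta>] \<beta> False assms(1,2) by (simp add: a_def)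
  ultimately show ?thesis unfolding a by (rule stability_histogram_per_query)
qed

lemma threshold_simultaneous:
  assumes "0 < \<delta>" "\<delta> \<le> 1" "2 * real n * \<gamma> \<le> \<beta>"
  shows "simultaneous_accuracy n m (2 + \<lceil>9 / (2 * \<epsilon>) * ln (8 * real n / (\<beta> * \<delta>))\<rceil>) \<beta>
    (stability_histogram fs d (threshold \<delta>))"
proof (cases "1 \<le> \<beta>")
  case True
  then show ?thesis by (rule simultaneous_accuracy_trivial)
next
  case False
  have "0 < 2 * real n * \<gamma>" using G n by simp
  then have \<beta>: "0 < \<beta>" using assms(3) by linarith
  \<comment> \<open>Each element may fail with probability \<beta>/n: half for the uniform part,
    since \<gamma> \<le> \<beta>/(2n), and half for the geometric tail.\<close>
  let ?x = "\<beta> / (2 * real n)"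
  have x: "0 < ?x" "?x \<le> 1" using \<beta> False n by (auto simp: field_simps)
  define a where "a = nat \<lceil>9 / 2 * real E * ln (1 / ?x)\<rceil>"
  have "r ^ a \<le> ?x" using x by (intro r_power_ceiling) (simp_all add: a_def)
  then have "real n * r ^ a \<le> \<beta> / 2" using n by (simp add: field_simps)
  moreover have "2 * (real n * \<gamma>) \<le> \<beta>" using assms(3) by (simp only: mult.assoc)
  ultimately have "real n * (\<gamma> + r ^ a) \<le> \<beta>" unfolding distrib_left by linarith
  moreover have "4 / (?x * \<delta>) = 8 * real n / (\<beta> * \<delta>)" using n \<beta> assms(1) by (simp add: field_simps)
  then have "int a + int (threshold \<delta>) \<le> 2 + \<lceil>9 / (2 * \<epsilon>) * ln (8 * real n / (\<beta> * \<delta>))\<rceil>"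
    using ceiling_thresholds[OF x assms(1,2)] by (simp add: a_def)
  ultimately show ?thesis by (rule stability_histogram_simultaneous)
qed

text \<open>The extreme case is \<epsilon> = \<delta> = 1, where 9/2 * ln 4 is about 6.24. The bound
  ln 2 \<ge> 2/3 would yield exactly 6 and miss the ceiling 7; splitting 2 as 4/3 * 3/2 sharpens it
  to 24/35.\<close>

lemma threshold_ge_8:
  assumes "0 < \<delta>" "\<delta> \<le> 1"
  shows "8 \<le> threshold \<delta>"
proof -
  have "2 * (1 / 3) / (2 + 1 / 3) \<le> ln (1 + 1 / 3 :: real)" "2 * (1 / 2) / (2 + 1 / 2) \<le> ln (1 + 1 / 2 :: real)"
    by (rule ln_one_plus_ge; simp)+
  then have "2 / 7 \<le> ln (4 / 3 :: real)" "2 / 5 \<le> ln (3 / 2 :: real)" by simp_all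
  moreover have "ln (4 / 3 :: real) + ln (3 / 2) = ln 2" by (subst ln_mult_pos[symmetric]) auto
  moreover have "ln (4::real) = ln 2 + ln 2" by (subst ln_mult_pos[symmetric]) auto
  moreover have "ln 4 \<le> ln (4 / \<delta>)" using assms by (subst ln_le_cancel_iff) (auto simp: field_simps)
  ultimately have "48 / 35 \<le> ln (4 / \<delta>)" by linarith
  moreover have "1 * ln (4 / \<delta>) \<le> real E * ln (4 / \<delta>)"
    using E assms by (intro mult_right_mono ln_ge_zero) (auto simp: field_simps)
  ultimately have "6 < 9 / 2 * (real E * ln (4 / \<delta>))" by linarith
  then have "7 \<le> \<lceil>9 / 2 * real E * ln (4 / \<delta>)\<rceil>" unfolding mult.assoc by linarith
  then show ?thesis unfolding threshold_def by linarith
qed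

end

theorem theorem5p4:
  fixes \<gamma> :: "nat \<Rightarrow> real \<Rightarrow> real \<Rightarrow> real"
    and b :: "real \<Rightarrow> real \<Rightarrow> nat"
    and H :: "nat \<Rightarrow> real \<Rightarrow> real \<Rightarrow> real \<Rightarrow> nat list \<Rightarrow> partial_histogram pmf"
    and P Q :: "(nat \<times> nat \<times> real \<times> real \<times> real) set"
  assumes \<gamma>: "\<And>n \<delta> \<beta>0. \<gamma> n \<delta> \<beta>0 = min (\<beta>0 / (2 * real n)) (\<delta> / 4)"
    and b: "\<And>\<epsilon> \<delta>. b \<epsilon> \<delta> = 1 + nat \<lceil>9 / (2 * \<epsilon>) * ln (4 / \<delta>)\<rceil>"
    and H: "\<And>n \<epsilon> \<delta> \<beta>0. H n \<epsilon> \<delta> \<beta>0 =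
              stability_histogram (fast_sample n \<epsilon> (\<gamma> n \<delta> \<beta>0)) (fs_d n \<epsilon> (\<gamma> n \<delta> \<beta>0)) (b \<epsilon> \<delta>)"
    and P: "P = {(n, m, \<epsilon>, \<delta>, \<beta>0). n \<ge> 1 \<and> m \<ge> 1 \<and>
              \<epsilon> \<in> unit_fractions \<and> \<delta> \<in> unit_fractions \<and> \<beta>0 \<in> unit_fractions}"
    and Q: "Q = {(n, m, \<epsilon>, \<delta>, \<beta>0) \<in> P. b \<epsilon> \<delta> \<in> {0..n}}"
  shows "(\<forall>(n, m, \<epsilon>, \<delta>, \<beta>0) \<in> P.
            differentially_private n m \<epsilon> \<delta> (H n \<epsilon> \<delta> \<beta>0) \<and>
            (\<forall>\<beta> \<ge> 2 * \<gamma> n \<delta> \<beta>0.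
               per_query_accuracy n m \<lceil>9 / (2 * \<epsilon>) * ln (2 / \<beta>)\<rceil> \<beta>
                 (2 + \<lceil>9 / (2 * \<epsilon>) * ln (8 / (\<beta> * \<delta>))\<rceil>) (H n \<epsilon> \<delta> \<beta>0)) \<and>
            (\<forall>\<beta> \<ge> \<beta>0.
               simultaneous_accuracy n m (2 + \<lceil>9 / (2 * \<epsilon>) * ln (8 * real n / (\<beta> * \<delta>))\<rceil>) \<beta>
                 (H n \<epsilon> \<delta> \<beta>0))) \<and>
         (\<forall>(mul_time :: nat \<Rightarrow> nat) (K :: real).
            (\<lambda>x. real (mul_time x)) \<in> soft_bigo at_top real \<longrightarrow>
            (\<exists>T1 \<in> soft_bigo (principal Q)
                     (\<lambda>(n, m, \<epsilon>, \<delta>, \<beta>0). real n / \<epsilon> * max 1 (log 2 (1 / (\<beta>0 * \<delta>)))).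
             \<exists>T2 \<in> O[principal Q](\<lambda>(n, m, \<epsilon>, \<delta>, \<beta>0). real n * log 2 (real n) * log 2 (real m)).
             \<forall>(n, m, \<epsilon>, \<delta>, \<beta>0) \<in> Q.
               (\<forall>w. word_length_ok K n m w \<longrightarrow>
                 (\<forall>D \<in> datasets n m.
                    implements_within
                      (stability_histogram_run w mul_time n
                         (nat \<lfloor>1 / \<epsilon>\<rfloor>) (nat \<lfloor>1 / \<gamma> n \<delta> \<beta>0\<rfloor>) (b \<epsilon> \<delta>) D)
                      (H n \<epsilon> \<delta> \<beta>0 D)
                      (T1 (n, m, \<epsilon>, \<delta>, \<beta>0) + T2 (n, m, \<epsilon>, \<delta>, \<beta>0))))))"
proof -
  \<comment> \<open>Passage to reciprocals: 1/\<gamma> is the maximum of 2 n B and 4 \<Delta>, hence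
    again a natural number.\<close>
  have params: "\<exists>E B \<Delta> G. fast_sample_params n E G \<and> E \<ge> 1 \<and> B \<ge> 1 \<and> \<Delta> \<ge> 1 \<and> \<epsilon> = 1 / real E \<and> \<delta> = 1 / real \<Delta> \<and>
      \<beta>0 = 1 / real B \<and> G = max (2 * n * B) (4 * \<Delta>) \<and> \<gamma> n \<delta> \<beta>0 = 1 / real G \<and>
      b \<epsilon> \<delta> = fast_sample_params.threshold E \<delta> \<and>
      H n \<epsilon> \<delta> \<beta>0 = stability_histogram (fast_sample n (1 / real E) (1 / real G)) (fast_sample_params.d n E G)
        (fast_sample_params.threshold E \<delta>)"
    if in_P: "(n, m, \<epsilon>, \<delta>, \<beta>0) \<in> P" for n m \<epsilon> \<delta> \<beta>0
  proof -
    obtain E where E0: "E \<ge> 1" "\<epsilon> = 1 / real E" using in_P by (auto simp: P elim: unit_fractionsE)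
    obtain \<Delta> where D0: "\<Delta> \<ge> 1" "\<delta> = 1 / real \<Delta>" using in_P by (auto simp: P elim: unit_fractionsE)
    obtain B where B0: "B \<ge> 1" "\<beta>0 = 1 / real B" using in_P by (auto simp: P elim: unit_fractionsE)
    have n0: "n \<ge> 1" using in_P by (simp add: P)
    define G where "G = max (2 * n * B) (4 * \<Delta>)"
    have "G \<ge> 4" using D0 by (simp add: G_def)
    then interpret fast_sample_params n E G using n0 E0 by unfold_locales auto
    have "1 / real G = min (1 / real (2 * n * B)) (1 / real (4 * \<Delta>))"
      using n0 B0 D0 unfolding G_def by (intro inverse_max) auto
    then have \<gamma>G: "\<gamma> n \<delta> \<beta>0 = 1 / real G"
      unfolding \<gamma> B0(2) D0(2) by (simp add: mult_ac)
    have bt: "b \<epsilon> \<delta> = threshold \<delta>" unfolding b threshold_def E0(2) by simp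
    have "H n \<epsilon> \<delta> \<beta>0 = stability_histogram fs d (threshold \<delta>)"
      unfolding H \<gamma>G bt unfolding E0(2) fs_d_eq ..
    then show ?thesis
      using fast_sample_params_axioms E0 D0 B0 G_def \<gamma>G bt by blast
  qed
  show ?thesis
  proof (intro conjI allI impI)
    show "\<forall>(n, m, \<epsilon>, \<delta>, \<beta>0) \<in> P.
              differentially_private n m \<epsilon> \<delta> (H n \<epsilon> \<delta> \<beta>0) \<and>
              (\<forall>\<beta> \<ge> 2 * \<gamma> n \<delta> \<beta>0.
                 per_query_accuracy n m \<lceil>9 / (2 * \<epsilon>) * ln (2 / \<beta>)\<rceil> \<beta>
                   (2 + \<lceil>9 / (2 * \<epsilon>) * ln (8 / (\<beta> * \<delta>))\<rceil>) (H n \<epsilon> \<delta> \<beta>0)) \<and>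
              (\<forall>\<beta> \<ge> \<beta>0.
                 simultaneous_accuracy n m (2 + \<lceil>9 / (2 * \<epsilon>) * ln (8 * real n / (\<beta> * \<delta>))\<rceil>) \<beta>
                   (H n \<epsilon> \<delta> \<beta>0))"
    proof (safe del: conjI)
      fix n m \<epsilon> \<delta> \<beta>0 assume in_P: "(n, m, \<epsilon>, \<delta>, \<beta>0) \<in> P"
      obtain E B \<Delta> G where p: "fast_sample_params n E G" "E \<ge> 1" "B \<ge> 1" "\<Delta> \<ge> 1" "\<epsilon> = 1 / real E"
        "\<delta> = 1 / real \<Delta>" "\<beta>0 = 1 / real B" "\<gamma> n \<delta> \<beta>0 = 1 / real G"
        "H n \<epsilon> \<delta> \<beta>0 = stability_histogram (fast_sample n (1 / real E) (1 / real G)) (fast_sample_params.d n E G)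
          (fast_sample_params.threshold E \<delta>)"
        using params[OF in_P] by blast
      interpret fast_sample_params n E G by (rule p(1))
      have \<delta>: "0 < \<delta>" "\<delta> \<le> 1" using p by auto
      have \<gamma>\<delta>: "1 / real G \<le> \<delta> / 4" and \<gamma>\<beta>: "1 / real G \<le> \<beta>0 / (2 * real n)"
        unfolding p(8)[symmetric] by (simp_all add: \<gamma>)
      from \<gamma>\<beta> have n\<gamma>: "2 * real n * (1 / real G) \<le> \<beta>0" using n by (simp add: field_simps)
      show "differentially_private n m \<epsilon> \<delta> (H n \<epsilon> \<delta> \<beta>0) \<and>
              (\<forall>\<beta> \<ge> 2 * \<gamma> n \<delta> \<beta>0.
                 per_query_accuracy n m \<lceil>9 / (2 * \<epsilon>) * ln (2 / \<beta>)\<rceil> \<beta>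
                   (2 + \<lceil>9 / (2 * \<epsilon>) * ln (8 / (\<beta> * \<delta>))\<rceil>) (H n \<epsilon> \<delta> \<beta>0)) \<and>
              (\<forall>\<beta> \<ge> \<beta>0.
                 simultaneous_accuracy n m (2 + \<lceil>9 / (2 * \<epsilon>) * ln (8 * real n / (\<beta> * \<delta>))\<rceil>) \<beta>
                   (H n \<epsilon> \<delta> \<beta>0))"
        unfolding p(8,9) unfolding p(5)
        using threshold_private[OF \<delta>(1) \<gamma>\<delta>] threshold_per_query[OF \<delta>] threshold_simultaneous[OF \<delta>] n\<gamma>
        by (meson order_trans)
    qed
  next
    fix mul_time :: "nat \<Rightarrow> nat" and K :: real
    assume "(\<lambda>x. real (mul_time x)) \<in> soft_bigo at_top real"
    then obtain C j where C: "0 \<le> C"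
      "\<And>x y. 2 \<le> x \<Longrightarrow> y \<le> x \<Longrightarrow> real (mul_time y) \<le> C * (real x * log 2 (real x) ^ j)"
      by (rule soft_bigo_envelope) blast
    define g :: "nat \<times> nat \<times> real \<times> real \<times> real \<Rightarrow> real" where
      "g = (\<lambda>(n, m, \<epsilon>, \<delta>, \<beta>0). real n / \<epsilon> * max 1 (log 2 (1 / (\<beta>0 * \<delta>))))"
    define h :: "nat \<times> nat \<times> real \<times> real \<times> real \<Rightarrow> real" where
      "h = (\<lambda>(n, m, \<epsilon>, \<delta>, \<beta>0). real n * log 2 (real n) * log 2 (real m))"
    define c1 where "c1 = 300 * ((4 + C) * 6 ^ j * 100) + 6 * \<bar>K\<bar>"
    define c2 where "c2 = 6 * \<bar>K\<bar> + 40"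
    \<comment> \<open>The witnesses are explicit multiples of the two bounds. Their constants depend
      only on \<open>mul_time\<close> and \<open>K\<close>, which makes the estimate uniform over
      \<open>Q\<close>.\<close>
    define T1 where "T1 z = c1 * (g z * log 2 (g z) ^ (j + 4))" for z
    define T2 where "T2 z = c2 * h z" for z
    have T1: "T1 \<in> soft_bigo (principal Q) g"
      unfolding soft_bigo_def T1_def
      by (intro UN_I[of "j + 4"] UNIV_I bigoI[of _ "\<bar>c1\<bar>"] always_eventually allI) (simp add: abs_mult)
    have T2: "T2 \<in> O[principal Q](h)"
      unfolding T2_def by (intro bigoI[of _ "\<bar>c2\<bar>"] always_eventually allI) (simp add: abs_mult)
    have time: "implements_within (stability_histogram_run w mul_time n (nat \<lfloor>1 / \<epsilon>\<rfloor>) (nat \<lfloor>1 / \<gamma> n \<delta> \<beta>0\<rfloor>) (b \<epsilon> \<delta>) D)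
        (H n \<epsilon> \<delta> \<beta>0 D) (T1 (n, m, \<epsilon>, \<delta>, \<beta>0) + T2 (n, m, \<epsilon>, \<delta>, \<beta>0))"
      if in_Q: "(n, m, \<epsilon>, \<delta>, \<beta>0) \<in> Q" and w: "word_length_ok K n m w" and D: "D \<in> datasets n m"
      for n m w D \<epsilon> \<delta> \<beta>0
    proof -
      have in_P: "(n, m, \<epsilon>, \<delta>, \<beta>0) \<in> P" and bn: "b \<epsilon> \<delta> \<le> n" using in_Q by (auto simp: Q)
      have nm: "1 \<le> n" "1 \<le> m" using in_P by (auto simp: P)
      obtain E B \<Delta> G where p: "fast_sample_params n E G" "E \<ge> 1" "B \<ge> 1" "\<Delta> \<ge> 1" "\<epsilon> = 1 / real E"
        "\<delta> = 1 / real \<Delta>" "\<beta>0 = 1 / real B" "G = max (2 * n * B) (4 * \<Delta>)" "\<gamma> n \<delta> \<beta>0 = 1 / real G"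
        "b \<epsilon> \<delta> = fast_sample_params.threshold E \<delta>"
        "H n \<epsilon> \<delta> \<beta>0 = stability_histogram (fast_sample n (1 / real E) (1 / real G)) (fast_sample_params.d n E G)
          (fast_sample_params.threshold E \<delta>)"
        using params[OF in_P] by blast
      have "8 \<le> b \<epsilon> \<delta>"
        unfolding p(10) using p(4,6) by (intro fast_sample_params.threshold_ge_8[OF p(1)]) auto
      then have n8: "8 \<le> n" using bn by simp
      interpret hp: histogram_params n E B \<Delta>
        using n8 p(2-4) by unfold_locales
      have G: "hp.G = G" by (simp add: hp.G_def p(8))
      have "1 / (\<beta>0 * \<delta>) = real (B * \<Delta>)" unfolding p(6,7) by simp
      then have g: "g (n, m, \<epsilon>, \<delta>, \<beta>0) = hp.g"
        unfolding g_def hp.g_def hp.\<Lambda>_def prod.case p(5) by simp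
      have nat_eq: "nat \<lfloor>1 / \<epsilon>\<rfloor> = E" "nat \<lfloor>1 / \<gamma> n \<delta> \<beta>0\<rfloor> = G" unfolding p(5,9) by simp_all
      have "\<exists>T. implements_within (stability_histogram_run w mul_time n E hp.G (b \<epsilon> \<delta>) D)
          (stability_histogram (fast_sample n (1 / real E) (1 / real hp.G)) hp.d (b \<epsilon> \<delta>) D) T \<and>
        T \<le> c1 * (hp.g * hp.L ^ (j + 4)) + c2 * (real n * log 2 (real n) * log 2 (real m))"
        unfolding c1_def c2_def
        by (rule hp.running_time[OF C(1) _ word_length_ok_le[OF w nm] abs_ge_zero nm(2) D bn]) (rule C(2))
      then obtain T where T: "implements_within (stability_histogram_run w mul_time n E hp.G (b \<epsilon> \<delta>) D)
          (stability_histogram (fast_sample n (1 / real E) (1 / real hp.G)) hp.d (b \<epsilon> \<delta>) D) T"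
        "T \<le> c1 * (hp.g * hp.L ^ (j + 4)) + c2 * (real n * log 2 (real n) * log 2 (real m))"
        by blast
      have "T \<le> T1 (n, m, \<epsilon>, \<delta>, \<beta>0) + T2 (n, m, \<epsilon>, \<delta>, \<beta>0)"
        using T(2) by (simp add: T1_def T2_def g h_def hp.L_def)
      with T(1) show ?thesis unfolding nat_eq p(11) G p(10) by (rule implements_within_mono)
    qed
    show "\<exists>T1 \<in> soft_bigo (principal Q) (\<lambda>(n, m, \<epsilon>, \<delta>, \<beta>0). real n / \<epsilon> * max 1 (log 2 (1 / (\<beta>0 * \<delta>)))).
           \<exists>T2 \<in> O[principal Q](\<lambda>(n, m, \<epsilon>, \<delta>, \<beta>0). real n * log 2 (real n) * log 2 (real m)).
           \<forall>(n, m, \<epsilon>, \<delta>, \<beta>0) \<in> Q.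
             (\<forall>w. word_length_ok K n m w \<longrightarrow>
               (\<forall>D \<in> datasets n m.
                  implements_within
                    (stability_histogram_run w mul_time n
                       (nat \<lfloor>1 / \<epsilon>\<rfloor>) (nat \<lfloor>1 / \<gamma> n \<delta> \<beta>0\<rfloor>) (b \<epsilon> \<delta>) D)
                    (H n \<epsilon> \<delta> \<beta>0 D)
                    (T1 (n, m, \<epsilon>, \<delta>, \<beta>0) + T2 (n, m, \<epsilon>, \<delta>, \<beta>0))))"
      unfolding g_def[symmetric] h_def[symmetric]
      by (rule bexI[OF _ T1], rule bexI[OF _ T2]) (use time in blast)
  qed
qed

end
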